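(* Let $(C,\triangle_\prec,\triangle_\succ)$ be a dendriform coalgebra and $M$ a bicomodule over it. Regard $M$ as a bicomodule over the associative coalgebra $(C,\triangle=\triangle_\prec+\triangle_\succ)$ with coactions $\triangle^l=\triangle^l_\prec+\triangle^l_\succ$ and $\triangle^r=\triangle^r_\prec+\triangle^r_\succ$. Then the map $S:C^n_{\mathrm{coDend}}(M,C)\to C^n_{\mathrm{coHoch}}(M,C)$, $n\ge1$, defined by $$S(f):=f_{[1]}+\cdots+f_{[n]}$$ commutes with the differentials, i.e. $\delta_{\mathrm{coHoch}}\circ S=S\circ\delta_{\mathrm{coDend}}$. Thus it induces a map $S_*:H^n_{\mathrm{coDend}}(M,C)\to H^n_{\mathrm{coHoch}}(M,C)$. Moreover, when $M=C$ (with the self bicomodule structure $\triangle^l_\prec=\triangle^r_\prec=\triangle_\prec$, $\triangle^l_\succ=\triangle^r_\succ=\triangle_\succ$), the induced map on cohomology is a morphism of Gerstenhaber algebras.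
   Context: All vector spaces, linear maps and tensor products are over a field $\mathbb K$ of characteristic zero. A dendriform coalgebra $(C,\triangle_\prec,\triangle_\succ)$ is a vector space $C$ with linear maps $\triangle_\prec,\triangle_\succ:C\to C\otimes C$ satisfying $(\triangle_\prec\otimes\mathrm{id})\triangle_\prec=(\mathrm{id}\otimes(\triangle_\prec+\triangle_\succ))\triangle_\prec$, $(\triangle_\succ\otimes\mathrm{id})\triangle_\prec=(\mathrm{id}\otimes\triangle_\prec)\triangle_\succ$, $((\triangle_\prec+\triangle_\succ)\otimes\mathrm{id})\triangle_\succ=(\mathrm{id}\otimes\triangle_\succ)\triangle_\succ$. Then $\triangle=\triangle_\prec+\triangle_\succ$ is coassociative. A bicomodule over $C$ is a vector space $M$ with linear maps $\triangle^l_\prec,\triangle^l_\succ:M\to C\otimes M$ and $\triangle^r_\prec,\triangle^r_\succ:M\to M\otimes C$ satisfying the nine identities $(\triangle_\prec\otimes\mathrm{id})\triangle^l_\prec=(\mathrm{id}\otimes(\triangle^l_\prec+\triangle^l_\succ))\triangle^l_\prec$, $(\triangle_\succ\otimes\mathrm{id})\triangle^l_\prec=(\mathrm{id}\otimes\triangle^l_\prec)\triangle^l_\succ$, $((\triangle_\prec+\triangle_\succ)\otimes\mathrm{id})\triangle^l_\succ=(\mathrm{id}\otimes\triangle^l_\succ)\triangle^l_\succ$; $(\triangle^l_\prec\otimes\mathrm{id})\triangle^r_\prec=(\mathrm{id}\otimes(\triangle^r_\prec+\triangle^r_\succ))\triangle^l_\prec$, $(\triangle^l_\succ\otimes\mathrm{id})\triangle^r_\prec=(\mathrm{id}\otimes\triangle^r_\prec)\triangle^l_\succ$,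 $((\triangle^l_\prec+\triangle^l_\succ)\otimes\mathrm{id})\triangle^r_\succ=(\mathrm{id}\otimes\triangle^r_\succ)\triangle^l_\succ$; $(\triangle^r_\prec\otimes\mathrm{id})\triangle^r_\prec=(\mathrm{id}\otimes(\triangle_\prec+\triangle_\succ))\triangle^r_\prec$, $(\triangle^r_\succ\otimes\mathrm{id})\triangle^r_\prec=(\mathrm{id}\otimes\triangle_\prec)\triangle^r_\succ$, $((\triangle^r_\prec+\triangle^r_\succ)\otimes\mathrm{id})\triangle^r_\succ=(\mathrm{id}\otimes\triangle_\succ)\triangle^r_\succ$. Combinatorial maps. $C_n=\{[1],\dots,[n]\}$ and $\mathbb K[C_n]$ is the vector space with basis $C_n$. For $m,n\ge1$, $1\le i\le m$ define $R_0^{m,i,n}:C_{m+n-1}\to C_m$ by $[r]\mapsto[r]$ if $r\le i-1$, $[r]\mapsto[i]$ if $i\le r\le i+n-1$, $[r]\mapsto[r-n+1]$ if $i+n\le r\le m+n-1$; and $R_1^{m,i,n}:C_{m+n-1}\to\mathbb K[C_n]$ by $[r]\mapsto[r-i+1]$ if $i\le r\le i+n-1$ and $[r]\mapsto[1]+\cdots+[n]$ otherwise. For $f\in\mathrm{Hom}(\mathbb K[C_n]\otimes X,Y)$ and $x\in\mathbb K[C_n]$ write $f_x=f(x;-):X\to Y$ (linear in $x$). Dendriform complex. Put $\triangle_{[1]}=\triangle_\prec$, $\triangle_{[2]}=\triangle_\succ$, $\triangle^l_{[1]}=\triangle^l_\prec$, $\triangle^l_{[2]}=\triangle^l_\succ$,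 $\triangle^r_{[1]}=\triangle^r_\prec$, $\triangle^r_{[2]}=\triangle^r_\succ$, extended linearly to $\mathbb K[C_2]$. $C^0_{\mathrm{coDend}}(M,C)=0$, $C^n_{\mathrm{coDend}}(M,C)=\mathrm{Hom}(\mathbb K[C_n]\otimes M,C^{\otimes n})$ for $n\ge1$, and for $[r]\in C_{n+1}$ $$(\delta_{\mathrm{coDend}}\sigma)_{[r]}=(\mathrm{id}\otimes\sigma_{R_1^{2,2,n}[r]})\circ\triangle^l_{R_0^{2,2,n}[r]}+\sum_{i=1}^n(-1)^i(\mathrm{id}^{\otimes(i-1)}\otimes\triangle_{R_1^{n,i,2}[r]}\otimes\mathrm{id}^{\otimes(n-i)})\circ\sigma_{R_0^{n,i,2}[r]}+(-1)^{n+1}(\sigma_{R_1^{2,1,n}[r]}\otimes\mathrm{id})\circ\triangle^r_{R_0^{2,1,n}[r]}.$$ coHochschild complex. For an associative coalgebra $(C,\triangle)$ and bicomodule $(M,\triangle^l,\triangle^r)$: $C^0_{\mathrm{coHoch}}(M,C)=0$, $C^n_{\mathrm{coHoch}}(M,C)=\mathrm{Hom}(M,C^{\otimes n})$ for $n\ge1$, and $\delta_{\mathrm{coHoch}}\sigma=(\mathrm{id}\otimes\sigma)\circ\triangle^l+\sum_{i=1}^n(-1)^i(\mathrm{id}^{\otimes(i-1)}\otimes\triangle\otimes\mathrm{id}^{\otimes(n-i)})\circ\sigma+(-1)^{n+1}(\sigma\otimes\mathrm{id})\circ\triangle^r$. Gerstenhaber structures for $M=C$. $\mathcal O(n)=\mathrm{Hom}(\mathbb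 K[C_n]\otimes C,C^{\otimes n})$ is a non-symmetric operad with $(f\bullet_ig)_{[r]}=(\mathrm{id}^{\otimes(i-1)}\otimes g_{R_1^{m,i,n}[r]}\otimes\mathrm{id}^{\otimes(m-i)})\circ f_{R_0^{m,i,n}[r]}$ ($f\in\mathcal O(m)$, $g\in\mathcal O(n)$), and the coendomorphism operad $\mathrm{coEnd}_C(n)=\mathrm{Hom}(C,C^{\otimes n})$ has $f\bullet_ig=(\mathrm{id}^{\otimes(i-1)}\otimes g\otimes\mathrm{id}^{\otimes(m-i)})\circ f$. In either operad, let $\pi$ be the multiplication given respectively by $(\triangle_\prec,\triangle_\succ)\in\mathcal O(2)$ and $\triangle_\prec+\triangle_\succ\in\mathrm{coEnd}_C(2)$. For $f,g$ of arities $m,n$ put $f\bullet g=\sum_{i=1}^m(-1)^{(i-1)(n-1)}f\bullet_ig$, $[f,g]=f\bullet g-(-1)^{(m-1)(n-1)}g\bullet f$, $f\cdot g=(-1)^{mn}(\pi\bullet_2g)\bullet_1f$. These induce on $\bigoplus_{n\ge1}H^n_{\mathrm{coDend}}(C,C)$ and $\bigoplus_{n\ge1}H^n_{\mathrm{coHoch}}(C,C)$ their Gerstenhaber algebra structures (graded commutative associative product, degree $-1$ graded Lie bracket, graded Leibniz rule). *)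

theory Defs
  imports Complex_Main "HOL-Library.Function_Algebras"
begin

section \<open>Tensor products of vector spaces\<close>

text \<open>
  A vector space over \<open>'k\<close> is a type with a scalar multiplication satisfying the library locale
  \<^locale>\<open>vector_space\<close>.  The library has no tensor products, so they are constructed here.

  Let \<open>\<Phi>\<close> be the set of multilinear forms on tuples \<open>w\<close> of vectors.  The pure tensor of \<open>w\<close> is
  evaluation at \<open>w\<close> of the forms in \<open>\<Phi>\<close>, and the tensor product is the span of the pure
  tensors.  Two formal sums of tuples thus denote the same tensor iff no multilinear form separates
  them; over a field this means that they agree modulo the multilinearity relations.  The
  universal property, for arbitrary target spaces, is proved below.  Sums, \<open>0\<close> and differences of
  tensors, and of maps into tensor products, are the pointwise ones of
  \<^theory>\<open>HOL-Library.Function_Algebras\<close>.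
\<close>

type_synonym ('w, 'k) tens = "('w \<Rightarrow> 'k) \<Rightarrow> 'k"

definition tscale :: "'k::field \<Rightarrow> ('w, 'k) tens \<Rightarrow> ('w, 'k) tens"
  where "tscale a t = (\<lambda>\<phi>. a * t \<phi>)"

definition pure_tensor :: "('w \<Rightarrow> 'k) set \<Rightarrow> 'w \<Rightarrow> ('w, 'k::field) tens"
  where "pure_tensor \<Phi> w = (\<lambda>\<phi>. if \<phi> \<in> \<Phi> then \<phi> w else 0)"

definition tensors :: "('w \<Rightarrow> 'k) set \<Rightarrow> 'w set \<Rightarrow> ('w, 'k::field) tens set"
  where "tensors \<Phi> W = module.span tscale (pure_tensor \<Phi> ` W)"

definition bilinear_forms ::
    "('k::field \<Rightarrow> 'a::ab_group_add \<Rightarrow> 'a) \<Rightarrow> ('k \<Rightarrow> 'b::ab_group_add \<Rightarrow> 'b) \<Rightarrow> ('a \<times> 'b \<Rightarrow> 'k) set"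
  where "bilinear_forms sA sB = {\<phi>.
    (\<forall>b. Vector_Spaces.linear sA (*) (\<lambda>a. \<phi> (a, b))) \<and>
    (\<forall>a. Vector_Spaces.linear sB (*) (\<lambda>b. \<phi> (a, b)))}"

definition trilinear_forms ::
    "('k::field \<Rightarrow> 'a::ab_group_add \<Rightarrow> 'a) \<Rightarrow> ('k \<Rightarrow> 'b::ab_group_add \<Rightarrow> 'b) \<Rightarrow>
     ('k \<Rightarrow> 'd::ab_group_add \<Rightarrow> 'd) \<Rightarrow> ('a \<times> 'b \<times> 'd \<Rightarrow> 'k) set"
  where "trilinear_forms sA sB sD = {\<phi>.
    (\<forall>b d. Vector_Spaces.linear sA (*) (\<lambda>a. \<phi> (a, b, d))) \<and>
    (\<forall>a d. Vector_Spaces.linear sB (*) (\<lambda>b. \<phi> (a, b, d))) \<and>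
    (\<forall>a b. Vector_Spaces.linear sD (*) (\<lambda>d. \<phi> (a, b, d)))}"

text \<open>Forms on the \<open>n\<close>-th power; the values on lists of other lengths are irrelevant.\<close>

definition multilinear_forms ::
    "('k::field \<Rightarrow> 'c::ab_group_add \<Rightarrow> 'c) \<Rightarrow> nat \<Rightarrow> ('c list \<Rightarrow> 'k) set"
  where "multilinear_forms s n = {\<phi>.
    \<forall>w i. length w = n \<longrightarrow> i < n \<longrightarrow> Vector_Spaces.linear s (*) (\<lambda>x. \<phi> (w[i := x]))}"

definition tensor2 ::
    "('k::field \<Rightarrow> 'a::ab_group_add \<Rightarrow> 'a) \<Rightarrow> ('k \<Rightarrow> 'b::ab_group_add \<Rightarrow> 'b) \<Rightarrow> ('a \<times> 'b, 'k) tens set"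
  where "tensor2 sA sB = tensors (bilinear_forms sA sB) UNIV"

definition tensor_power ::
    "('k::field \<Rightarrow> 'c::ab_group_add \<Rightarrow> 'c) \<Rightarrow> nat \<Rightarrow> ('c list, 'k) tens set"
  where "tensor_power s n = tensors (multilinear_forms s n) {w. length w = n}"

text \<open>\<open>Hom(X, T)\<close> for a subspace \<open>T\<close> of tensors\<close>

definition Hom :: "('k::field \<Rightarrow> 'x::ab_group_add \<Rightarrow> 'x) \<Rightarrow> ('w, 'k) tens set \<Rightarrow> ('x \<Rightarrow> ('w, 'k) tens) set"
  where "Hom s T = {f. Vector_Spaces.linear s tscale f \<and> range f \<subseteq> T}"

lemma vector_space_tscale: "vector_space (tscale :: 'k::field \<Rightarrow> ('w, 'k) tens \<Rightarrow> ('w, 'k) tens)"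
  by unfold_locales (auto simp: tscale_def fun_eq_iff algebra_simps)

lemma vector_space_mult: "vector_space ((*) :: 'k::field \<Rightarrow> 'k \<Rightarrow> 'k)"
  by unfold_locales (auto simp: algebra_simps)

lemma functional_separates:
  fixes s :: "'k::field \<Rightarrow> 'v::ab_group_add \<Rightarrow> 'v"
  assumes "vector_space s" "v \<noteq> 0"
  obtains l where "Vector_Spaces.linear s (*) l" "l v \<noteq> 0"
proof -
  interpret p: vector_space_pair s "(*) :: 'k \<Rightarrow> 'k \<Rightarrow> 'k"
    using assms(1) vector_space_mult by (simp add: vector_space_pair_def)
  have "p.vs1.independent {v}"
    using assms(2) by (simp add: p.vs1.independent_insert)
  then obtain l where "Vector_Spaces.linear s (*) l" "\<forall>x\<in>{v}. l x = 1"
    using p.linear_independent_extend[of "{v}" "\<lambda>_. 1"] by blast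
  then show thesis using that by auto
qed

text \<open>
  Universal property: \<open>f\<close> is multilinear as soon as its compositions with linear functionals
  are, and it then factors through the pure tensors.  The factorisation is unique on
  \<^term>\<open>tensors \<Phi> W\<close>, which the pure tensors span.
\<close>

lemma tensors_universal:
  fixes s :: "'k::field \<Rightarrow> 'v::ab_group_add \<Rightarrow> 'v" and f :: "'w \<Rightarrow> 'v"
  assumes s: "vector_space s"
    and f: "\<And>l. Vector_Spaces.linear s (*) l \<Longrightarrow> (\<lambda>w. l (f w)) \<in> \<Phi>"
  shows "\<exists>g. Vector_Spaces.linear tscale s g \<and> (\<forall>w\<in>W. g (pure_tensor \<Phi> w) = f w)"
proof -
  interpret p: vector_space_pair "tscale :: 'k \<Rightarrow> ('w, 'k) tens \<Rightarrow> ('w, 'k) tens" s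
    using s vector_space_tscale by (simp add: vector_space_pair_def)
  let ?P = "pure_tensor \<Phi> ` W"
  obtain B where B: "B \<subseteq> ?P" "p.vs1.independent B" "?P \<subseteq> p.vs1.span B"
    using p.vs1.maximal_independent_subset by blast
  define h where "h b = f (SOME w. w \<in> W \<and> pure_tensor \<Phi> w = b)" for b
  obtain g where g: "Vector_Spaces.linear tscale s g" "\<And>b. b \<in> B \<Longrightarrow> g b = h b"
    using p.linear_independent_extend[OF B(2), of h] by auto
  interpret g: Vector_Spaces.linear tscale s g by (rule g(1))
  have key: "l (g t) = t (\<lambda>w. l (f w))"
    if t: "t \<in> p.vs1.span B" and l: "Vector_Spaces.linear s (*) l" for t l
  proof -
    interpret l: Vector_Spaces.linear s "(*)" l by (rule l)
    show ?thesis using t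
    proof (induction rule: p.vs1.span_induct_alt)
      case base
      show ?case using g.zero l.zero by (simp add: zero_fun_def)
    next
      case (step c x y)
      from step(1) B(1) obtain w where "w \<in> W \<and> pure_tensor \<Phi> w = x" by blast
      then have "pure_tensor \<Phi> (SOME w. w \<in> W \<and> pure_tensor \<Phi> w = x) = x"
        by (metis (mono_tags, lifting) someI)
      from fun_cong[OF this, of "\<lambda>w. l (f w)"] have "l (h x) = x (\<lambda>w. l (f w))"
        using f[OF l] by (simp add: pure_tensor_def h_def)
      have "l (g (tscale c x + y)) = c * l (g x) + l (g y)"
        by (simp only: g.add g.scale l.add l.scale)
      then show ?case
        using step g(2)[OF step(1)] \<open>l (h x) = _\<close> by (simp add: tscale_def plus_fun_def)
    qed
  qed
  have "g (pure_tensor \<Phi> w) = f w" if w: "w \<in> W" for w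
  proof (rule ccontr)
    assume "\<not> ?thesis"
    then obtain l where l: "Vector_Spaces.linear s (*) l" "l (g (pure_tensor \<Phi> w) - f w) \<noteq> 0"
      using functional_separates[OF s, of "g (pure_tensor \<Phi> w) - f w"] by auto
    interpret l: Vector_Spaces.linear s "(*)" l by (rule l(1))
    have "l (g (pure_tensor \<Phi> w)) = l (f w)"
      using key[OF _ l(1), of "pure_tensor \<Phi> w"] B(3) w f[OF l(1)]
      by (auto simp: pure_tensor_def)
    then show False using l(2) by (simp add: l.diff)
  qed
  then show ?thesis using g(1) by blast
qed

lemma tensor2_universal:
  assumes s: "vector_space s"
    and "\<And>b. Vector_Spaces.linear sA s (\<lambda>a. f (a, b))" "\<And>a. Vector_Spaces.linear sB s (\<lambda>b. f (a, b))"
  shows "\<exists>g. Vector_Spaces.linear tscale s g \<and>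
    (\<forall>w. g (pure_tensor (bilinear_forms sA sB) w) = f w)"
proof -
  have "(\<lambda>w. l (f w)) \<in> bilinear_forms sA sB" if "Vector_Spaces.linear s (*) l" for l
    using Vector_Spaces.linear_compose[OF assms(2) that]
      Vector_Spaces.linear_compose[OF assms(3) that] by (simp add: bilinear_forms_def o_def)
  from tensors_universal[OF s this, where W = UNIV] show ?thesis by auto
qed

lemma tensor_power_universal:
  assumes s: "vector_space s"
    and "\<And>w i. length w = n \<Longrightarrow> i < n \<Longrightarrow> Vector_Spaces.linear sC s (\<lambda>x. f (w[i := x]))"
  shows "\<exists>g. Vector_Spaces.linear tscale s g \<and>
    (\<forall>w. length w = n \<longrightarrow> g (pure_tensor (multilinear_forms sC n) w) = f w)"
proof -
  have "(\<lambda>w. l (f w)) \<in> multilinear_forms sC n" if "Vector_Spaces.linear s (*) l" for l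
    using Vector_Spaces.linear_compose[OF assms(2) that] by (simp add: multilinear_forms_def o_def)
  from tensors_universal[OF s this, where W = "{w. length w = n}"] show ?thesis by auto
qed

text \<open>
  Tensor products of maps with identities.  Applying a tensor \<open>t\<close> to a form \<open>\<phi>\<close> means
  pairing \<open>t\<close> with \<open>\<phi>\<close>; to pair \<open>(f \<otimes> id) t\<close> with \<open>\<psi>\<close>, pair
  \<open>t\<close> with the form \<open>(a, d) \<mapsto> \<langle>f a, \<psi>(\<dots>, d)\<rangle>\<close>.  On a pure tensor
  \<open>a \<otimes> d\<close> this gives \<open>f a \<otimes> d\<close>.
\<close>

definition map_id ::
    "('k::field \<Rightarrow> 'x::ab_group_add \<Rightarrow> 'x) \<Rightarrow> ('k \<Rightarrow> 'y::ab_group_add \<Rightarrow> 'y) \<Rightarrow>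
     ('k \<Rightarrow> 'd::ab_group_add \<Rightarrow> 'd) \<Rightarrow> ('a \<Rightarrow> ('x \<times> 'y, 'k) tens) \<Rightarrow>
     ('a \<times> 'd, 'k) tens \<Rightarrow> ('x \<times> 'y \<times> 'd, 'k) tens"
  where "map_id sX sY sD f t = (\<lambda>\<psi>. if \<psi> \<in> trilinear_forms sX sY sD
    then t (\<lambda>(a, d). f a (\<lambda>(x, y). \<psi> (x, y, d))) else 0)"

definition id_map ::
    "('k::field \<Rightarrow> 'd::ab_group_add \<Rightarrow> 'd) \<Rightarrow> ('k \<Rightarrow> 'x::ab_group_add \<Rightarrow> 'x) \<Rightarrow>
     ('k \<Rightarrow> 'y::ab_group_add \<Rightarrow> 'y) \<Rightarrow> ('a \<Rightarrow> ('x \<times> 'y, 'k) tens) \<Rightarrow>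
     ('d \<times> 'a, 'k) tens \<Rightarrow> ('d \<times> 'x \<times> 'y, 'k) tens"
  where "id_map sD sX sY f t = (\<lambda>\<psi>. if \<psi> \<in> trilinear_forms sD sX sY
    then t (\<lambda>(d, a). f a (\<lambda>(x, y). \<psi> (d, x, y))) else 0)"

text \<open>\<open>id \<otimes> f : C \<otimes> X \<rightarrow> C\<^sup>n\<^sup>+\<^sup>1\<close> and \<open>f \<otimes> id : X \<otimes> C \<rightarrow> C\<^sup>n\<^sup>+\<^sup>1\<close>
  for \<open>f : X \<rightarrow> C\<^sup>n\<close> (tensor powers)\<close>

definition id_pow_map ::
    "('k::field \<Rightarrow> 'c::ab_group_add \<Rightarrow> 'c) \<Rightarrow> nat \<Rightarrow> ('x \<Rightarrow> ('c list, 'k) tens) \<Rightarrow>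
     ('c \<times> 'x, 'k) tens \<Rightarrow> ('c list, 'k) tens"
  where "id_pow_map s n f t = (\<lambda>\<psi>. if \<psi> \<in> multilinear_forms s (n + 1)
    then t (\<lambda>(c, x). f x (\<lambda>w. \<psi> (c # w))) else 0)"

definition pow_map_id ::
    "('k::field \<Rightarrow> 'c::ab_group_add \<Rightarrow> 'c) \<Rightarrow> nat \<Rightarrow> ('x \<Rightarrow> ('c list, 'k) tens) \<Rightarrow>
     ('x \<times> 'c, 'k) tens \<Rightarrow> ('c list, 'k) tens"
  where "pow_map_id s n f t = (\<lambda>\<psi>. if \<psi> \<in> multilinear_forms s (n + 1)
    then t (\<lambda>(x, c). f x (\<lambda>w. \<psi> (w @ [c]))) else 0)"

text \<open>\<open>id\<^sup>i\<^sup>-\<^sup>1 \<otimes> g \<otimes> id\<^sup>m\<^sup>-\<^sup>i\<close> on the \<open>m\<close>-th tensor power, for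
  \<open>g : C \<rightarrow> C\<^sup>n\<close> and \<open>1 \<le> i \<le> m\<close>\<close>

definition slot_map ::
    "('k::field \<Rightarrow> 'c::ab_group_add \<Rightarrow> 'c) \<Rightarrow> nat \<Rightarrow> nat \<Rightarrow> nat \<Rightarrow> ('c \<Rightarrow> ('c list, 'k) tens) \<Rightarrow>
     ('c list, 'k) tens \<Rightarrow> ('c list, 'k) tens"
  where "slot_map s m n i g t = (\<lambda>\<psi>. if \<psi> \<in> multilinear_forms s (m + n - 1)
    then t (\<lambda>w. g (w ! (i - 1)) (\<lambda>u. \<psi> (take (i - 1) w @ u @ drop i w))) else 0)"

text \<open>\<open>slot_map\<close> acts as expected on pure tensors.\<close>

lemma tensors_apply_linear:
  fixes t :: "('w,'k::field) tens"
  assumes t: "t \<in> tensors \<Phi> W" and P: "\<phi> \<in> \<Phi>" "\<phi>' \<in> \<Phi>" "\<phi>'' \<in> \<Phi>" 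
   and e: "\<And>w. w\<in>W \<Longrightarrow> \<phi>'' w = a * \<phi> w + b * \<phi>' w"
  shows "t \<phi>'' = a * t \<phi> + b * t \<phi>'"
proof -
  interpret v: vector_space "tscale :: 'k \<Rightarrow> ('w, 'k) tens \<Rightarrow> ('w, 'k) tens" by (rule vector_space_tscale)
  show ?thesis using t unfolding tensors_def
  proof (induction rule: v.span_induct_alt)
    case base then show ?case by simp
  next
    case (step c x y)
    then obtain w where w: "w\<in>W" "x = pure_tensor \<Phi> w" by auto
    then have "x \<phi>'' = a * x \<phi> + b * x \<phi>'" using P e[OF w(1)] by (simp add: pure_tensor_def)
    then show ?case using step by (simp add: tscale_def algebra_simps)
  qed
qed

lemma slot_map_form:
  assumes s: "vector_space s" and g: "g \<in> Hom s (tensor_power s n)" and i: "1 \<le> i" "i \<le> m" and \<psi>: "\<psi> \<in> multilinear_forms s (m+n-1)"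
  shows "(\<lambda>w. g (w ! (i - 1)) (\<lambda>u. \<psi> (take (i - 1) w @ u @ drop i w))) \<in> multilinear_forms s m"
  unfolding multilinear_forms_def mem_Collect_eq
proof (intro allI impI)
  fix w :: "'b list" and j assume w: "length w = m" "j < m"
  interpret g: Vector_Spaces.linear s tscale g using g by (simp add: Hom_def)
  have lin: "Vector_Spaces.linear s (*) (\<lambda>x. \<psi> (v[k:=x]))" if "length v = m+n-1" "k < m+n-1" for v k
    using \<psi> that by (simp add: multilinear_forms_def)
  have inner: "(\<lambda>u. \<psi> (take (i - 1) v @ u @ drop i v)) \<in> multilinear_forms s n" if v: "length v = m" for v
    unfolding multilinear_forms_def mem_Collect_eq
  proof (intro allI impI)
    fix u :: "'b list" and k assume u: "length u = n" "k < n"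
    have "(take (i - 1) v @ u @ drop i v)[i-1+k := x] = take (i - 1) v @ u[k:=x] @ drop i v" for x
      using u v i by (auto simp: list_update_append)
    moreover have "Vector_Spaces.linear s (*) (\<lambda>x. \<psi> ((take (i - 1) v @ u @ drop i v)[i-1+k:=x]))"
      by (rule lin) (use u v i in auto)
    ultimately show "Vector_Spaces.linear s (*) (\<lambda>x. \<psi> (take (i - 1) v @ u[k:=x] @ drop i v))" by simp
  qed
  show "Vector_Spaces.linear s (*) (\<lambda>x. g (w[j := x] ! (i - 1)) (\<lambda>u. \<psi> (take (i - 1) (w[j:=x]) @ u @ drop i (w[j:=x]))))"
  proof (cases "j = i-1")
    case True
    then have eq: "take (i - 1) (w[j:=x]) = take (i - 1) w" "drop i (w[j:=x]) = drop i w" "w[j := x] ! (i - 1) = x" for x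
      using w i by auto
    show ?thesis
      unfolding eq unfolding Vector_Spaces.linear_iff
      by (intro conjI allI s vector_space_mult) (simp_all only: g.add g.scale tscale_def plus_fun_def)
  next
    case False
    let ?F = "\<lambda>x u. \<psi> (take (i - 1) (w[j:=x]) @ u @ drop i (w[j:=x]))"
    define k where "k = (if j < i then j else j + n - 1)"
    have nn: "w[j := x] ! (i - 1) = w ! (i-1)" for x using False by simp
    have gi: "g (w!(i-1)) \<in> tensors (multilinear_forms s n) {w. length w = n}" using g by (auto simp: Hom_def tensor_power_def)
    have F: "?F x u = \<psi> ((take (i - 1) w @ u @ drop i w)[k:=x])" if "length u = n" for x u
    proof (cases "j < i")
      case True
      then show ?thesis using that w i False
        by (auto simp: k_def list_update_append take_update_swap)
    next
      case ge: False
      then have "k = length (take (i - 1) w) + (length u + (j - i))" "take (i - 1) (w[j := x]) = take (i - 1) w"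
        using that w i by (auto simp: k_def)
      then show ?thesis using ge w i by (auto simp: list_update_append drop_update_swap)
    qed
    have Fl: "Vector_Spaces.linear s (*) (\<lambda>x. ?F x u)" if "length u = n" for u
      unfolding F[OF that] by (rule lin) (use that w i False in \<open>auto simp: k_def\<close>)
    have FM: "?F x \<in> multilinear_forms s n" for x by (rule inner) (simp add: w)
    show ?thesis
      unfolding Vector_Spaces.linear_iff nn
    proof (intro conjI allI)
      fix x y
      show "g (w!(i-1)) (?F (x+y)) = g (w!(i-1)) (?F x) + g (w!(i-1)) (?F y)"
        using tensors_apply_linear[OF gi FM[of x] FM[of y] FM[of "x+y"], of 1 1] Fl by (simp add: Vector_Spaces.linear_iff)
      fix c
      show "g (w!(i-1)) (?F (s c x)) = c * g (w!(i-1)) (?F x)"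
        using tensors_apply_linear[OF gi FM[of x] FM[of x] FM[of "s c x"], of c 0] Fl by (simp add: Vector_Spaces.linear_iff)
    qed (use s vector_space_mult in auto)
  qed
qed

lemma slot_map_pure:
  assumes "vector_space s" "g \<in> Hom s (tensor_power s n)" "1 \<le> i" "i \<le> m" "length w = m"
     "g (w ! (i-1)) = pure_tensor (multilinear_forms s n) u" "length u = n"
  shows "slot_map s m n i g (pure_tensor (multilinear_forms s m) w) =
     pure_tensor (multilinear_forms s (m+n-1)) (take (i-1) w @ u @ drop i w)"
proof
  fix \<psi>
  show "slot_map s m n i g (pure_tensor (multilinear_forms s m) w) \<psi> =
     pure_tensor (multilinear_forms s (m+n-1)) (take (i-1) w @ u @ drop i w) \<psi>"
  proof (cases "\<psi> \<in> multilinear_forms s (m+n-1)")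
    case True
    have inner: "(\<lambda>u. \<psi> (take (i - 1) w @ u @ drop i w)) \<in> multilinear_forms s n" 
      unfolding multilinear_forms_def mem_Collect_eq
    proof (intro allI impI)
      fix u :: "'b list" and k assume u: "length u = n" "k < n"
      have "(take (i - 1) w @ u @ drop i w)[i-1+k := x] = take (i - 1) w @ u[k:=x] @ drop i w" for x
        using u assms by (auto simp: list_update_append)
      moreover have "Vector_Spaces.linear s (*) (\<lambda>x. \<psi> ((take (i - 1) w @ u @ drop i w)[i-1+k:=x]))"
        using True u assms by (simp add: multilinear_forms_def)
      ultimately show "Vector_Spaces.linear s (*) (\<lambda>x. \<psi> (take (i - 1) w @ u[k:=x] @ drop i w))" by simp
    qed
    show ?thesis using True slot_map_form[OF assms(1-4) True] inner assms(6) by (simp add: slot_map_def pure_tensor_def)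
  qed (simp add: slot_map_def pure_tensor_def)
qed

text \<open>The identification of \<open>C \<otimes> C\<close> (pairs) with the second tensor power (lists)\<close>

definition to_power2 ::
    "('k::field \<Rightarrow> 'c::ab_group_add \<Rightarrow> 'c) \<Rightarrow> ('c \<times> 'c, 'k) tens \<Rightarrow> ('c list, 'k) tens"
  where "to_power2 s t = (\<lambda>\<psi>. if \<psi> \<in> multilinear_forms s 2 then t (\<lambda>(x, y). \<psi> [x, y]) else 0)"


section \<open>Coalgebras and bicomodules\<close>

definition dendriform_coalgebra ::
    "('k::field \<Rightarrow> 'c::ab_group_add \<Rightarrow> 'c) \<Rightarrow>
     ('c \<Rightarrow> ('c \<times> 'c, 'k) tens) \<Rightarrow> ('c \<Rightarrow> ('c \<times> 'c, 'k) tens) \<Rightarrow> bool"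
  where "dendriform_coalgebra s Dp Ds \<longleftrightarrow>
    vector_space s \<and> Dp \<in> Hom s (tensor2 s s) \<and> Ds \<in> Hom s (tensor2 s s) \<and>
    map_id s s s Dp \<circ> Dp = id_map s s s (Dp + Ds) \<circ> Dp \<and>
    map_id s s s Ds \<circ> Dp = id_map s s s Dp \<circ> Ds \<and>
    map_id s s s (Dp + Ds) \<circ> Ds = id_map s s s Ds \<circ> Ds"

definition dendriform_bicomodule ::
    "('k::field \<Rightarrow> 'c::ab_group_add \<Rightarrow> 'c) \<Rightarrow>
     ('c \<Rightarrow> ('c \<times> 'c, 'k) tens) \<Rightarrow> ('c \<Rightarrow> ('c \<times> 'c, 'k) tens) \<Rightarrow>
     ('k \<Rightarrow> 'm::ab_group_add \<Rightarrow> 'm) \<Rightarrow>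
     ('m \<Rightarrow> ('c \<times> 'm, 'k) tens) \<Rightarrow> ('m \<Rightarrow> ('c \<times> 'm, 'k) tens) \<Rightarrow>
     ('m \<Rightarrow> ('m \<times> 'c, 'k) tens) \<Rightarrow> ('m \<Rightarrow> ('m \<times> 'c, 'k) tens) \<Rightarrow> bool"
  where "dendriform_bicomodule s Dp Ds sM lp ls rp rs \<longleftrightarrow>
    vector_space sM \<and>
    lp \<in> Hom sM (tensor2 s sM) \<and> ls \<in> Hom sM (tensor2 s sM) \<and>
    rp \<in> Hom sM (tensor2 sM s) \<and> rs \<in> Hom sM (tensor2 sM s) \<and>
    map_id s s sM Dp \<circ> lp = id_map s s sM (lp + ls) \<circ> lp \<and>
    map_id s s sM Ds \<circ> lp = id_map s s sM lp \<circ> ls \<and>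
    map_id s s sM (Dp + Ds) \<circ> ls = id_map s s sM ls \<circ> ls \<and>
    map_id s sM s lp \<circ> rp = id_map s sM s (rp + rs) \<circ> lp \<and>
    map_id s sM s ls \<circ> rp = id_map s sM s rp \<circ> ls \<and>
    map_id s sM s (lp + ls) \<circ> rs = id_map s sM s rs \<circ> ls \<and>
    map_id sM s s rp \<circ> rp = id_map sM s s (Dp + Ds) \<circ> rp \<and>
    map_id sM s s rs \<circ> rp = id_map sM s s Dp \<circ> rs \<and>
    map_id sM s s (rp + rs) \<circ> rs = id_map sM s s Ds \<circ> rs"

definition coassociative_coalgebra ::
    "('k::field \<Rightarrow> 'c::ab_group_add \<Rightarrow> 'c) \<Rightarrow> ('c \<Rightarrow> ('c \<times> 'c, 'k) tens) \<Rightarrow> bool"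
  where "coassociative_coalgebra s D \<longleftrightarrow>
    vector_space s \<and> D \<in> Hom s (tensor2 s s) \<and> map_id s s s D \<circ> D = id_map s s s D \<circ> D"

definition bicomodule ::
    "('k::field \<Rightarrow> 'c::ab_group_add \<Rightarrow> 'c) \<Rightarrow> ('c \<Rightarrow> ('c \<times> 'c, 'k) tens) \<Rightarrow>
     ('k \<Rightarrow> 'm::ab_group_add \<Rightarrow> 'm) \<Rightarrow>
     ('m \<Rightarrow> ('c \<times> 'm, 'k) tens) \<Rightarrow> ('m \<Rightarrow> ('m \<times> 'c, 'k) tens) \<Rightarrow> bool"
  where "bicomodule s D sM l r \<longleftrightarrow>
    vector_space sM \<and> l \<in> Hom sM (tensor2 s sM) \<and> r \<in> Hom sM (tensor2 sM s) \<and>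
    map_id s s sM D \<circ> l = id_map s s sM l \<circ> l \<and>
    map_id s sM s l \<circ> r = id_map s sM s r \<circ> l \<and>
    map_id sM s s r \<circ> r = id_map sM s s D \<circ> r"


section \<open>The combinatorial maps\<close>

text \<open>
  The element \<open>[r]\<close> of \<open>C\<^sub>n\<close> is the number \<open>r \<in> {1..n}\<close>, and a vector of \<open>\<bbbK>[C\<^sub>n]\<close> is
  its coefficient function.  A linear map \<open>f : \<bbbK>[C\<^sub>n] \<otimes> X \<rightarrow> Y\<close> is the family of linear maps
  \<open>f\<^sub>[\<^sub>r\<^sub>] : X \<rightarrow> Y\<close>, which is set to \<open>0\<close> for \<open>r \<notin> {1..n}\<close>; \<open>at_vector n f x\<close> is then \<open>f\<^sub>x\<close>.
\<close>

definition basis_vector :: "nat \<Rightarrow> nat \<Rightarrow> 'k::field"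
  where "basis_vector r = (\<lambda>j. if j = r then 1 else 0)"

definition R0 :: "nat \<Rightarrow> nat \<Rightarrow> nat \<Rightarrow> nat \<Rightarrow> nat"
  where "R0 m i n r = (if r \<le> i - 1 then r else if r \<le> i + n - 1 then i else r - n + 1)"

definition R1 :: "nat \<Rightarrow> nat \<Rightarrow> nat \<Rightarrow> nat \<Rightarrow> nat \<Rightarrow> 'k::field"
  where "R1 m i n r =
    (if i \<le> r \<and> r \<le> i + n - 1 then basis_vector (r - i + 1) else (\<Sum>j=1..n. basis_vector j))"

definition at_vector ::
    "nat \<Rightarrow> (nat \<Rightarrow> 'x \<Rightarrow> ('w, 'k::field) tens) \<Rightarrow> (nat \<Rightarrow> 'k) \<Rightarrow> 'x \<Rightarrow> ('w, 'k) tens"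
  where "at_vector n f v = (\<lambda>x. \<Sum>j=1..n. tscale (v j) (f j x))"

definition two_family :: "'a \<Rightarrow> 'a \<Rightarrow> nat \<Rightarrow> 'a::zero"
  where "two_family a b = (\<lambda>j. if j = 1 then a else if j = 2 then b else 0)"


section \<open>Cochain complexes and cohomology\<close>

record ('k, 'a) cochain_complex =
  cochains :: "nat \<Rightarrow> 'a set"
  diff :: "nat \<Rightarrow> 'a \<Rightarrow> 'a"
  cscale :: "'k \<Rightarrow> 'a \<Rightarrow> 'a"

definition cocycles :: "('k, 'a::ab_group_add) cochain_complex \<Rightarrow> nat \<Rightarrow> 'a set"
  where "cocycles K n = {f \<in> cochains K n. diff K n f = 0}"

definition coboundaries :: "('k, 'a::ab_group_add) cochain_complex \<Rightarrow> nat \<Rightarrow> 'a set"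
  where "coboundaries K n = (if n = 0 then {0} else diff K (n - 1) ` cochains K (n - 1))"

definition coclass :: "('k, 'a::ab_group_add) cochain_complex \<Rightarrow> nat \<Rightarrow> 'a \<Rightarrow> 'a set"
  where "coclass K n f = {f + b | b. b \<in> coboundaries K n}"

definition cohomology :: "('k, 'a::ab_group_add) cochain_complex \<Rightarrow> nat \<Rightarrow> 'a set set"
  where "cohomology K n = coclass K n ` cocycles K n"

text \<open>
  Operations induced on classes.  The unions are taken over all representatives, so they are
  again cohomology classes exactly when the result does not depend on the representatives.
\<close>

definition induced_map ::
    "('k, 'b::ab_group_add) cochain_complex \<Rightarrow> nat \<Rightarrow> ('a \<Rightarrow> 'b) \<Rightarrow> 'a set \<Rightarrow> 'b set"
  where "induced_map K n F X = (\<Union>f\<in>X. coclass K n (F f))"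

definition induced_op ::
    "('k, 'a::ab_group_add) cochain_complex \<Rightarrow> nat \<Rightarrow> ('a \<Rightarrow> 'a \<Rightarrow> 'a) \<Rightarrow> 'a set \<Rightarrow> 'a set \<Rightarrow> 'a set"
  where "induced_op K n F X Y = (\<Union>f\<in>X. \<Union>g\<in>Y. coclass K n (F f g))"

abbreviation cohomology_add ::
    "('k, 'a::ab_group_add) cochain_complex \<Rightarrow> nat \<Rightarrow> 'a set \<Rightarrow> 'a set \<Rightarrow> 'a set"
  where "cohomology_add K n \<equiv> induced_op K n (+)"

abbreviation cohomology_scale ::
    "('k, 'a::ab_group_add) cochain_complex \<Rightarrow> nat \<Rightarrow> 'k \<Rightarrow> 'a set \<Rightarrow> 'a set"
  where "cohomology_scale K n a \<equiv> induced_map K n (cscale K a)"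

definition cohomology_linear ::
    "('k, 'a::ab_group_add) cochain_complex \<Rightarrow> ('k, 'b::ab_group_add) cochain_complex \<Rightarrow> nat \<Rightarrow>
     ('a set \<Rightarrow> 'b set) \<Rightarrow> bool"
  where "cohomology_linear K L n F \<longleftrightarrow>
    (\<forall>X\<in>cohomology K n. F X \<in> cohomology L n) \<and>
    (\<forall>X\<in>cohomology K n. \<forall>Y\<in>cohomology K n.
      F (cohomology_add K n X Y) = cohomology_add L n (F X) (F Y)) \<and>
    (\<forall>a. \<forall>X\<in>cohomology K n. F (cohomology_scale K n a X) = cohomology_scale L n a (F X))"


section \<open>The dendriform and the coHochschild complex\<close>

definition coDend_cochains ::
    "('k::field \<Rightarrow> 'c::ab_group_add \<Rightarrow> 'c) \<Rightarrow> ('k \<Rightarrow> 'm::ab_group_add \<Rightarrow> 'm) \<Rightarrow> nat \<Rightarrow>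
     (nat \<Rightarrow> 'm \<Rightarrow> ('c list, 'k) tens) set"
  where "coDend_cochains s sM n = (if n = 0 then {0} else
    {f. (\<forall>r\<in>{1..n}. f r \<in> Hom sM (tensor_power s n)) \<and> (\<forall>r. r \<notin> {1..n} \<longrightarrow> f r = 0)})"

definition coDend_diff ::
    "('k::field \<Rightarrow> 'c::ab_group_add \<Rightarrow> 'c) \<Rightarrow>
     ('c \<Rightarrow> ('c \<times> 'c, 'k) tens) \<Rightarrow> ('c \<Rightarrow> ('c \<times> 'c, 'k) tens) \<Rightarrow>
     ('m \<Rightarrow> ('c \<times> 'm, 'k) tens) \<Rightarrow> ('m \<Rightarrow> ('c \<times> 'm, 'k) tens) \<Rightarrow>
     ('m \<Rightarrow> ('m \<times> 'c, 'k) tens) \<Rightarrow> ('m \<Rightarrow> ('m \<times> 'c, 'k) tens) \<Rightarrow>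
     nat \<Rightarrow> (nat \<Rightarrow> 'm \<Rightarrow> ('c list, 'k) tens) \<Rightarrow> nat \<Rightarrow> 'm \<Rightarrow> ('c list, 'k) tens"
  where "coDend_diff s Dp Ds lp ls rp rs n f = (if n = 0 then 0 else (\<lambda>r.
    if r \<notin> {1..n+1} then 0 else (\<lambda>x.
      id_pow_map s n (at_vector n f (R1 2 2 n r)) (two_family lp ls (R0 2 2 n r) x)
      + (\<Sum>i=1..n. tscale ((-1) ^ i)
          (slot_map s n 2 i
            (at_vector 2 (two_family (to_power2 s \<circ> Dp) (to_power2 s \<circ> Ds)) (R1 n i 2 r))
            (f (R0 n i 2 r) x)))
      + tscale ((-1) ^ (n + 1))
          (pow_map_id s n (at_vector n f (R1 2 1 n r)) (two_family rp rs (R0 2 1 n r) x)))))"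

definition coDend_complex where
  "coDend_complex s Dp Ds sM lp ls rp rs =
    \<lparr>cochains = coDend_cochains s sM,
     diff = coDend_diff s Dp Ds lp ls rp rs,
     cscale = (\<lambda>a f r x. tscale a (f r x))\<rparr>"

definition coHoch_cochains ::
    "('k::field \<Rightarrow> 'c::ab_group_add \<Rightarrow> 'c) \<Rightarrow> ('k \<Rightarrow> 'm::ab_group_add \<Rightarrow> 'm) \<Rightarrow> nat \<Rightarrow>
     ('m \<Rightarrow> ('c list, 'k) tens) set"
  where "coHoch_cochains s sM n = (if n = 0 then {0} else Hom sM (tensor_power s n))"

definition coHoch_diff ::
    "('k::field \<Rightarrow> 'c::ab_group_add \<Rightarrow> 'c) \<Rightarrow> ('c \<Rightarrow> ('c \<times> 'c, 'k) tens) \<Rightarrow>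
     ('m \<Rightarrow> ('c \<times> 'm, 'k) tens) \<Rightarrow> ('m \<Rightarrow> ('m \<times> 'c, 'k) tens) \<Rightarrow>
     nat \<Rightarrow> ('m \<Rightarrow> ('c list, 'k) tens) \<Rightarrow> 'm \<Rightarrow> ('c list, 'k) tens"
  where "coHoch_diff s D l r n f = (if n = 0 then 0 else (\<lambda>x.
      id_pow_map s n f (l x)
      + (\<Sum>i=1..n. tscale ((-1) ^ i) (slot_map s n 2 i (to_power2 s \<circ> D) (f x)))
      + tscale ((-1) ^ (n + 1)) (pow_map_id s n f (r x))))"

definition coHoch_complex where
  "coHoch_complex s D sM l r =
    \<lparr>cochains = coHoch_cochains s sM,
     diff = coHoch_diff s D l r,
     cscale = (\<lambda>a f x. tscale a (f x))\<rparr>"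

definition S_map :: "nat \<Rightarrow> (nat \<Rightarrow> 'm \<Rightarrow> ('c list, 'k::field) tens) \<Rightarrow> 'm \<Rightarrow> ('c list, 'k) tens"
  where "S_map n f = (\<Sum>r=1..n. f r)"


section \<open>Gerstenhaber algebras\<close>

text \<open>
  A graded vector space with components \<open>gcomp A n\<close>, \<open>n \<ge> 1\<close>, with a degree \<open>0\<close> product
  \<open>gprod A m n\<close> and a degree \<open>-1\<close> bracket \<open>gbracket A m n\<close> of elements of degrees \<open>m\<close>, \<open>n\<close>.
\<close>

record ('k, 'h) graded_algebra =
  gcomp :: "nat \<Rightarrow> 'h set"
  gadd :: "nat \<Rightarrow> 'h \<Rightarrow> 'h \<Rightarrow> 'h"
  gscale :: "nat \<Rightarrow> 'k \<Rightarrow> 'h \<Rightarrow> 'h"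
  gprod :: "nat \<Rightarrow> nat \<Rightarrow> 'h \<Rightarrow> 'h \<Rightarrow> 'h"
  gbracket :: "nat \<Rightarrow> nat \<Rightarrow> 'h \<Rightarrow> 'h \<Rightarrow> 'h"

definition carrier_vector_space :: "'h set \<Rightarrow> ('h \<Rightarrow> 'h \<Rightarrow> 'h) \<Rightarrow> ('k::field \<Rightarrow> 'h \<Rightarrow> 'h) \<Rightarrow> bool"
  where "carrier_vector_space V add sc \<longleftrightarrow>
    (\<forall>x\<in>V. \<forall>y\<in>V. add x y \<in> V \<and> add x y = add y x) \<and>
    (\<forall>x\<in>V. \<forall>y\<in>V. \<forall>z\<in>V. add (add x y) z = add x (add y z)) \<and>
    (\<exists>e\<in>V. \<forall>x\<in>V. add e x = x \<and> (\<exists>y\<in>V. add x y = e)) \<and>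
    (\<forall>a. \<forall>x\<in>V. sc a x \<in> V) \<and>
    (\<forall>a. \<forall>x\<in>V. \<forall>y\<in>V. sc a (add x y) = add (sc a x) (sc a y)) \<and>
    (\<forall>a b. \<forall>x\<in>V. sc (a + b) x = add (sc a x) (sc b x) \<and> sc (a * b) x = sc a (sc b x)) \<and>
    (\<forall>x\<in>V. sc 1 x = x)"

definition graded_bilinear ::
    "('k, 'h) graded_algebra \<Rightarrow> (nat \<Rightarrow> nat \<Rightarrow> nat) \<Rightarrow> (nat \<Rightarrow> nat \<Rightarrow> 'h \<Rightarrow> 'h \<Rightarrow> 'h) \<Rightarrow> bool"
  where "graded_bilinear A deg bl \<longleftrightarrow> (\<forall>m\<ge>1. \<forall>n\<ge>1.
    (\<forall>x\<in>gcomp A m. \<forall>y\<in>gcomp A n. bl m n x y \<in> gcomp A (deg m n) \<and>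
      (\<forall>a. bl m n (gscale A m a x) y = gscale A (deg m n) a (bl m n x y) \<and>
           bl m n x (gscale A n a y) = gscale A (deg m n) a (bl m n x y))) \<and>
    (\<forall>x\<in>gcomp A m. \<forall>x'\<in>gcomp A m. \<forall>y\<in>gcomp A n.
      bl m n (gadd A m x x') y = gadd A (deg m n) (bl m n x y) (bl m n x' y)) \<and>
    (\<forall>x\<in>gcomp A m. \<forall>y\<in>gcomp A n. \<forall>y'\<in>gcomp A n.
      bl m n x (gadd A n y y') = gadd A (deg m n) (bl m n x y) (bl m n x y')))"

definition gerstenhaber_algebra :: "('k::field, 'h) graded_algebra \<Rightarrow> bool"
  where "gerstenhaber_algebra A \<longleftrightarrow>
    (\<forall>n\<ge>1. carrier_vector_space (gcomp A n) (gadd A n) (gscale A n)) \<and>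
    graded_bilinear A (\<lambda>m n. m + n) (gprod A) \<and>
    graded_bilinear A (\<lambda>m n. m + n - 1) (gbracket A) \<and>
    (\<forall>m\<ge>1. \<forall>n\<ge>1. \<forall>x\<in>gcomp A m. \<forall>y\<in>gcomp A n.
      gprod A m n x y = gscale A (m + n) ((-1) ^ (m * n)) (gprod A n m y x) \<and>
      gbracket A m n x y =
        gscale A (m + n - 1) (- ((-1) ^ ((m - 1) * (n - 1)))) (gbracket A n m y x)) \<and>
    (\<forall>m\<ge>1. \<forall>n\<ge>1. \<forall>p\<ge>1. \<forall>x\<in>gcomp A m. \<forall>y\<in>gcomp A n. \<forall>z\<in>gcomp A p.
      gprod A (m + n) p (gprod A m n x y) z = gprod A m (n + p) x (gprod A n p y z) \<and>
      gbracket A m (n + p - 1) x (gbracket A n p y z) =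
        gadd A (m + n + p - 2)
          (gbracket A (m + n - 1) p (gbracket A m n x y) z)
          (gscale A (m + n + p - 2) ((-1) ^ ((m - 1) * (n - 1)))
            (gbracket A n (m + p - 1) y (gbracket A m p x z))) \<and>
      gbracket A m (n + p) x (gprod A n p y z) =
        gadd A (m + n + p - 1)
          (gprod A (m + n - 1) p (gbracket A m n x y) z)
          (gscale A (m + n + p - 1) ((-1) ^ ((m - 1) * n))
            (gprod A n (m + p - 1) y (gbracket A m p x z))))"

text \<open>A morphism is given by its homogeneous components \<open>F n\<close>.\<close>

definition gerstenhaber_morphism ::
    "('k::field, 'h) graded_algebra \<Rightarrow> ('k, 'j) graded_algebra \<Rightarrow> (nat \<Rightarrow> 'h \<Rightarrow> 'j) \<Rightarrow> bool"
  where "gerstenhaber_morphism A B F \<longleftrightarrow>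
    gerstenhaber_algebra A \<and> gerstenhaber_algebra B \<and>
    (\<forall>n\<ge>1. (\<forall>x\<in>gcomp A n. F n x \<in> gcomp B n \<and>
        (\<forall>a. F n (gscale A n a x) = gscale B n a (F n x))) \<and>
      (\<forall>x\<in>gcomp A n. \<forall>y\<in>gcomp A n. F n (gadd A n x y) = gadd B n (F n x) (F n y))) \<and>
    (\<forall>m\<ge>1. \<forall>n\<ge>1. \<forall>x\<in>gcomp A m. \<forall>y\<in>gcomp A n.
      F (m + n) (gprod A m n x y) = gprod B m n (F m x) (F n y) \<and>
      F (m + n - 1) (gbracket A m n x y) = gbracket B m n (F m x) (F n y))"

text \<open>
  The operations on cochains, for partial compositions \<open>pc m n i f g = f \<bullet>\<^sub>i g\<close> (\<open>f\<close>, \<open>g\<close> of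
  arities \<open>m\<close>, \<open>n\<close>), scalar multiplication \<open>sc\<close> and multiplication \<open>\<pi>\<close> of arity \<open>2\<close>.
\<close>

type_synonym 'a partial_comp = "nat \<Rightarrow> nat \<Rightarrow> nat \<Rightarrow> 'a \<Rightarrow> 'a \<Rightarrow> 'a"

definition operad_bullet ::
    "'a::ab_group_add partial_comp \<Rightarrow> ('k::field \<Rightarrow> 'a \<Rightarrow> 'a) \<Rightarrow> nat \<Rightarrow> nat \<Rightarrow> 'a \<Rightarrow> 'a \<Rightarrow> 'a"
  where "operad_bullet pc sc m n f g =
    (\<Sum>i=1..m. sc ((-1) ^ ((i - 1) * (n - 1))) (pc m n i f g))"

definition operad_bracket ::
    "'a::ab_group_add partial_comp \<Rightarrow> ('k::field \<Rightarrow> 'a \<Rightarrow> 'a) \<Rightarrow> nat \<Rightarrow> nat \<Rightarrow> 'a \<Rightarrow> 'a \<Rightarrow> 'a"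
  where "operad_bracket pc sc m n f g =
    operad_bullet pc sc m n f g
    - sc ((-1) ^ ((m - 1) * (n - 1))) (operad_bullet pc sc n m g f)"

definition operad_prod ::
    "'a::ab_group_add partial_comp \<Rightarrow> ('k::field \<Rightarrow> 'a \<Rightarrow> 'a) \<Rightarrow> 'a \<Rightarrow> nat \<Rightarrow> nat \<Rightarrow> 'a \<Rightarrow> 'a \<Rightarrow> 'a"
  where "operad_prod pc sc \<pi> m n f g =
    sc ((-1) ^ (m * n)) (pc (n + 1) m 1 (pc 2 n 2 \<pi> g) f)"

definition cohomology_gerstenhaber ::
    "('k::field, 'a::ab_group_add) cochain_complex \<Rightarrow> 'a partial_comp \<Rightarrow> 'a \<Rightarrow>
     ('k, 'a set) graded_algebra"
  where "cohomology_gerstenhaber K pc \<pi> =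
    \<lparr>gcomp = cohomology K,
     gadd = cohomology_add K,
     gscale = cohomology_scale K,
     gprod = (\<lambda>m n. induced_op K (m + n) (operad_prod pc (cscale K) \<pi> m n)),
     gbracket = (\<lambda>m n. induced_op K (m + n - 1) (operad_bracket pc (cscale K) m n))\<rparr>"

definition coDend_comp ::
    "('k::field \<Rightarrow> 'c::ab_group_add \<Rightarrow> 'c) \<Rightarrow> (nat \<Rightarrow> 'c \<Rightarrow> ('c list, 'k) tens) partial_comp"
  where "coDend_comp s m n i f g = (\<lambda>r. if r \<notin> {1..m+n-1} then 0 else
    slot_map s m n i (at_vector n g (R1 m i n r)) \<circ> f (R0 m i n r))"

definition coEnd_comp ::
    "('k::field \<Rightarrow> 'c::ab_group_add \<Rightarrow> 'c) \<Rightarrow> ('c \<Rightarrow> ('c list, 'k) tens) partial_comp"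
  where "coEnd_comp s m n i f g = slot_map s m n i g \<circ> f"

definition coDend_gerstenhaber where
  "coDend_gerstenhaber s Dp Ds =
    cohomology_gerstenhaber (coDend_complex s Dp Ds s Dp Ds Dp Ds) (coDend_comp s)
      (two_family (to_power2 s \<circ> Dp) (to_power2 s \<circ> Ds))"

definition coHoch_gerstenhaber where
  "coHoch_gerstenhaber s D =
    cohomology_gerstenhaber (coHoch_complex s D s D D) (coEnd_comp s) (to_power2 s \<circ> D)"

end

theory Submission
  imports Defs
begin

text \<open>
  Summation over labels commutes with the whole structure for one combinatorial reason.  As
  \<open>[r]\<close> runs through \<open>C\<^bsub>m+n-1\<^esub>\<close>, the pair \<open>(R\<^sub>0[r], R\<^sub>1[r])\<close> runs once through the pairs
  \<open>([q], [1] + \<dots> + [n])\<close> with \<open>q \<noteq> i\<close> and, inside the block of \<open>i\<close>, through the pairs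
  \<open>([i], [j])\<close>, whose second entries again add up to \<open>[1] + \<dots> + [n]\<close>.  So for every biadditive
  \<open>B\<close> the sum of \<open>B(f\<^bsub>R\<^sub>0[r]\<^esub>, g\<^bsub>R\<^sub>1[r]\<^esub>)\<close> over all \<open>r\<close> is \<open>B(S f, S g)\<close> (\<open>sum_labels\<close>).  Applied to the
  three kinds of terms of the differential this gives \<open>\<delta> \<circ> S = S \<circ> \<delta>\<close>
  (\<open>coDend_coHoch_chain_map\<close>); applied to partial compositions it says that \<open>S\<close> is a morphism of
  operads (\<open>S_map_coDend_comp\<close>), and it sends \<open>(\<triangle>\<^sub>\<prec>, \<triangle>\<^sub>\<succ>)\<close> to \<open>\<triangle>\<^sub>\<prec> + \<triangle>\<^sub>\<succ>\<close>.

  For \<open>M = C\<close> both complexes are complexes of an operad with multiplication \<open>\<pi>\<close>, in which the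
  differential is \<open>[\<pi>, -]\<close> up to sign and product and bracket are expressed through partial
  compositions.  A morphism of operads that respects the multiplications therefore commutes with
  all operations already on cochains, and the only remaining task is to see that the
  operations really define Gerstenhaber algebras on cohomology.

  That is Gerstenhaber's theorem for operads with multiplication
  (\<open>cohomology_gerstenhaber_algebra\<close>).  After suspension all signs become Koszul signs, and
  everything follows from three identities for the braces \<open>f{g}\<close>, \<open>f{g, h}\<close>, \<open>f{g, h, w}\<close>
  (\<open>pre_associator\<close>, \<open>pre_brace2_left\<close>, \<open>brace2_pre_left\<close>): the first, the pre-Lie identity, yields
  the Jacobi identity, \<open>d \<circ> d = 0\<close>, and that \<open>d\<close> is a derivation of the bracket; the others show
  that \<open>d\<close> is a derivation of the cup product \<open>\<pi>{x, y}\<close>;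
  \<open>x{y}\<close> is a homotopy for graded commutativity of the cup product, and \<open>x{y, z}\<close> is
  one for the Leibniz rule.

  The operad axioms for the coendomorphism operad are checked on pure tensors; there the
  exchange of two insertions in different slots is a Fubini rule for pairing two tensors with one
  form (\<open>tensor_fubini\<close>).  The axioms for the dendriform operad follow from these, label by label,
  and its multiplication is associative exactly by the three dendriform identities.
\<close>

section \<open>Signs\<close>

text \<open>
  The sign \<open>(-1)\<^sup>k\<close> on an abelian group; the brace calculus is purely additive.
\<close>

definition sg :: "nat \<Rightarrow> 'a::ab_group_add \<Rightarrow> 'a"
  where "sg k x = (if even k then x else - x)"

lemma sg_0 [simp]: "sg 0 x = x"
  by (simp add: sg_def)

lemma sg_add_exp: "sg (k + l) x = sg k (sg l x)"
  by (simp add: sg_def)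

lemma sg_add: "sg k (x + y) = sg k x + sg k y"
  by (simp add: sg_def)

lemma sg_Suc: "sg (Suc k) x = - sg k x"
  by (simp add: sg_def)

lemma sg_zero [simp]: "sg k 0 = 0"
  by (simp add: sg_def)

lemma sg_minus: "sg k (- x) = - sg k x"
  by (simp add: sg_def)

lemma sg_diff: "sg k (x - y) = sg k x - sg k y"
  by (simp add: sg_def)

lemma sg_sum: "sg k (\<Sum>i\<in>I. f i) = (\<Sum>i\<in>I. sg k (f i))"
  by (simp add: sg_def sum_negf)

lemma sg_sg [simp]: "sg k (sg k x) = x"
  by (simp add: sg_def)

lemma scale_sign_eq_sg:
  assumes "vector_space (sc :: 'k::field \<Rightarrow> 'a::ab_group_add \<Rightarrow> 'a)"
  shows "sc ((-1) ^ k) x = sg k x"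
proof -
  interpret vector_space sc by fact
  show ?thesis by (cases "even k") (simp_all add: sg_def)
qed

section \<open>Brace calculus in a suspended operad\<close>

text \<open>
  The slots of a composite that has a block of \<open>b + 1\<close> slots in place of slot \<open>i\<close> lie before the
  block, in it, or after it.  This lemma and its variants split sums over slots accordingly.
\<close>

lemma sum_block_split:
  fixes \<phi> :: "nat \<Rightarrow> 'a::ab_group_add"
  assumes "i \<le> a"
  shows "(\<Sum>l\<le>a+b. \<phi> l) = (\<Sum>l<i. \<phi> l) + (\<Sum>j\<le>b. \<phi> (i+j)) + (\<Sum>k\<in>{i<..a}. \<phi> (k+b))"
proof -
  have "{..a+b} = {..<i} \<union> ({i..i+b} \<union> {i+b<..a+b})" using assms by auto
  then have "(\<Sum>l\<le>a+b. \<phi> l) = (\<Sum>l<i. \<phi> l) + ((\<Sum>l\<in>{i..i+b}. \<phi> l) + (\<Sum>l\<in>{i+b<..a+b}. \<phi> l))"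
    by (simp only:) (subst sum.union_disjoint; auto)+
  moreover have "(\<Sum>l\<in>{i..i+b}. \<phi> l) = (\<Sum>j\<le>b. \<phi> (i+j))"
    by (rule sum.reindex_bij_witness[where i="\<lambda>j. i+j" and j="\<lambda>l. l-i"]) auto
  moreover have "(\<Sum>l\<in>{i+b<..a+b}. \<phi> l) = (\<Sum>k\<in>{i<..a}. \<phi> (k+b))"
    by (rule sum.reindex_bij_witness[where i="\<lambda>j. j+b" and j="\<lambda>l. l-b"]) auto
  ultimately show ?thesis by simp
qed

lemma sum_block_split_lessThan:
  fixes \<phi> :: "nat \<Rightarrow> 'a::ab_group_add"
  assumes "i < k"
  shows "(\<Sum>l<k+b. \<phi> l) = (\<Sum>l<i. \<phi> l) + (\<Sum>j\<le>b. \<phi> (i+j)) + (\<Sum>l\<in>{i<..<k}. \<phi> (l+b))"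
proof -
  obtain k' where k: "k = Suc k'" using assms by (cases k) auto
  have "{..<k+b} = {..k'+b}" "{i<..<k} = {i<..k'}" using k by auto
  then show ?thesis using sum_block_split[of i k' \<phi> b] assms k by simp
qed

lemma sum_block_split_greater_left:
  fixes \<phi> :: "nat \<Rightarrow> 'a::ab_group_add"
  assumes "p < i" "i \<le> a"
  shows "(\<Sum>q\<in>{p<..a+b}. \<phi> q) =
    (\<Sum>q\<in>{p<..<i}. \<phi> q) + (\<Sum>j\<le>b. \<phi> (i+j)) + (\<Sum>k\<in>{i<..a}. \<phi> (k+b))"
proof -
  have "(\<Sum>l\<le>a+b. \<phi> l) = (\<Sum>l\<le>p. \<phi> l) + (\<Sum>q\<in>{p<..a+b}. \<phi> q)"
    by (subst sum.union_disjoint[symmetric]) (use assms in \<open>auto intro!: sum.cong\<close>)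
  moreover have "(\<Sum>l<i. \<phi> l) = (\<Sum>l\<le>p. \<phi> l) + (\<Sum>q\<in>{p<..<i}. \<phi> q)"
    by (subst sum.union_disjoint[symmetric]) (use assms in \<open>auto intro!: sum.cong\<close>)
  ultimately show ?thesis using sum_block_split[OF assms(2), of \<phi> b] by simp
qed

lemma sum_block_split_greater_inner:
  fixes \<phi> :: "nat \<Rightarrow> 'a::ab_group_add"
  assumes "i \<le> a" "j \<le> b"
  shows "(\<Sum>q\<in>{i+j<..a+b}. \<phi> q) = (\<Sum>j'\<in>{j<..b}. \<phi> (i+j')) + (\<Sum>k\<in>{i<..a}. \<phi> (k+b))"
proof -
  have "{i+j<..a+b} = {i+j<..i+b} \<union> {i+b<..a+b}" using assms by auto
  then have "(\<Sum>q\<in>{i+j<..a+b}. \<phi> q) = (\<Sum>q\<in>{i+j<..i+b}. \<phi> q) + (\<Sum>q\<in>{i+b<..a+b}. \<phi> q)"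
    by (simp only:) (subst sum.union_disjoint; auto)
  moreover have "(\<Sum>l\<in>{i+j<..i+b}. \<phi> l) = (\<Sum>j\<in>{j<..b}. \<phi> (i+j))"
    by (rule sum.reindex_bij_witness[where i="\<lambda>j. i+j" and j="\<lambda>l. l-i"]) auto
  moreover have "(\<Sum>l\<in>{i+b<..a+b}. \<phi> l) = (\<Sum>k\<in>{i<..a}. \<phi> (k+b))"
    by (rule sum.reindex_bij_witness[where i="\<lambda>j. j+b" and j="\<lambda>l. l-b"]) auto
  ultimately show ?thesis by simp
qed

lemma sum_shift_greater:
  fixes \<phi> :: "nat \<Rightarrow> 'a::ab_group_add"
  shows "(\<Sum>q\<in>{k+b<..a+b}. \<phi> q) = (\<Sum>l\<in>{k<..a}. \<phi> (l+b))"
  by (rule sum.reindex_bij_witness[where i="\<lambda>j. j+b" and j="\<lambda>l. l-b"]) auto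

lemma sum_triangle_swap:
  fixes \<phi> :: "nat \<Rightarrow> nat \<Rightarrow> 'a::ab_group_add"
  shows "(\<Sum>i\<le>a. \<Sum>l<i. \<phi> i l) = (\<Sum>l\<le>a. \<Sum>i\<in>{l<..a}. \<phi> i l)"
  unfolding sum.Sigma[OF finite_atMost ballI[OF finite_lessThan]]
    sum.Sigma[OF finite_atMost ballI[OF finite_greaterThanAtMost]]
  by (rule sum.reindex_bij_witness[where i="\<lambda>(l,i). (i,l)" and j="\<lambda>(i,l). (l,i)"]) auto

lemma sum_triangle_swap_greater:
  fixes \<phi> :: "nat \<Rightarrow> nat \<Rightarrow> 'a::ab_group_add"
  shows "(\<Sum>k\<in>{i<..a}. \<Sum>l\<in>{i<..<k}. \<phi> k l) = (\<Sum>l\<in>{i<..a}. \<Sum>k\<in>{l<..a}. \<phi> k l)"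
  unfolding sum.Sigma[OF finite_greaterThanAtMost ballI[OF finite_greaterThanLessThan]]
    sum.Sigma[OF finite_greaterThanAtMost ballI[OF finite_greaterThanAtMost]]
  by (rule sum.reindex_bij_witness[where i="\<lambda>(l,i). (i,l)" and j="\<lambda>(i,l). (l,i)"]) auto

text \<open>
  The partial compositions of a non-symmetric operad after suspension.  An element of arity
  \<open>a + 1\<close> has degree \<open>a\<close> and lies in \<open>Q a\<close>, slots are numbered from \<open>0\<close>, and \<open>C a b i\<close> is
  composition in slot \<open>i\<close> with the sign \<open>(-1)\<^sup>i\<^sup>b\<close>.  With this sign sequential composition is
  associative on the nose, and exchanging two parallel insertions costs the Koszul sign of their
  degrees.  Beyond slot \<open>a\<close> the value is meant to be \<open>0\<close>, which makes closure and additivity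
  unconditional in \<open>i\<close>.
\<close>

locale suspended_operad =
  fixes Q :: "nat \<Rightarrow> 'a::ab_group_add set"
    and C :: "nat \<Rightarrow> nat \<Rightarrow> nat \<Rightarrow> 'a \<Rightarrow> 'a \<Rightarrow> 'a"
  assumes Q_0 [simp]: "0 \<in> Q a"
    and Q_add: "f \<in> Q a \<Longrightarrow> f' \<in> Q a \<Longrightarrow> f + f' \<in> Q a"
    and Q_minus: "f \<in> Q a \<Longrightarrow> - f \<in> Q a"
    and C_closed: "f \<in> Q a \<Longrightarrow> g \<in> Q b \<Longrightarrow> C a b i f g \<in> Q (a + b)"
    and C_add_left: "f \<in> Q a \<Longrightarrow> f' \<in> Q a \<Longrightarrow> g \<in> Q b \<Longrightarrow>
      C a b i (f + f') g = C a b i f g + C a b i f' g"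
    and C_add_right: "f \<in> Q a \<Longrightarrow> g \<in> Q b \<Longrightarrow> g' \<in> Q b \<Longrightarrow>
      C a b i f (g + g') = C a b i f g + C a b i f g'"
    and C_seq: "i \<le> a \<Longrightarrow> j \<le> b \<Longrightarrow> f \<in> Q a \<Longrightarrow> g \<in> Q b \<Longrightarrow> h \<in> Q c \<Longrightarrow>
      C (a + b) c (i + j) (C a b i f g) h = C a (b + c) i f (C b c j g h)"
    and C_par: "i < k \<Longrightarrow> k \<le> a \<Longrightarrow> f \<in> Q a \<Longrightarrow> g \<in> Q b \<Longrightarrow> h \<in> Q c \<Longrightarrow>
      C (a + b) c (k + b) (C a b i f g) h = sg (b * c) (C (a + c) b i (C a c k f h) g)"
begin

lemma Q_sum: "(\<And>t. t \<in> T \<Longrightarrow> X t \<in> Q a) \<Longrightarrow> (\<Sum>t\<in>T. X t) \<in> Q a"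
  by (induction T rule: infinite_finite_induct) (auto intro: Q_add)

lemma Q_sg: "f \<in> Q a \<Longrightarrow> sg k f \<in> Q a"
  by (simp add: sg_def Q_minus)

lemma Q_diff: "f \<in> Q a \<Longrightarrow> f' \<in> Q a \<Longrightarrow> f - f' \<in> Q a"
  using Q_add[of f a "- f'"] by (simp add: Q_minus)

lemma C_zero_left: "g \<in> Q b \<Longrightarrow> C a b i 0 g = 0"
  using C_add_left[of 0 a 0 g b i] by simp

lemma C_zero_right: "f \<in> Q a \<Longrightarrow> C a b i f 0 = 0"
  using C_add_right[of f a 0 b 0 i] by simp

lemma C_minus_left: "f \<in> Q a \<Longrightarrow> g \<in> Q b \<Longrightarrow> C a b i (- f) g = - C a b i f g"
  using C_add_left[of f a "- f" g b i] by (simp add: Q_minus C_zero_left add_eq_0_iff)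

lemma C_minus_right: "f \<in> Q a \<Longrightarrow> g \<in> Q b \<Longrightarrow> C a b i f (- g) = - C a b i f g"
  using C_add_right[of f a g b "- g" i] by (simp add: Q_minus C_zero_right add_eq_0_iff)

lemma C_sg_left: "f \<in> Q a \<Longrightarrow> g \<in> Q b \<Longrightarrow> C a b i (sg k f) g = sg k (C a b i f g)"
  by (simp add: sg_def C_minus_left)

lemma C_sg_right: "f \<in> Q a \<Longrightarrow> g \<in> Q b \<Longrightarrow> C a b i f (sg k g) = sg k (C a b i f g)"
  by (simp add: sg_def C_minus_right)

lemma C_sum_left: "(\<And>t. t \<in> T \<Longrightarrow> X t \<in> Q a) \<Longrightarrow> g \<in> Q b \<Longrightarrow>
    C a b i (\<Sum>t\<in>T. X t) g = (\<Sum>t\<in>T. C a b i (X t) g)"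
  by (induction T rule: infinite_finite_induct) (auto simp: C_zero_left C_add_left Q_sum)

lemma C_sum_right: "(\<And>t. t \<in> T \<Longrightarrow> X t \<in> Q b) \<Longrightarrow> f \<in> Q a \<Longrightarrow>
    C a b i f (\<Sum>t\<in>T. X t) = (\<Sum>t\<in>T. C a b i f (X t))"
  by (induction T rule: infinite_finite_induct) (auto simp: C_zero_right C_add_right Q_sum)

text \<open>
  The case of a second insertion to the left of the first: it becomes the first one, and the slot of
  the other moves by its degree.
\<close>

lemma C_par': "l < i \<Longrightarrow> i \<le> a \<Longrightarrow> f \<in> Q a \<Longrightarrow> g \<in> Q b \<Longrightarrow> h \<in> Q c \<Longrightarrow>
    C (a + b) c l (C a b i f g) h = sg (b * c) (C (a + c) b (i + c) (C a c l f h) g)"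
  by (simp add: C_par[of l i a f h c g b] mult.commute)

text \<open>
  \<open>pre\<close>, \<open>brace2\<close> and \<open>brace3\<close> are the braces \<open>f{g}\<close>, \<open>f{g, h}\<close> and \<open>f{g, h, w}\<close>: the arguments are
  inserted into distinct slots of \<open>f\<close> in all ways that keep their order.  The index
  of a later insertion is shifted by the degrees of the earlier ones.
\<close>

definition pre :: "nat \<Rightarrow> nat \<Rightarrow> 'a \<Rightarrow> 'a \<Rightarrow> 'a"
  where "pre a b f g = (\<Sum>i\<le>a. C a b i f g)"

definition brace2 :: "nat \<Rightarrow> nat \<Rightarrow> nat \<Rightarrow> 'a \<Rightarrow> 'a \<Rightarrow> 'a \<Rightarrow> 'a"
  where "brace2 a b c f g h = (\<Sum>i\<le>a. \<Sum>k\<in>{i<..a}. C (a + b) c (k + b) (C a b i f g) h)"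

definition brace3 :: "nat \<Rightarrow> nat \<Rightarrow> nat \<Rightarrow> nat \<Rightarrow> 'a \<Rightarrow> 'a \<Rightarrow> 'a \<Rightarrow> 'a \<Rightarrow> 'a"
  where "brace3 a b c d f g h w = (\<Sum>i\<le>a. \<Sum>k\<in>{i<..a}. \<Sum>l\<in>{k<..a}.
    C (a + b + c) d (l + b + c) (C (a + b) c (k + b) (C a b i f g) h) w)"

lemma pre_closed: "f \<in> Q a \<Longrightarrow> g \<in> Q b \<Longrightarrow> pre a b f g \<in> Q (a + b)"
  by (simp add: pre_def Q_sum C_closed)

lemma brace2_closed: "f \<in> Q a \<Longrightarrow> g \<in> Q b \<Longrightarrow> h \<in> Q c \<Longrightarrow> brace2 a b c f g h \<in> Q (a + b + c)"
  by (auto simp: brace2_def intro!: Q_sum C_closed)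

lemma pre_add_left: "f \<in> Q a \<Longrightarrow> f' \<in> Q a \<Longrightarrow> g \<in> Q b \<Longrightarrow>
    pre a b (f + f') g = pre a b f g + pre a b f' g"
  by (simp add: pre_def C_add_left sum.distrib)

lemma pre_add_right: "f \<in> Q a \<Longrightarrow> g \<in> Q b \<Longrightarrow> g' \<in> Q b \<Longrightarrow>
    pre a b f (g + g') = pre a b f g + pre a b f g'"
  by (simp add: pre_def C_add_right sum.distrib)

lemma pre_sg_left: "f \<in> Q a \<Longrightarrow> g \<in> Q b \<Longrightarrow> pre a b (sg k f) g = sg k (pre a b f g)"
  by (simp add: pre_def C_sg_left sg_sum)

lemma pre_sg_right: "f \<in> Q a \<Longrightarrow> g \<in> Q b \<Longrightarrow> pre a b f (sg k g) = sg k (pre a b f g)"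
  by (simp add: pre_def C_sg_right sg_sum)

lemma brace2_add:
  assumes "f \<in> Q a" "g \<in> Q b" "h \<in> Q c"
  shows "f' \<in> Q a \<Longrightarrow> brace2 a b c (f + f') g h = brace2 a b c f g h + brace2 a b c f' g h"
    and "g' \<in> Q b \<Longrightarrow> brace2 a b c f (g + g') h = brace2 a b c f g h + brace2 a b c f g' h"
    and "h' \<in> Q c \<Longrightarrow> brace2 a b c f g (h + h') = brace2 a b c f g h + brace2 a b c f g h'"
  using assms
  by (simp_all add: brace2_def C_add_left C_add_right C_closed sum.distrib)

lemma brace2_sg:
  assumes "f \<in> Q a" "g \<in> Q b" "h \<in> Q c"
  shows "brace2 a b c (sg k f) g h = sg k (brace2 a b c f g h)"
    and "brace2 a b c f (sg k g) h = sg k (brace2 a b c f g h)"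
    and "brace2 a b c f g (sg k h) = sg k (brace2 a b c f g h)"
  using assms
  by (simp_all add: brace2_def C_sg_left C_sg_right C_closed sg_sum)

lemma pre_sum_left: "(\<And>t. t \<in> T \<Longrightarrow> X t \<in> Q a) \<Longrightarrow> g \<in> Q b \<Longrightarrow>
    pre a b (\<Sum>t\<in>T. X t) g = (\<Sum>t\<in>T. pre a b (X t) g)"
  by (simp add: pre_def C_sum_left) (rule sum.swap)

lemma brace2_zero_left: "g \<in> Q b \<Longrightarrow> h \<in> Q c \<Longrightarrow> brace2 a b c 0 g h = 0"
  by (simp add: brace2_def C_zero_left)

lemma brace2_sum_left: "(\<And>t. t \<in> T \<Longrightarrow> X t \<in> Q a) \<Longrightarrow> g \<in> Q b \<Longrightarrow> h \<in> Q c \<Longrightarrow>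
    brace2 a b c (\<Sum>t\<in>T. X t) g h = (\<Sum>t\<in>T. brace2 a b c (X t) g h)"
  by (induction T rule: infinite_finite_induct) (auto simp: brace2_add Q_sum brace2_zero_left)

text \<open>
  In \<open>(f{g}){h}\<close> the element \<open>h\<close> goes into a slot of \<open>g\<close>, which gives \<open>f{g{h}}\<close>, or into a slot of \<open>f\<close>
  to the right or to the left of \<open>g\<close>, which gives the two braces.
\<close>

theorem pre_associator:
  assumes f: "f \<in> Q a" and g: "g \<in> Q b" and h: "h \<in> Q c"
  shows "pre (a + b) c (pre a b f g) h =
    pre a (b + c) f (pre b c g h) + brace2 a b c f g h + sg (b * c) (brace2 a c b f h g)"
proof -
  let ?F = "\<lambda>i. C a b i f g"
  have F: "?F i \<in> Q (a + b)" for i using f g by (simp add: C_closed)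
  have *: "pre (a + b) c (?F i) h = (\<Sum>l<i. sg (b * c) (C (a + c) b (i + c) (C a c l f h) g))
      + C a (b + c) i f (pre b c g h) + (\<Sum>k\<in>{i<..a}. C (a + b) c (k + b) (?F i) h)"
    if i: "i \<le> a" for i
  proof -
    have "(\<Sum>l<i. C (a + b) c l (?F i) h) = (\<Sum>l<i. sg (b * c) (C (a + c) b (i + c) (C a c l f h) g))"
      by (intro sum.cong refl C_par') (use i f g h in auto)
    moreover have "(\<Sum>j\<le>b. C (a + b) c (i + j) (?F i) h) = C a (b + c) i f (pre b c g h)"
      using i f g h by (simp add: C_seq pre_def C_sum_right C_closed)
    ultimately show ?thesis unfolding pre_def[of "a + b"] by (simp add: sum_block_split[OF i])
  qed
  have "pre (a + b) c (pre a b f g) h = (\<Sum>i\<le>a. pre (a + b) c (?F i) h)"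
    unfolding pre_def[of a b] using F h by (simp add: pre_sum_left)
  also have "\<dots> = (\<Sum>i\<le>a. \<Sum>l<i. sg (b * c) (C (a + c) b (i + c) (C a c l f h) g))
      + pre a (b + c) f (pre b c g h) + brace2 a b c f g h"
    by (simp add: * sum.distrib pre_def[of a "b + c"] brace2_def)
  also have "(\<Sum>i\<le>a. \<Sum>l<i. sg (b * c) (C (a + c) b (i + c) (C a c l f h) g)) = sg (b * c) (brace2 a c b f h g)"
    unfolding sum_triangle_swap brace2_def sg_sum ..
  finally show ?thesis by (simp add: algebra_simps)
qed

text \<open>
  The five terms record where \<open>w\<close> is inserted: into \<open>h\<close>, into \<open>g\<close>, or into a slot of \<open>f\<close> to the right
  of both, between them, or to the left of both.
\<close>

theorem pre_brace2_left:
  assumes f: "f \<in> Q a" and g: "g \<in> Q b" and h: "h \<in> Q c" and w: "w \<in> Q d"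
  shows "pre (a + b + c) d (brace2 a b c f g h) w =
    brace2 a b (c + d) f g (pre c d h w) + sg (c * d) (brace2 a (b + d) c f (pre b d g w) h)
    + brace3 a b c d f g h w + sg (c * d) (brace3 a b d c f g w h)
    + sg (b * d + c * d) (brace3 a d b c f w g h)"
proof -
  let ?F = "\<lambda>i. C a b i f g"
  have F: "?F i \<in> Q (a + b)" for i using f g by (simp add: C_closed)
  let ?G = "\<lambda>i k. C (a + b) c (k + b) (?F i) h"
  have G: "?G i k \<in> Q (a + b + c)" for i k using F h by (simp add: C_closed)
  have *: "pre (a + b + c) d (?G i k) w =
      (\<Sum>l<i. sg (b * d + c * d) (C (a + d + b) c (k + d + b) (C (a + d) b (i + d) (C a d l f w) g) h))
    + sg (c * d) (C (a + (b + d)) c (k + (b + d)) (C a (b + d) i f (pre b d g w)) h)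
    + (\<Sum>l\<in>{i<..<k}. sg (c * d) (C (a + b + d) c (k + b + d) (C (a + b) d (l + b) (?F i) w) h))
    + C (a + b) (c + d) (k + b) (?F i) (pre c d h w)
    + (\<Sum>l\<in>{k<..a}. C (a + b + c) d (l + b + c) (?G i k) w)"
    if ik: "i < k" "k \<le> a" for i k
  proof -
    have i: "i \<le> a" using ik by simp
    have split: "pre (a + b + c) d (?G i k) w =
        (\<Sum>l<i. C (a + b + c) d l (?G i k) w) + (\<Sum>j\<le>b. C (a + b + c) d (i + j) (?G i k) w)
      + (\<Sum>l\<in>{i<..<k}. C (a + b + c) d (l + b) (?G i k) w)
      + (\<Sum>j\<le>c. C (a + b + c) d (k + b + j) (?G i k) w)
      + (\<Sum>l\<in>{k<..a}. C (a + b + c) d (l + b + c) (?G i k) w)"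
      unfolding pre_def using ik
      by (simp add: sum_block_split[of "k+b" "a+b"] sum_block_split_lessThan sum_shift_greater)
    have t: "C (a + b + c) d l (?G i k) w = sg (c * d) (C (a + b + d) c (k + b + d) (C (a + b) d l (?F i) w) h)"
      if "l < k + b" for l
      by (rule C_par') (use ik i that f g h w in \<open>auto simp: C_closed\<close>)
    have 1: "C (a + b + c) d l (?G i k) w =
        sg (b * d + c * d) (C (a + d + b) c (k + d + b) (C (a + d) b (i + d) (C a d l f w) g) h)"
      if "l < i" for l
    proof -
      have "C (a + b) d l (?F i) w = sg (b * d) (C (a + d) b (i + d) (C a d l f w) g)"
        by (rule C_par') (use i that f g w in auto)
      moreover have "C (a + d) b (i + d) (C a d l f w) g \<in> Q (a + b + d)"
        using C_closed[of "C a d l f w" "a + d" g b "i + d"] C_closed[of f a w d l] i that f g w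
        by (simp add: ac_simps)
      ultimately show ?thesis
        using t[of l] that ik h by (simp add: C_sg_left sg_add_exp ac_simps) (metis sg_add_exp add.commute)
    qed
    have 2: "(\<Sum>j\<le>b. C (a + b + c) d (i + j) (?G i k) w) =
        sg (c * d) (C (a + (b + d)) c (k + (b + d)) (C a (b + d) i f (pre b d g w)) h)"
    proof -
      have "C (a + b + c) d (i + j) (?G i k) w =
          sg (c * d) (C (a + (b + d)) c (k + (b + d)) (C a (b + d) i f (C b d j g w)) h)" if "j \<le> b" for j
        using t[of "i + j"] that ik i C_seq[OF i that f g w] by (simp add: add.assoc)
      moreover have "C a (b + d) i f (pre b d g w) = (\<Sum>j\<le>b. C a (b + d) i f (C b d j g w))"
        unfolding pre_def using i f g w by (simp add: C_sum_right C_closed)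
      ultimately show ?thesis using ik i f g h w by (simp add: C_sum_left C_closed sg_sum)
    qed
    have 3: "(\<Sum>l\<in>{i<..<k}. C (a + b + c) d (l + b) (?G i k) w) =
        (\<Sum>l\<in>{i<..<k}. sg (c * d) (C (a + b + d) c (k + b + d) (C (a + b) d (l + b) (?F i) w) h))"
      by (intro sum.cong refl t) auto
    have 4: "(\<Sum>j\<le>c. C (a + b + c) d (k + b + j) (?G i k) w) = C (a + b) (c + d) (k + b) (?F i) (pre c d h w)"
      unfolding pre_def using ik i F[of i] h w by (simp add: C_seq C_sum_right C_closed)
    show ?thesis unfolding split 2 3 4 using 1 by simp
  qed
  have "pre (a + b + c) d (brace2 a b c f g h) w = (\<Sum>i\<le>a. \<Sum>k\<in>{i<..a}. pre (a + b + c) d (?G i k) w)"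
    unfolding brace2_def using G w by (simp add: pre_sum_left Q_sum)
  also have "\<dots> = 
      (\<Sum>i\<le>a. \<Sum>l<i. \<Sum>k\<in>{i<..a}. sg (b * d + c * d) (C (a + d + b) c (k + d + b) (C (a + d) b (i + d) (C a d l f w) g) h))
    + sg (c * d) (brace2 a (b + d) c f (pre b d g w) h)
    + (\<Sum>i\<le>a. \<Sum>k\<in>{i<..a}. \<Sum>l\<in>{i<..<k}. sg (c * d) (C (a + b + d) c (k + b + d) (C (a + b) d (l + b) (?F i) w) h))
    + brace2 a b (c + d) f g (pre c d h w) + brace3 a b c d f g h w"
    by (simp add: * sum.distrib brace2_def brace3_def sg_sum cong: sum.cong_simp) (intro sum.cong refl sum.swap)
  also have "(\<Sum>i\<le>a. \<Sum>l<i. \<Sum>k\<in>{i<..a}. sg (b * d + c * d) (C (a + d + b) c (k + d + b) (C (a + d) b (i + d) (C a d l f w) g) h))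
     = sg (b * d + c * d) (brace3 a d b c f w g h)"
    unfolding sum_triangle_swap brace3_def sg_sum ..
  also have "(\<Sum>i\<le>a. \<Sum>k\<in>{i<..a}. \<Sum>l\<in>{i<..<k}. sg (c * d) (C (a + b + d) c (k + b + d) (C (a + b) d (l + b) (?F i) w) h))
     = sg (c * d) (brace3 a b d c f g w h)"
    unfolding sum_triangle_swap_greater brace3_def sg_sum ..
  finally show ?thesis by (simp add: algebra_simps)
qed

text \<open>
  The six terms record where the pair \<open>h\<close>, \<open>w\<close> goes relative to \<open>g\<close>: both into \<open>g\<close>, only \<open>h\<close>, only
  \<open>w\<close>, or none of them, and in the last case \<open>g\<close> stands to the left of both, between them, or to the right.
\<close>

theorem brace2_pre_left:
  assumes f: "f \<in> Q a" and g: "g \<in> Q b" and h: "h \<in> Q c" and w: "w \<in> Q d"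
  shows "brace2 (a + b) c d (pre a b f g) h w =
    pre a (b + c + d) f (brace2 b c d g h w)
    + brace2 a (b + c) d f (pre b c g h) w + sg (b * c) (brace2 a c (b + d) f h (pre b d g w))
    + brace3 a b c d f g h w + sg (b * c) (brace3 a c b d f h g w)
    + sg (b * c + b * d) (brace3 a c d b f h w g)"
proof -
  let ?F = "\<lambda>i. C a b i f g"
  have F: "?F i \<in> Q (a + b)" for i using f g by (simp add: C_closed)
  let ?t = "\<lambda>i p q. C (a + b + c) d (q + c) (C (a + b) c p (?F i) h) w"
  have *: "brace2 (a + b) c d (?F i) h w =
      (\<Sum>p<i. (\<Sum>q\<in>{p<..<i}. sg (b * c + b * d) (C (a + c + d) b (i + c + d) (C (a + c) d (q + c) (C a c p f h) w) g))
        + sg (b * c) (C (a + c) (b + d) (i + c) (C a c p f h) (pre b d g w))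
        + (\<Sum>k\<in>{i<..a}. sg (b * c) (C (a + c + b) d (k + c + b) (C (a + c) b (i + c) (C a c p f h) g) w)))
     + (C a (b + c + d) i f (brace2 b c d g h w)
        + (\<Sum>k\<in>{i<..a}. C (a + (b + c)) d (k + (b + c)) (C a (b + c) i f (pre b c g h)) w))
     + (\<Sum>k\<in>{i<..a}. \<Sum>l\<in>{k<..a}. C (a + b + c) d (l + b + c) (C (a + b) c (k + b) (?F i) h) w)"
    if i: "i \<le> a" for i
  proof -
    have split: "brace2 (a + b) c d (?F i) h w =
       (\<Sum>p<i. (\<Sum>q\<in>{p<..<i}. ?t i p q) + (\<Sum>j\<le>b. ?t i p (i+j)) + (\<Sum>k\<in>{i<..a}. ?t i p (k+b)))
       + ((\<Sum>j\<le>b. \<Sum>j'\<in>{j<..b}. ?t i (i+j) (i+j')) + (\<Sum>j\<le>b. \<Sum>k\<in>{i<..a}. ?t i (i+j) (k+b)))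
       + (\<Sum>k\<in>{i<..a}. \<Sum>l\<in>{k<..a}. ?t i (k+b) (l+b))"
      unfolding brace2_def sum_block_split[OF i]
      using i by (simp add: sum_block_split_greater_left[OF _ i] sum_block_split_greater_inner[OF i]
          sum_shift_greater sum.distrib)
    have swap: "C (a + b) c p (?F i) h = sg (b * c) (C (a + c) b (i + c) (C a c p f h) g)"
      if "p < i" for p by (rule C_par') (use that i f g h in auto)
    have H: "C a c p f h \<in> Q (a + c)" for p using f h by (simp add: C_closed)
    have swap2: "?t i p q = sg (b * c) (C (a + c + b) d (q + c) (C (a + c) b (i + c) (C a c p f h) g) w)"
      if "p < i" "q \<le> a + b" for p q
    proof -
      have "C (a + c) b (i + c) (C a c p f h) g \<in> Q (a + c + b)"
        using H[of p] i g by (simp add: C_closed)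
      then have "C (a + c + b) d (q + c) (sg (b * c) (C (a + c) b (i + c) (C a c p f h) g)) w =
          sg (b * c) (C (a + c + b) d (q + c) (C (a + c) b (i + c) (C a c p f h) g) w)"
        using that w by (intro C_sg_left) auto
      moreover have "a + b + c = a + c + b" by simp
      ultimately show ?thesis by (simp only: swap[OF that(1)])
    qed
    have 1: "?t i p q = sg (b * c + b * d) (C (a + c + d) b (i + c + d) (C (a + c) d (q + c) (C a c p f h) w) g)"
      if "p < q" "q < i" for p q
    proof -
      have "C (a + c + b) d (q + c) (C (a + c) b (i + c) (C a c p f h) g) w =
        sg (b * d) (C (a + c + d) b (i + c + d) (C (a + c) d (q + c) (C a c p f h) w) g)"
        by (rule C_par') (use that i H g w in auto)
      then show ?thesis using swap2[of p q] that i by (simp add: sg_add_exp)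
    qed
    have 2: "(\<Sum>j\<le>b. ?t i p (i+j)) = sg (b * c) (C (a + c) (b + d) (i + c) (C a c p f h) (pre b d g w))"
      if p: "p < i" for p
    proof -
      have "?t i p (i+j) = sg (b * c) (C (a + c) (b + d) (i + c) (C a c p f h) (C b d j g w))" if j: "j \<le> b" for j
      proof -
        have "C (a + c + b) d (i + c + j) (C (a + c) b (i + c) (C a c p f h) g) w =
            C (a + c) (b + d) (i + c) (C a c p f h) (C b d j g w)"
          by (rule C_seq) (use i j p H g w in auto)
        moreover have "i + j + c = i + c + j" by simp
        moreover have "?t i p (i+j) =
            sg (b * c) (C (a + c + b) d (i + j + c) (C (a + c) b (i + c) (C a c p f h) g) w)"
          using swap2[of p "i+j"] p i j by simp
        ultimately show ?thesis by (simp only:)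
      qed
      then show ?thesis unfolding pre_def using H[of p] i g w by (simp add: C_sum_right C_closed sg_sum)
    qed
    have 3: "?t i p (k+b) = sg (b * c) (C (a + c + b) d (k + c + b) (C (a + c) b (i + c) (C a c p f h) g) w)"
      if "p < i" "k \<le> a" for p k
    proof -
      have "k + b + c = k + c + b" by simp
      moreover have "?t i p (k+b) =
          sg (b * c) (C (a + c + b) d (k + b + c) (C (a + c) b (i + c) (C a c p f h) g) w)"
        using swap2[of p "k+b"] that by simp
      ultimately show ?thesis by (simp only:)
    qed
    have 4: "(\<Sum>j\<le>b. \<Sum>j'\<in>{j<..b}. ?t i (i+j) (i+j')) = C a (b + c + d) i f (brace2 b c d g h w)"
    proof -
      have "?t i (i+j) (i+j') = C a (b + c + d) i f (C (b + c) d (j' + c) (C b c j g h) w)"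
        if "j < j'" "j' \<le> b" for j j'
        using C_seq[OF i _ f g h, of j] C_seq[OF i _ f _ w, of "j' + c" "b + c" "C b c j g h"] that g h
        by (simp add: C_closed add.assoc)
      then show ?thesis unfolding brace2_def using i f g h w by (simp add: C_sum_right C_closed Q_sum)
    qed
    have 5: "(\<Sum>j\<le>b. \<Sum>k\<in>{i<..a}. ?t i (i+j) (k+b)) =
       (\<Sum>k\<in>{i<..a}. C (a + (b + c)) d (k + (b + c)) (C a (b + c) i f (pre b c g h)) w)"
    proof -
      have "?t i (i+j) (k+b) = C (a + (b + c)) d (k + (b + c)) (C a (b + c) i f (C b c j g h)) w"
        if "j \<le> b" for j k
        using C_seq[OF i that f g h] by (simp add: add.assoc)
      moreover have "C a (b + c) i f (pre b c g h) = (\<Sum>j\<le>b. C a (b + c) i f (C b c j g h))"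
        unfolding pre_def using i f g h by (simp add: C_sum_right C_closed)
      ultimately show ?thesis using i f g h w
        by (simp add: C_sum_left C_closed) (rule sum.swap)
    qed
    show ?thesis unfolding split 4 5 using 1 2 3 by simp
  qed
  have "brace2 (a + b) c d (pre a b f g) h w = (\<Sum>i\<le>a. brace2 (a + b) c d (?F i) h w)"
    unfolding pre_def using F h w by (simp add: brace2_sum_left)
  also have "\<dots> = 
     (\<Sum>i\<le>a. \<Sum>p<i. \<Sum>q\<in>{p<..<i}. sg (b * c + b * d) (C (a + c + d) b (i + c + d) (C (a + c) d (q + c) (C a c p f h) w) g))
     + (\<Sum>i\<le>a. \<Sum>p<i. sg (b * c) (C (a + c) (b + d) (i + c) (C a c p f h) (pre b d g w)))
     + (\<Sum>i\<le>a. \<Sum>p<i. \<Sum>k\<in>{i<..a}. sg (b * c) (C (a + c + b) d (k + c + b) (C (a + c) b (i + c) (C a c p f h) g) w))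
     + pre a (b + c + d) f (brace2 b c d g h w) + brace2 a (b + c) d f (pre b c g h) w
     + brace3 a b c d f g h w"
    by (simp add: * sum.distrib pre_def[of a] brace2_def[of a] brace3_def)
  also have "(\<Sum>i\<le>a. \<Sum>p<i. \<Sum>q\<in>{p<..<i}. sg (b * c + b * d) (C (a + c + d) b (i + c + d) (C (a + c) d (q + c) (C a c p f h) w) g))
     = sg (b * c + b * d) (brace3 a c d b f h w g)"
    unfolding sum_triangle_swap sum_triangle_swap_greater brace3_def sg_sum ..
  also have "(\<Sum>i\<le>a. \<Sum>p<i. sg (b * c) (C (a + c) (b + d) (i + c) (C a c p f h) (pre b d g w)))
     = sg (b * c) (brace2 a c (b + d) f h (pre b d g w))"
    unfolding sum_triangle_swap brace2_def sg_sum ..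
  also have "(\<Sum>i\<le>a. \<Sum>p<i. \<Sum>k\<in>{i<..a}. sg (b * c) (C (a + c + b) d (k + c + b) (C (a + c) b (i + c) (C a c p f h) g) w))
     = sg (b * c) (brace3 a c b d f h g w)"
    unfolding sum_triangle_swap brace3_def sg_sum ..
  finally show ?thesis by (simp add: algebra_simps)
qed

end

section \<open>Bracket, differential and cup product\<close>

context suspended_operad
begin

definition bracket :: "nat \<Rightarrow> nat \<Rightarrow> 'a \<Rightarrow> 'a \<Rightarrow> 'a"
  where "bracket a b f g = pre a b f g - sg (a * b) (pre b a g f)"

lemma pre_closed': "f \<in> Q a \<Longrightarrow> g \<in> Q b \<Longrightarrow> pre a b f g \<in> Q (b + a)"
  using pre_closed by (simp add: add.commute)

lemma bracket_closed: "f \<in> Q a \<Longrightarrow> g \<in> Q b \<Longrightarrow> bracket a b f g \<in> Q (a + b)"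
  by (simp add: bracket_def Q_diff Q_sg pre_closed pre_closed')

lemma bracket_add_left: "f \<in> Q a \<Longrightarrow> f' \<in> Q a \<Longrightarrow> g \<in> Q b \<Longrightarrow>
    bracket a b (f + f') g = bracket a b f g + bracket a b f' g"
  by (simp add: bracket_def pre_add_left pre_add_right sg_add)

lemma bracket_add_right: "f \<in> Q a \<Longrightarrow> g \<in> Q b \<Longrightarrow> g' \<in> Q b \<Longrightarrow>
    bracket a b f (g + g') = bracket a b f g + bracket a b f g'"
  by (simp add: bracket_def pre_add_left pre_add_right sg_add)

lemma bracket_zero: "g \<in> Q b \<Longrightarrow> bracket a b 0 g = 0" "f \<in> Q a \<Longrightarrow> bracket a b f 0 = 0"
  using bracket_add_left[of 0 a 0 g b] bracket_add_right[of f a 0 b 0] by simp_all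

lemma bracket_antisym: "bracket a b f g = - sg (a * b) (bracket b a g f)"
  by (simp add: bracket_def sg_def mult.commute)

lemma pre_minus: "f \<in> Q a \<Longrightarrow> g \<in> Q b \<Longrightarrow> pre a b (- f) g = - pre a b f g"
    "f \<in> Q a \<Longrightarrow> g \<in> Q b \<Longrightarrow> pre a b f (- g) = - pre a b f g"
  using pre_sg_left[of f a g b 1] pre_sg_right[of f a g b 1] by (simp_all add: sg_def)

lemma pre_diff:
  "f \<in> Q a \<Longrightarrow> f' \<in> Q a \<Longrightarrow> g \<in> Q b \<Longrightarrow> pre a b (f - f') g = pre a b f g - pre a b f' g"
  "f \<in> Q a \<Longrightarrow> g \<in> Q b \<Longrightarrow> g' \<in> Q b \<Longrightarrow> pre a b f (g - g') = pre a b f g - pre a b f g'"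
  using pre_add_left[of f a "- f'" g b] pre_add_right[of f a g b "- g'"]
  by (simp_all add: Q_minus pre_minus)

lemma brace2_minus:
  assumes "f \<in> Q a" "g \<in> Q b" "h \<in> Q c"
  shows "brace2 a b c (- f) g h = - brace2 a b c f g h"
    and "brace2 a b c f (- g) h = - brace2 a b c f g h"
    and "brace2 a b c f g (- h) = - brace2 a b c f g h"
  using brace2_sg[OF assms, of 1] by (simp_all add: sg_def)

lemma brace2_diff:
  assumes "f \<in> Q a" "g \<in> Q b" "h \<in> Q c"
  shows "f' \<in> Q a \<Longrightarrow> brace2 a b c (f - f') g h = brace2 a b c f g h - brace2 a b c f' g h"
    and "g' \<in> Q b \<Longrightarrow> brace2 a b c f (g - g') h = brace2 a b c f g h - brace2 a b c f g' h"
    and "h' \<in> Q c \<Longrightarrow> brace2 a b c f g (h - h') = brace2 a b c f g h - brace2 a b c f g h'"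
  using brace2_add(1)[OF assms, of "- f'"] brace2_add(2)[OF assms, of "- g'"]
    brace2_add(3)[OF assms, of "- h'"] assms
  by (simp_all add: Q_minus brace2_minus)

lemma bracket_minus:
  "f \<in> Q a \<Longrightarrow> g \<in> Q b \<Longrightarrow> bracket a b (- f) g = - bracket a b f g"
  "f \<in> Q a \<Longrightarrow> g \<in> Q b \<Longrightarrow> bracket a b f (- g) = - bracket a b f g"
  by (simp_all add: bracket_def pre_minus sg_minus)

lemma bracket_sg:
  "f \<in> Q a \<Longrightarrow> g \<in> Q b \<Longrightarrow> bracket a b (sg k f) g = sg k (bracket a b f g)"
  "f \<in> Q a \<Longrightarrow> g \<in> Q b \<Longrightarrow> bracket a b f (sg k g) = sg k (bracket a b f g)"
  by (simp_all add: sg_def bracket_minus)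

text \<open>
  By \<open>pre_associator\<close> the associator of \<open>pre\<close> is graded symmetric in its last two arguments;
  in the graded sum over the six orders of \<open>x\<close>, \<open>y\<close>, \<open>z\<close> the braces cancel.
\<close>

theorem bracket_jacobi:
  assumes x: "x \<in> Q a" and y: "y \<in> Q b" and z: "z \<in> Q c"
  shows "bracket a (b + c) x (bracket b c y z) =
    bracket (a + b) c (bracket a b x y) z + sg (a * b) (bracket b (a + c) y (bracket a c x z))"
proof -
  note cl = x y z pre_closed[OF x y] pre_closed[OF y x] pre_closed[OF x z] pre_closed[OF z x]
    pre_closed[OF y z] pre_closed[OF z y]
  note cl' = cl cl[unfolded add.commute[of b a] add.commute[of c a] add.commute[of c b]]
  note assoc = pre_associator[OF x y z] pre_associator[OF x z y] pre_associator[OF y x z]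
    pre_associator[OF y z x] pre_associator[OF z x y] pre_associator[OF z y x]
  have expand: "bracket a (b + c) x (bracket b c y z) =
      pre a (b+c) x (pre b c y z) - sg (b*c) (pre a (b+c) x (pre c b z y))
      - sg (a*(b+c)) (pre (b+c) a (pre b c y z) x - sg (b*c) (pre (b+c) a (pre c b z y) x))"
    "bracket (a + b) c (bracket a b x y) z =
      pre (a+b) c (pre a b x y) z - sg (a*b) (pre (a+b) c (pre b a y x) z)
      - sg ((a+b)*c) (pre c (a+b) z (pre a b x y) - sg (a*b) (pre c (a+b) z (pre b a y x)))"
    "bracket b (a + c) y (bracket a c x z) =
      pre b (a+c) y (pre a c x z) - sg (a*c) (pre b (a+c) y (pre c a z x))
      - sg (b*(a+c)) (pre (a+c) b (pre a c x z) y - sg (a*c) (pre (a+c) b (pre c a z x) y))"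
    using cl' unfolding bracket_def
    by (simp_all add: pre_diff pre_sg_left pre_sg_right Q_sg sg_diff)
  show ?thesis
    unfolding expand assoc[unfolded add.commute[of b a] add.commute[of c a] add.commute[of c b]]
    by (cases "even a"; cases "even b"; cases "even c") (simp_all add: sg_def algebra_simps)
qed

end

text \<open>
  For an associative multiplication \<open>\<pi>\<close> of arity \<open>2\<close> the two composites of \<open>\<pi>\<close> with itself enter
  \<open>\<pi>{\<pi>}\<close> with opposite signs, so that associativity reads \<open>\<pi>{\<pi>} = 0\<close>.
\<close>

locale suspended_operad_mult = suspended_operad +
  fixes \<pi> :: 'a
  assumes \<pi>_in: "\<pi> \<in> Q 1"
    and \<pi>_assoc: "pre 1 1 \<pi> \<pi> = 0"
begin

definition d :: "nat \<Rightarrow> 'a \<Rightarrow> 'a"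
  where "d a x = bracket 1 a \<pi> x"

definition cup :: "nat \<Rightarrow> nat \<Rightarrow> 'a \<Rightarrow> 'a \<Rightarrow> 'a"
  where "cup a b x y = brace2 1 a b \<pi> x y"

lemma d_closed: "x \<in> Q a \<Longrightarrow> d a x \<in> Q (1 + a)"
  unfolding d_def by (rule bracket_closed[OF \<pi>_in])

lemma d_add: "x \<in> Q a \<Longrightarrow> y \<in> Q a \<Longrightarrow> d a (x + y) = d a x + d a y"
  unfolding d_def by (rule bracket_add_right[OF \<pi>_in])

lemma d_sg: "x \<in> Q a \<Longrightarrow> d a (sg k x) = sg k (d a x)"
  unfolding d_def by (rule bracket_sg(2)[OF \<pi>_in])

lemma d_unfold: "d a x = pre 1 a \<pi> x - sg a (pre a 1 x \<pi>)"
  by (simp add: d_def bracket_def)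

lemma cup_closed: "x \<in> Q a \<Longrightarrow> y \<in> Q b \<Longrightarrow> cup a b x y \<in> Q (1 + a + b)"
  unfolding cup_def by (rule brace2_closed[OF \<pi>_in])

lemma cup_add:
  assumes "x \<in> Q a" "y \<in> Q b"
  shows "x' \<in> Q a \<Longrightarrow> cup a b (x + x') y = cup a b x y + cup a b x' y"
    and "y' \<in> Q b \<Longrightarrow> cup a b x (y + y') = cup a b x y + cup a b x y'"
  unfolding cup_def using brace2_add[OF \<pi>_in assms] by auto

lemma cup_zero: "y \<in> Q b \<Longrightarrow> cup a b 0 y = 0" "x \<in> Q a \<Longrightarrow> cup a b x 0 = 0"
  using cup_add(1)[of 0 a y b 0] cup_add(2)[of x a 0 b 0] by simp_all

lemma cup_sg:
  assumes "x \<in> Q a" "y \<in> Q b"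
  shows "cup a b (sg k x) y = sg k (cup a b x y)"
    and "cup a b x (sg k y) = sg k (cup a b x y)"
  unfolding cup_def using brace2_sg[OF \<pi>_in assms] by auto

text \<open>
  \<open>\<pi>\<close> has only two slots.
\<close>

lemma brace3_arity_two: "brace3 1 b c e f g h w = 0"
  by (auto simp: brace3_def intro!: sum.neutral)

lemma cup_eq: "cup a b x y = C (1 + a) b (1 + a) (C 1 a 0 \<pi> x) y"
proof -
  have "{..1::nat} = {0, 1}" "{0<..1::nat} = {1}" by auto
  then show ?thesis by (simp add: cup_def brace2_def)
qed

text \<open>
  The Jacobi identity gives only \<open>2 d (d x) = 0\<close>; expanding the iterated terms with
  \<open>pre_associator\<close>, the braces with two entries \<open>\<pi>\<close> and \<open>x\<close> cancel in pairs.
\<close>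

theorem d_d: assumes x: "x \<in> Q a" shows "d (1 + a) (d a x) = 0"
proof -
  note p = \<pi>_in
  have 1: "pre 1 (1 + a) \<pi> (pre 1 a \<pi> x) = - brace2 1 1 a \<pi> \<pi> x - sg a (brace2 1 a 1 \<pi> x \<pi>)"
    using pre_associator[OF p p x] \<pi>_assoc pre_def[of "1+1" a 0] x
    by (simp add: C_zero_left algebra_simps eq_neg_iff_add_eq_0)
  have 2: "pre (1 + a) 1 (pre 1 a \<pi> x) \<pi> = pre 1 (a + 1) \<pi> (pre a 1 x \<pi>)
      + brace2 1 a 1 \<pi> x \<pi> + sg a (brace2 1 1 a \<pi> \<pi> x)"
    using pre_associator[OF p x p] by simp
  have 3: "pre (1 + a) 1 (pre a 1 x \<pi>) \<pi> = 0"
    using pre_associator[OF x p p] \<pi>_assoc x by (simp add: sg_def pre_def[of a "Suc (Suc 0)"] C_zero_right)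
  have expand: "d (1 + a) (d a x) = pre 1 (1 + a) \<pi> (pre 1 a \<pi> x) - sg a (pre 1 (1 + a) \<pi> (pre a 1 x \<pi>))
      - sg (1 + a) (pre (1 + a) 1 (pre 1 a \<pi> x) \<pi> - sg a (pre (1 + a) 1 (pre a 1 x \<pi>) \<pi>))"
    using p x pre_closed[OF p x] pre_closed'[OF x p] unfolding d_unfold
    by (simp add: pre_diff pre_sg_left pre_sg_right Q_sg sg_diff)
  show ?thesis unfolding expand 2 3 1 by (cases "even a") (simp_all add: sg_def algebra_simps)
qed

theorem d_bracket:
  assumes "x \<in> Q a" "y \<in> Q b"
  shows "d (a + b) (bracket a b x y) = bracket (1 + a) b (d a x) y + sg a (bracket a (1 + b) x (d b y))"
  using bracket_jacobi[OF \<pi>_in assms] by (simp add: d_def)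

text \<open>
  The term \<open>\<pi>{\<pi>{x, y}}\<close> of \<open>d (\<pi>{x, y})\<close> is turned by \<open>brace2_pre_left\<close> and \<open>\<pi>{\<pi>} = 0\<close> into
  terms where \<open>\<pi>\<close> meets \<open>x\<close> or \<open>y\<close> only.
\<close>

theorem d_cup:
  assumes x: "x \<in> Q a" and y: "y \<in> Q b"
  shows "d (1 + a + b) (cup a b x y) = - cup (1 + a) b (d a x) y - sg a (cup a (1 + b) x (d b y))"
proof -
  note p = \<pi>_in
  have 1: "pre 1 (1 + a + b) \<pi> (brace2 1 a b \<pi> x y) =
      - brace2 1 (1 + a) b \<pi> (pre 1 a \<pi> x) y - sg a (brace2 1 a (1 + b) \<pi> x (pre 1 b \<pi> y))"
    using brace2_pre_left[OF p p x y] \<pi>_assoc brace2_zero_left[OF x y, of "1 + 1"]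
    by (simp add: brace3_arity_two[simplified] algebra_simps eq_neg_iff_add_eq_0)
  have 2: "pre (1 + a + b) 1 (brace2 1 a b \<pi> x y) \<pi> =
      brace2 1 a (b + 1) \<pi> x (pre b 1 y \<pi>) + sg b (brace2 1 (a + 1) b \<pi> (pre a 1 x \<pi>) y)"
    using pre_brace2_left[OF p x y p] by (simp add: brace3_arity_two[simplified])
  have 3: "cup (1 + a) b (d a x) y =
      brace2 1 (1 + a) b \<pi> (pre 1 a \<pi> x) y - sg a (brace2 1 (1 + a) b \<pi> (pre a 1 x \<pi>) y)"
    using p x y pre_closed[OF p x] pre_closed'[OF x p] unfolding d_unfold cup_def
    by (simp add: brace2_diff brace2_sg Q_sg)
  have 4: "cup a (1 + b) x (d b y) =
      brace2 1 a (1 + b) \<pi> x (pre 1 b \<pi> y) - sg b (brace2 1 a (1 + b) \<pi> x (pre b 1 y \<pi>))"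
    using p x y pre_closed[OF p y] pre_closed'[OF y p] unfolding d_unfold cup_def
    by (simp add: brace2_diff brace2_sg Q_sg)
  show ?thesis unfolding 3 4 unfolding d_unfold[of "1 + a + b"] cup_def 1 2
    by (cases "even a"; cases "even b") (simp_all add: sg_def algebra_simps)
qed

text \<open>
  The two sides are \<open>x\<close>, \<open>y\<close>, \<open>z\<close> inserted into the two composites of \<open>\<pi>\<close> with itself, which agree
  up to sign.
\<close>

theorem cup_assoc:
  assumes x: "x \<in> Q a" and y: "y \<in> Q b" and z: "z \<in> Q c"
  shows "cup (1 + a + b) c (cup a b x y) z = - sg a (cup a (1 + b + c) x (cup b c y z))"
proof -
  note p = \<pi>_in
  let ?px = "C 1 a 0 \<pi> x"
  have px: "?px \<in> Q (1 + a)" using C_closed[OF p x] .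
  have swap: "C 1 1 1 \<pi> \<pi> = - C 1 1 0 \<pi> \<pi>"
    using \<pi>_assoc by (simp add: pre_def add_eq_0_iff)
  have pp: "C 1 1 0 \<pi> \<pi> \<in> Q (1 + 1)" using C_closed[OF p p] .
  have "C 1 (1 + a + b) 0 \<pi> (cup a b x y) = C (1 + (1 + a)) b (1 + a) (C 1 (1 + a) 0 \<pi> ?px) y"
    unfolding cup_eq using C_seq[of 0 1 "1 + a" "1 + a" \<pi> ?px y b] p px y by simp
  also have "C 1 (1 + a) 0 \<pi> ?px = C (1 + 1) a 0 (C 1 1 0 \<pi> \<pi>) x"
    using C_seq[of 0 1 0 1 \<pi> \<pi> x a] p x by simp
  finally have left: "cup (1 + a + b) c (cup a b x y) z =
      C (1 + (1 + a + b)) c (1 + (1 + a + b))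
        (C (1 + (1 + a)) b (1 + a) (C (1 + 1) a 0 (C 1 1 0 \<pi> \<pi>) x) y) z"
    by (simp only: cup_eq[of "1 + a + b"])
  have "C (1 + a) 1 (1 + a) ?px \<pi> = sg a (C (1 + 1) a 0 (C 1 1 1 \<pi> \<pi>) x)"
    using C_par[of 0 1 1 \<pi> x a \<pi> 1] p x by simp
  also have "\<dots> = - sg a (C (1 + 1) a 0 (C 1 1 0 \<pi> \<pi>) x)"
    unfolding swap using pp x by (simp add: C_minus_left sg_minus)
  finally have turn: "C (1 + a) 1 (1 + a) ?px \<pi> = - sg a (C (1 + 1) a 0 (C 1 1 0 \<pi> \<pi>) x)" .
  have "cup a (1 + b + c) x (cup b c y z) =
      C (1 + a) (1 + b + c) (1 + a) ?px (C (1 + b) c (1 + b) (C 1 b 0 \<pi> y) z)"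
    by (simp add: cup_eq)
  also have "\<dots> = C (1 + a + (1 + b)) c (1 + a + (1 + b)) (C (1 + a) (1 + b) (1 + a) ?px (C 1 b 0 \<pi> y)) z"
    using C_seq[of "1 + a" "1 + a" "1 + b" "1 + b" ?px "C 1 b 0 \<pi> y" z c] px C_closed[OF p y] z by simp
  also have "C (1 + a) (1 + b) (1 + a) ?px (C 1 b 0 \<pi> y) =
      C (1 + a + 1) b (1 + a) (C (1 + a) 1 (1 + a) ?px \<pi>) y"
    using C_seq[of "1 + a" "1 + a" 0 1 ?px \<pi> y b] px p y by simp
  also have "C (1 + a + 1) b (1 + a) (C (1 + a) 1 (1 + a) ?px \<pi>) y =
      - sg a (C (1 + (1 + a)) b (1 + a) (C (1 + 1) a 0 (C 1 1 0 \<pi> \<pi>) x) y)"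
    unfolding turn using C_closed[OF pp x] y
    by (simp add: C_minus_left C_sg_left Q_sg)
  finally have "cup a (1 + b + c) x (cup b c y z) =
     - sg a (C (1 + a + (1 + b)) c (1 + a + (1 + b))
       (C (1 + (1 + a)) b (1 + a) (C (1 + 1) a 0 (C 1 1 0 \<pi> \<pi>) x) y) z)"
    using C_closed[OF C_closed[OF pp x] y] z
    by (simp add: C_minus_left C_sg_left Q_sg)
  then show ?thesis unfolding left by (simp add: sg_minus ac_simps)
qed

text \<open>
  For cocycles, \<open>\<pi>{x} = \<plusminus> x{\<pi>}\<close> and \<open>\<pi>{y} = \<plusminus> y{\<pi>}\<close>; the defect \<open>\<pi>{x, y} \<plusminus> \<pi>{y, x}\<close> of the pre-Lie
  identity for \<open>\<pi>\<close>, \<open>x\<close>, \<open>y\<close> is what remains of \<open>d (x{y})\<close>.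
\<close>

theorem cup_comm_up_to_homotopy:
  assumes x: "x \<in> Q a" and y: "y \<in> Q b" and "d a x = 0" "d b y = 0"
  shows "d (a + b) (pre a b x y) = - cup a b x y - sg (a * b) (cup b a y x)"
proof -
  note p = \<pi>_in
  have xc: "pre 1 a \<pi> x = sg a (pre a 1 x \<pi>)" and yc: "pre 1 b \<pi> y = sg b (pre b 1 y \<pi>)"
    using assms(3,4) by (simp_all add: d_unfold)
  have 1: "sg a (pre (a + 1) b (pre a 1 x \<pi>) y) = pre 1 (a + b) \<pi> (pre a b x y)
      + brace2 1 a b \<pi> x y + sg (a * b) (brace2 1 b a \<pi> y x)"
    using pre_associator[OF p x y] pre_closed'[OF x p] y unfolding xc by (simp add: pre_sg_left)
  have 2: "pre (a + b) 1 (pre a b x y) \<pi> = pre a (b + 1) x (pre b 1 y \<pi>)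
      + brace2 a b 1 x y \<pi> + sg b (brace2 a 1 b x \<pi> y)"
    using pre_associator[OF x y p] by simp
  have 3: "pre (a + 1) b (pre a 1 x \<pi>) y = sg b (pre a (b + 1) x (pre b 1 y \<pi>))
      + brace2 a 1 b x \<pi> y + sg b (brace2 a b 1 x y \<pi>)"
    using pre_associator[OF x p y] pre_closed'[OF y p] x unfolding yc by (simp add: pre_sg_right)
  have 4: "pre 1 (a + b) \<pi> (pre a b x y) = sg a (pre (a + 1) b (pre a 1 x \<pi>) y)
      - brace2 1 a b \<pi> x y - sg (a * b) (brace2 1 b a \<pi> y x)"
    using 1 by simp
  show ?thesis unfolding d_unfold cup_def 4 2 3
    by (cases "even a"; cases "even b") (simp_all add: sg_def algebra_simps)
qed

text \<open>
  The homotopy is \<open>x{y, z}\<close>.  Expanding \<open>(\<pi>{x}){y, z} = \<plusminus> (x{\<pi>}){y, z}\<close> on both sides, the braces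
  \<open>x{\<pi>, y, z}\<close>, \<open>x{y, \<pi>, z}\<close>, \<open>x{y, z, \<pi>}\<close> cancel those of \<open>(x{y, z}){\<pi>}\<close>, and the terms with \<open>\<pi>{y}\<close>
  and \<open>\<pi>{z}\<close> cancel because \<open>y\<close> and \<open>z\<close> are cocycles.
\<close>

theorem leibniz_up_to_homotopy:
  assumes x: "x \<in> Q a" and y: "y \<in> Q b" and z: "z \<in> Q c"
    and "d a x = 0" "d b y = 0" "d c z = 0"
  shows "bracket a (1 + b + c) x (cup b c y z) =
    sg a (d (a + b + c) (brace2 a b c x y z)
      + cup (a + b) c (bracket a b x y) z + sg (a * b) (cup b (a + c) y (bracket a c x z)))"
proof -
  note p = \<pi>_in
  have xc: "pre 1 a \<pi> x = sg a (pre a 1 x \<pi>)" and yc: "pre 1 b \<pi> y = sg b (pre b 1 y \<pi>)"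
    and zc: "pre 1 c \<pi> z = sg c (pre c 1 z \<pi>)"
    using assms(4-6) by (simp_all add: d_unfold)
  let ?X = "brace2 (1 + a) b c (pre a 1 x \<pi>) y z"
  have 1: "sg a ?X = pre 1 (a + b + c) \<pi> (brace2 a b c x y z)
      + brace2 1 (a + b) c \<pi> (pre a b x y) z + sg (a * b) (brace2 1 b (a + c) \<pi> y (pre a c x z))"
    using brace2_pre_left[OF p x y z] pre_closed'[OF x p] y z unfolding xc
    by (simp add: brace2_sg brace3_arity_two[simplified])
  have 2: "?X = pre a (1 + b + c) x (brace2 1 b c \<pi> y z)
      + sg b (brace2 a (1 + b) c x (pre b 1 y \<pi>) z) + sg b (sg c (brace2 a b (1 + c) x y (pre c 1 z \<pi>)))
      + brace3 a 1 b c x \<pi> y z + sg b (brace3 a b 1 c x y \<pi> z) + sg (b + c) (brace3 a b c 1 x y z \<pi>)"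
    using brace2_pre_left[OF x p y z] pre_closed'[OF y p] pre_closed'[OF z p] x y z unfolding yc zc
    by (simp add: brace2_sg)
  have 3: "pre (a + b + c) 1 (brace2 a b c x y z) \<pi> =
      brace2 a b (1 + c) x y (pre c 1 z \<pi>) + sg c (brace2 a (1 + b) c x (pre b 1 y \<pi>) z)
      + brace3 a b c 1 x y z \<pi> + sg c (brace3 a b 1 c x y \<pi> z) + sg (b + c) (brace3 a 1 b c x \<pi> y z)"
    using pre_brace2_left[OF x y z p] by simp
  have 4: "pre (1 + b + c) a (brace2 1 b c \<pi> y z) x =
      brace2 1 b (c + a) \<pi> y (pre c a z x) + sg (c * a) (brace2 1 (b + a) c \<pi> (pre b a y x) z)"
    using pre_brace2_left[OF p y z x] by (simp add: brace3_arity_two[simplified])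
  have 5: "cup (a + b) c (bracket a b x y) z =
      brace2 1 (a + b) c \<pi> (pre a b x y) z - sg (a * b) (brace2 1 (a + b) c \<pi> (pre b a y x) z)"
    using p z pre_closed[OF x y] pre_closed'[OF y x] unfolding bracket_def cup_def
    by (simp add: brace2_diff brace2_sg Q_sg)
  have 6: "cup b (a + c) y (bracket a c x z) =
      brace2 1 b (a + c) \<pi> y (pre a c x z) - sg (a * c) (brace2 1 b (a + c) \<pi> y (pre c a z x))"
    using p y pre_closed[OF x z] pre_closed'[OF z x] unfolding bracket_def cup_def
    by (simp add: brace2_diff brace2_sg Q_sg)
  have 7: "pre 1 (a + b + c) \<pi> (brace2 a b c x y z) = sg a ?X
     - brace2 1 (a + b) c \<pi> (pre a b x y) z - sg (a * b) (brace2 1 b (a + c) \<pi> y (pre a c x z))"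
    unfolding 1 by simp
  show ?thesis unfolding 5 6 unfolding d_unfold cup_def bracket_def 7 2 3 4
    by (cases "even a"; cases "even b"; cases "even c") (simp_all add: sg_def algebra_simps)
qed

end

section \<open>Cochain complexes and operations on cohomology\<close>

text \<open>
  Cohomology classes are cosets of the coboundaries; a linear differential makes the coboundaries
  a subspace, which is what linear operations on classes rest on.
\<close>

locale linear_complex =
  fixes K :: "('k::field, 'a::ab_group_add) cochain_complex"
  assumes scale_vector_space: "vector_space (cscale K)"
    and cochains_0: "0 \<in> cochains K n"
    and cochains_add: "f \<in> cochains K n \<Longrightarrow> g \<in> cochains K n \<Longrightarrow> f + g \<in> cochains K n"
    and cochains_scale: "f \<in> cochains K n \<Longrightarrow> cscale K a f \<in> cochains K n"
    and diff_add: "f \<in> cochains K n \<Longrightarrow> g \<in> cochains K n \<Longrightarrow>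
      diff K n (f + g) = diff K n f + diff K n g"
    and diff_scale: "f \<in> cochains K n \<Longrightarrow> diff K n (cscale K a f) = cscale K a (diff K n f)"
begin

sublocale vs: vector_space "cscale K" by (rule scale_vector_space)

lemma coboundaries_0: "0 \<in> coboundaries K n"
proof -
  have "diff K (n - 1) 0 = 0" using diff_add[OF cochains_0 cochains_0, of "n - 1"] by simp
  then show ?thesis using cochains_0[of "n - 1"] by (force simp: coboundaries_def)
qed

lemma coboundaries_add: "b \<in> coboundaries K n \<Longrightarrow> b' \<in> coboundaries K n \<Longrightarrow> b + b' \<in> coboundaries K n"
  by (auto simp: coboundaries_def diff_add[symmetric] cochains_add split: if_splits)

lemma coboundaries_scale: "b \<in> coboundaries K n \<Longrightarrow> cscale K a b \<in> coboundaries K n"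
  by (auto simp: coboundaries_def diff_scale[symmetric] cochains_scale split: if_splits)

lemma coboundaries_minus: "b \<in> coboundaries K n \<Longrightarrow> - b \<in> coboundaries K n"
  using coboundaries_scale[of b n "- 1"] by simp

lemma coboundaries_diff: "b \<in> coboundaries K n \<Longrightarrow> b' \<in> coboundaries K n \<Longrightarrow> b - b' \<in> coboundaries K n"
  using coboundaries_add[of b n "- b'"] coboundaries_minus by simp

lemma coboundaries_sg: "b \<in> coboundaries K n \<Longrightarrow> sg k b \<in> coboundaries K n"
  by (simp add: sg_def coboundaries_minus)

lemma cocycles_add: "f \<in> cocycles K n \<Longrightarrow> g \<in> cocycles K n \<Longrightarrow> f + g \<in> cocycles K n"
  by (simp add: cocycles_def cochains_add diff_add)

lemma cocycles_scale: "f \<in> cocycles K n \<Longrightarrow> cscale K a f \<in> cocycles K n"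
  by (simp add: cocycles_def cochains_scale diff_scale)

lemma cocycles_0: "0 \<in> cocycles K n"
  using diff_add[OF cochains_0 cochains_0, of n] by (simp add: cocycles_def cochains_0)

lemma mem_coclass_iff: "g \<in> coclass K n f \<longleftrightarrow> g - f \<in> coboundaries K n"
  by (auto simp: coclass_def) (metis add.commute diff_add_cancel)

lemma coclass_eq_iff: "coclass K n f = coclass K n g \<longleftrightarrow> f - g \<in> coboundaries K n"
proof
  assume "coclass K n f = coclass K n g"
  then have "f \<in> coclass K n g" using mem_coclass_iff[of f n f] coboundaries_0 by simp
  then show "f - g \<in> coboundaries K n" by (simp add: mem_coclass_iff)
next
  assume fg: "f - g \<in> coboundaries K n"
  have "h - f \<in> coboundaries K n \<longleftrightarrow> h - g \<in> coboundaries K n" for h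
    using coboundaries_add[OF fg, of "h - f"] coboundaries_diff[OF _ fg, of "h - g"]
    by (auto simp: algebra_simps)
  then show "coclass K n f = coclass K n g" by (auto simp: mem_coclass_iff)
qed

lemma self_mem_coclass: "f \<in> coclass K n f"
  by (simp add: mem_coclass_iff coboundaries_0)

text \<open>
  The union over all representatives collapses to a single class as soon as the result
  changes only by coboundaries.
\<close>

lemma induced_op_coclass:
  assumes "\<And>b b'. b \<in> coboundaries K m \<Longrightarrow> b' \<in> coboundaries K n \<Longrightarrow>
    F (f + b) (g + b') - F f g \<in> coboundaries K p"
  shows "induced_op K p F (coclass K m f) (coclass K n g) = coclass K p (F f g)"
proof -
  have "coclass K p (F f' g') = coclass K p (F f g)"
    if "f' \<in> coclass K m f" "g' \<in> coclass K n g" for f' g'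
    unfolding coclass_eq_iff
    using that assms[of "f' - f" "g' - g"] by (simp add: mem_coclass_iff)
  then have "induced_op K p F (coclass K m f) (coclass K n g) =
      (\<Union>f'\<in>coclass K m f. \<Union>g'\<in>coclass K n g. coclass K p (F f g))"
    unfolding induced_op_def by (intro SUP_cong refl)
  then show ?thesis using self_mem_coclass[of f m] self_mem_coclass[of g n] by auto
qed

lemma add_coclass: "cohomology_add K n (coclass K n f) (coclass K n g) = coclass K n (f + g)"
  by (rule induced_op_coclass) (simp add: algebra_simps coboundaries_add)

lemma cohomology_elims:
  assumes "X \<in> cohomology K n"
  obtains f where "f \<in> cocycles K n" "X = coclass K n f"
  using assms by (auto simp: cohomology_def)

lemma coclass_in: "f \<in> cocycles K n \<Longrightarrow> coclass K n f \<in> cohomology K n"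
  by (simp add: cohomology_def)

end

lemma induced_map_coclass:
  assumes K: "linear_complex K" and L: "linear_complex L"
    and F: "\<And>b. b \<in> coboundaries K n \<Longrightarrow> F (f + b) - F f \<in> coboundaries L m"
  shows "induced_map L m F (coclass K n f) = coclass L m (F f)"
proof -
  interpret K: linear_complex K by fact
  interpret L: linear_complex L by fact
  have "coclass L m (F f') = coclass L m (F f)" if "f' \<in> coclass K n f" for f'
    unfolding L.coclass_eq_iff using that F[of "f' - f"] by (simp add: K.mem_coclass_iff)
  then have "induced_map L m F (coclass K n f) = (\<Union>f'\<in>coclass K n f. coclass L m (F f))"
    unfolding induced_map_def by (intro SUP_cong refl)
  then show ?thesis using K.self_mem_coclass[of f n] by auto
qed

context linear_complex
begin

lemma scale_coclass: "cohomology_scale K n a (coclass K n f) = coclass K n (cscale K a f)"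
  by (rule induced_map_coclass) (unfold_locales, simp_all add: vs.scale_right_distrib coboundaries_scale)

lemma cohomology_vector_space:
  "carrier_vector_space (cohomology K n) (cohomology_add K n) (cohomology_scale K n)"
proof -
  have inv: "\<exists>Y\<in>cohomology K n. cohomology_add K n X Y = coclass K n 0" if "X \<in> cohomology K n" for X
  proof -
    from that obtain f where f: "f \<in> cocycles K n" "X = coclass K n f" by (rule cohomology_elims)
    then have "cohomology_add K n X (coclass K n (cscale K (-1) f)) = coclass K n 0"
      by (simp add: add_coclass)
    moreover have "coclass K n (cscale K (-1) f) \<in> cohomology K n"
      using f by (intro coclass_in cocycles_scale)
    ultimately show ?thesis by blast
  qed
  have unit: "\<exists>E\<in>cohomology K n. \<forall>X\<in>cohomology K n. cohomology_add K n E X = X \<and>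
      (\<exists>Y\<in>cohomology K n. cohomology_add K n X Y = E)"
    using inv coclass_in[OF cocycles_0]
    by (intro bexI[of _ "coclass K n 0"]) (auto elim!: cohomology_elims simp: add_coclass)
  show ?thesis
    unfolding carrier_vector_space_def using unit
    by (intro conjI; (intro ballI allI)?)
      (auto elim!: cohomology_elims intro!: coclass_in cocycles_add cocycles_scale
        simp: add_coclass scale_coclass ac_simps vs.scale_right_distrib vs.scale_left_distrib)
qed

end

text \<open>
  The maps \<open>F n\<close> are additive and homogeneous on all functions, not only on cochains, as
  \<open>S_map\<close> is.  Thus \<open>F n (f + b) = F n f + F n b\<close> holds for every coboundary \<open>b\<close>.
\<close>

locale chain_map = K: linear_complex K + L: linear_complex L
  for K :: "('k::field, 'a::ab_group_add) cochain_complex"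
    and L :: "('k, 'b::ab_group_add) cochain_complex" +
  fixes F :: "nat \<Rightarrow> 'a \<Rightarrow> 'b"
  assumes F_add: "F n (f + g) = F n f + F n g"
    and F_scale: "F n (cscale K a f) = cscale L a (F n f)"
    and F_cochain: "f \<in> cochains K n \<Longrightarrow> F n f \<in> cochains L n"
    and F_diff: "f \<in> cochains K n \<Longrightarrow> diff L n (F n f) = F (n + 1) (diff K n f)"
begin

lemma F_0: "F n 0 = 0"
  using F_add[of n 0 0] by simp

lemma F_cocycle: "f \<in> cocycles K n \<Longrightarrow> F n f \<in> cocycles L n"
  by (simp add: cocycles_def F_cochain F_diff F_0)

lemma F_coboundary: "b \<in> coboundaries K n \<Longrightarrow> F n b \<in> coboundaries L n"
proof (cases n)
  case (Suc k)
  assume "b \<in> coboundaries K n"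
  then obtain f where f: "f \<in> cochains K k" "b = diff K k f" using Suc by (auto simp: coboundaries_def)
  then have "F n b = diff L k (F k f)" using F_diff[of f k] Suc by simp
  then show ?thesis using Suc F_cochain[OF f(1)] by (auto simp: coboundaries_def)
qed (auto simp: coboundaries_def F_0)

lemma F_coclass: "induced_map L n (F n) (coclass K n f) = coclass L n (F n f)"
  by (rule induced_map_coclass[OF K.linear_complex_axioms L.linear_complex_axioms])
    (simp add: F_add F_coboundary)

lemma F_cohomology_linear: "cohomology_linear K L n (induced_map L n (F n))"
  unfolding cohomology_linear_def
  by (auto elim!: K.cohomology_elims intro!: L.coclass_in F_cocycle
      simp: F_coclass K.add_coclass K.scale_coclass L.add_coclass L.scale_coclass F_add F_scale)

end

section \<open>Non-symmetric operads with multiplication\<close>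

text \<open>
  Slots are numbered from \<open>1\<close>, hence the shifts \<open>i - 1 + j\<close> and \<open>k - 1 + n\<close> in the sequential and in
  the parallel axiom.  Arity \<open>0\<close> does not occur.
\<close>

locale operad_with_multiplication =
  fixes sc :: "'k::field \<Rightarrow> 'a::ab_group_add \<Rightarrow> 'a"
    and P :: "nat \<Rightarrow> 'a set"
    and pc :: "'a partial_comp"
    and \<pi> :: 'a
  assumes sc_vector_space: "vector_space sc"
    and P_0: "1 \<le> n \<Longrightarrow> 0 \<in> P n"
    and P_add: "1 \<le> n \<Longrightarrow> f \<in> P n \<Longrightarrow> g \<in> P n \<Longrightarrow> f + g \<in> P n"
    and P_scale: "1 \<le> n \<Longrightarrow> f \<in> P n \<Longrightarrow> sc a f \<in> P n"
    and pc_closed: "1 \<le> i \<Longrightarrow> i \<le> m \<Longrightarrow> 1 \<le> n \<Longrightarrow> f \<in> P m \<Longrightarrow> g \<in> P n \<Longrightarrow>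
      pc m n i f g \<in> P (m + n - 1)"
    and pc_add_left: "1 \<le> i \<Longrightarrow> i \<le> m \<Longrightarrow> 1 \<le> n \<Longrightarrow> f \<in> P m \<Longrightarrow> f' \<in> P m \<Longrightarrow> g \<in> P n \<Longrightarrow>
      pc m n i (f + f') g = pc m n i f g + pc m n i f' g"
    and pc_add_right: "1 \<le> i \<Longrightarrow> i \<le> m \<Longrightarrow> 1 \<le> n \<Longrightarrow> f \<in> P m \<Longrightarrow> g \<in> P n \<Longrightarrow> g' \<in> P n \<Longrightarrow>
      pc m n i f (g + g') = pc m n i f g + pc m n i f g'"
    and pc_scale_left: "1 \<le> i \<Longrightarrow> i \<le> m \<Longrightarrow> 1 \<le> n \<Longrightarrow> f \<in> P m \<Longrightarrow> g \<in> P n \<Longrightarrow>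
      pc m n i (sc a f) g = sc a (pc m n i f g)"
    and pc_scale_right: "1 \<le> i \<Longrightarrow> i \<le> m \<Longrightarrow> 1 \<le> n \<Longrightarrow> f \<in> P m \<Longrightarrow> g \<in> P n \<Longrightarrow>
      pc m n i f (sc a g) = sc a (pc m n i f g)"
    and pc_seq: "1 \<le> i \<Longrightarrow> i \<le> m \<Longrightarrow> 1 \<le> j \<Longrightarrow> j \<le> n \<Longrightarrow> 1 \<le> p \<Longrightarrow>
      f \<in> P m \<Longrightarrow> g \<in> P n \<Longrightarrow> h \<in> P p \<Longrightarrow>
      pc (m + n - 1) p (i - 1 + j) (pc m n i f g) h = pc m (n + p - 1) i f (pc n p j g h)"
    and pc_par: "1 \<le> i \<Longrightarrow> i < k \<Longrightarrow> k \<le> m \<Longrightarrow> 1 \<le> n \<Longrightarrow> 1 \<le> p \<Longrightarrow>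
      f \<in> P m \<Longrightarrow> g \<in> P n \<Longrightarrow> h \<in> P p \<Longrightarrow>
      pc (m + n - 1) p (k - 1 + n) (pc m n i f g) h = pc (m + p - 1) n i (pc m p k f h) g"
    and \<pi>_in_P: "\<pi> \<in> P 2"
    and \<pi>_assoc_P: "pc 2 2 1 \<pi> \<pi> = pc 2 2 2 \<pi> \<pi>"
begin

sublocale vector_space sc by (rule sc_vector_space)

definition susp :: "nat \<Rightarrow> nat \<Rightarrow> nat \<Rightarrow> 'a \<Rightarrow> 'a \<Rightarrow> 'a"
  where "susp a b i f g = (if i \<le> a then sg (i * b) (pc (Suc a) (Suc b) (Suc i) f g) else 0)"

lemma P_minus: "1 \<le> n \<Longrightarrow> f \<in> P n \<Longrightarrow> - f \<in> P n"
  using P_scale[of n f "- 1"] by simp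

lemma P_sg: "1 \<le> n \<Longrightarrow> f \<in> P n \<Longrightarrow> sg k f \<in> P n"
  by (simp add: sg_def P_minus)

lemma pc_sg:
  assumes "1 \<le> i" "i \<le> m" "1 \<le> n" "f \<in> P m" "g \<in> P n"
  shows "pc m n i (sg k f) g = sg k (pc m n i f g)"
    and "pc m n i f (sg k g) = sg k (pc m n i f g)"
  using pc_scale_left[OF assms, of "- 1"] pc_scale_right[OF assms, of "- 1"] by (simp_all add: sg_def)

sublocale suspended_operad "\<lambda>a. P (Suc a)" susp
proof
  fix a b c i j k :: nat and f f' g g' h
  show "0 \<in> P (Suc a)" by (simp add: P_0)
  show "f + f' \<in> P (Suc a)" if "f \<in> P (Suc a)" "f' \<in> P (Suc a)" using that by (simp add: P_add)
  show "- f \<in> P (Suc a)" if "f \<in> P (Suc a)" using that by (simp add: P_minus)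
  show "susp a b i f g \<in> P (Suc (a + b))" if "f \<in> P (Suc a)" "g \<in> P (Suc b)"
    using that pc_closed[of "Suc i" "Suc a" "Suc b" f g] by (simp add: susp_def P_sg P_0)
  show "susp a b i (f + f') g = susp a b i f g + susp a b i f' g"
    if "f \<in> P (Suc a)" "f' \<in> P (Suc a)" "g \<in> P (Suc b)"
    using that by (simp add: susp_def pc_add_left sg_add)
  show "susp a b i f (g + g') = susp a b i f g + susp a b i f g'"
    if "f \<in> P (Suc a)" "g \<in> P (Suc b)" "g' \<in> P (Suc b)"
    using that by (simp add: susp_def pc_add_right sg_add)
  show "susp (a + b) c (i + j) (susp a b i f g) h = susp a (b + c) i f (susp b c j g h)"
    if "i \<le> a" "j \<le> b" "f \<in> P (Suc a)" "g \<in> P (Suc b)" "h \<in> P (Suc c)"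
  proof -
    have "pc (Suc a) (Suc b) (Suc i) f g \<in> P (Suc (a + b))" "pc (Suc b) (Suc c) (Suc j) g h \<in> P (Suc (b + c))"
      using that pc_closed[of "Suc i" "Suc a" "Suc b" f g] pc_closed[of "Suc j" "Suc b" "Suc c" g h] by simp_all
    then show ?thesis
      using that pc_seq[of "Suc i" "Suc a" "Suc j" "Suc b" "Suc c" f g h]
      by (simp add: susp_def pc_sg sg_add_exp[symmetric] algebra_simps)
  qed
  show "susp (a + b) c (k + b) (susp a b i f g) h = sg (b * c) (susp (a + c) b i (susp a c k f h) g)"
    if "i < k" "k \<le> a" "f \<in> P (Suc a)" "g \<in> P (Suc b)" "h \<in> P (Suc c)"
  proof -
    have "pc (Suc a) (Suc b) (Suc i) f g \<in> P (Suc (a + b))" "pc (Suc a) (Suc c) (Suc k) f h \<in> P (Suc (a + c))"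
      using that pc_closed[of "Suc i" "Suc a" "Suc b" f g] pc_closed[of "Suc k" "Suc a" "Suc c" f h] by simp_all
    then show ?thesis
      using that pc_par[of "Suc i" "Suc k" "Suc a" "Suc b" "Suc c" f g h]
      by (simp add: susp_def pc_sg sg_add_exp[symmetric] algebra_simps)
  qed
qed

sublocale suspended_operad_mult "\<lambda>a. P (Suc a)" susp \<pi>
proof
  show "\<pi> \<in> P (Suc 1)" using \<pi>_in_P by (simp add: numeral_2_eq_2)
  have "{..1::nat} = {0, 1}" by auto
  then show "pre 1 1 \<pi> \<pi> = 0"
    using \<pi>_assoc_P by (simp add: pre_def susp_def sg_def numeral_2_eq_2)
qed

lemma operad_bullet_eq_pre:
  "operad_bullet pc sc (Suc a) (Suc b) f g = pre a b f g"
proof -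
  have "(\<Sum>i=1..Suc a. sg ((i - 1) * b) (pc (Suc a) (Suc b) i f g)) =
      (\<Sum>i\<le>a. sg (i * b) (pc (Suc a) (Suc b) (Suc i) f g))"
    by (rule sum.reindex_bij_witness[where i = Suc and j = "\<lambda>i. i - 1"]) auto
  then show ?thesis
    by (simp add: operad_bullet_def pre_def susp_def scale_sign_eq_sg[OF sc_vector_space])
qed

lemma operad_bracket_eq_bracket:
  "operad_bracket pc sc (Suc a) (Suc b) f g = bracket a b f g"
  by (simp add: operad_bracket_def bracket_def operad_bullet_eq_pre scale_sign_eq_sg[OF sc_vector_space])

text \<open>
  The parallel axiom identifies the two ways of building the composite; the sign is the quotient of
  the sign \<open>(-1)\<^sup>m\<^sup>n\<close> of the product by the suspension sign of the slot, with \<open>m = a + 1\<close> and \<open>n = b + 1\<close>.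
\<close>

lemma operad_prod_eq_cup:
  assumes "f \<in> P (Suc a)" "g \<in> P (Suc b)"
  shows "operad_prod pc sc \<pi> (Suc a) (Suc b) f g = - sg a (cup a b f g)"
proof -
  have "pc (Suc (Suc b)) (Suc a) 1 (pc 2 (Suc b) 2 \<pi> g) f =
      pc (Suc (Suc a)) (Suc b) (Suc (Suc a)) (pc 2 (Suc a) 1 \<pi> f) g"
    using pc_par[of 1 2 2 "Suc a" "Suc b" \<pi> f g] \<pi>_in_P assms by simp
  moreover have "cup a b f g = sg (Suc a * b) (pc (Suc (Suc a)) (Suc b) (Suc (Suc a)) (pc 2 (Suc a) 1 \<pi> f) g)"
    by (simp add: cup_eq susp_def numeral_2_eq_2)
  ultimately show ?thesis
    by (simp add: operad_prod_def scale_sign_eq_sg[OF sc_vector_space])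
      (cases "even a"; cases "even b"; simp add: sg_def)
qed

lemma pc_pre_scale:
  assumes "f \<in> P (Suc a)" "g \<in> P (Suc b)"
  shows "pre a b (sc c f) g = sc c (pre a b f g)" "pre a b f (sc c g) = sc c (pre a b f g)"
  using assms by (simp_all add: pre_def susp_def sg_def pc_scale_left pc_scale_right scale_sum_right
      if_distrib[of "sc c"] cong: if_cong)

lemma bracket_scale:
  assumes "f \<in> P (Suc a)" "g \<in> P (Suc b)"
  shows "bracket a b (sc c f) g = sc c (bracket a b f g)" "bracket a b f (sc c g) = sc c (bracket a b f g)"
  using assms by (simp_all add: bracket_def pc_pre_scale sg_def scale_right_diff_distrib scale_right_distrib)

lemma cup_scale:
  assumes "f \<in> P (Suc a)" "g \<in> P (Suc b)"
  shows "cup a b (sc c f) g = sc c (cup a b f g)" "cup a b f (sc c g) = sc c (cup a b f g)"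
proof -
  have "pc 2 (Suc a) 1 \<pi> f \<in> P (Suc (Suc a))"
    using pc_closed[of 1 2 "Suc a" \<pi> f] \<pi>_in_P assms by simp
  then show "cup a b (sc c f) g = sc c (cup a b f g)" "cup a b f (sc c g) = sc c (cup a b f g)"
    using assms \<pi>_in_P
    by (simp_all add: cup_eq susp_def sg_def pc_scale_left pc_scale_right numeral_2_eq_2)
qed

end

section \<open>The Gerstenhaber algebra of an operad with multiplication\<close>

text \<open>
  The complex of an operad with multiplication, with the differential written in the form that
  it has for the dendriform and the coHochschild complex.
\<close>

locale operad_complex = operad_with_multiplication sc P pc \<pi>
  for sc :: "'k::field \<Rightarrow> 'a::ab_group_add \<Rightarrow> 'a" and P pc \<pi> +
  fixes K :: "('k, 'a) cochain_complex"
  assumes K_scale: "cscale K = sc"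
    and K_cochains_0: "cochains K 0 = {0}"
    and K_cochains: "1 \<le> n \<Longrightarrow> cochains K n = P n"
    and K_diff_0: "diff K 0 0 = 0"
    and K_diff: "1 \<le> n \<Longrightarrow> f \<in> P n \<Longrightarrow> diff K n f =
      pc 2 n 2 \<pi> f + (\<Sum>i=1..n. sc ((-1) ^ i) (pc n 2 i f \<pi>)) + sc ((-1) ^ (n + 1)) (pc 2 n 1 \<pi> f)"
begin

text \<open>
  The differential is \<open>[\<pi>, -]\<close> up to the sign of the degree: the two compositions into \<open>\<pi>\<close> are its
  outer terms and the compositions of \<open>\<pi>\<close> into the cochain are the inner sum.
\<close>

lemma K_diff_Suc:
  assumes x: "x \<in> P (Suc a)"
  shows "diff K (Suc a) x = sg a (d a x)"
proof -
  have "(\<Sum>i=1..Suc a. sg i (pc (Suc a) 2 i x \<pi>)) = (\<Sum>i\<le>a. sg (Suc i) (pc (Suc a) 2 (Suc i) x \<pi>))"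
    by (rule sum.reindex_bij_witness[where i = Suc and j = "\<lambda>i. i - 1"]) auto
  also have "\<dots> = - (\<Sum>i\<le>a. sg i (pc (Suc a) 2 (Suc i) x \<pi>))"
    by (simp add: sg_Suc sum_negf)
  also have "(\<Sum>i\<le>a. sg i (pc (Suc a) 2 (Suc i) x \<pi>)) = pre a 1 x \<pi>"
    by (simp add: pre_def susp_def numeral_2_eq_2)
  finally have mid: "(\<Sum>i=1..Suc a. sg i (pc (Suc a) 2 i x \<pi>)) = - pre a 1 x \<pi>" .
  have "{..1::nat} = {0, 1}" by auto
  then have outer: "pre 1 a \<pi> x = pc 2 (Suc a) 1 \<pi> x + sg a (pc 2 (Suc a) 2 \<pi> x)"
    by (simp add: pre_def susp_def numeral_2_eq_2)
  have n: "1 \<le> Suc a" by simp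
  show ?thesis
    unfolding K_diff[OF n x] d_unfold outer scale_sign_eq_sg[OF sc_vector_space] mid
    by (cases "even a") (simp_all add: sg_def algebra_simps)
qed

lemma d_scale: "x \<in> P (Suc a) \<Longrightarrow> d a (sc c x) = sc c (d a x)"
  unfolding d_def using \<pi>_in by (simp add: bracket_scale)

sublocale linear_complex K
proof (rule linear_complex.intro)
  fix n f g and a :: 'k
  show "vector_space (cscale K)" by (simp add: K_scale sc_vector_space)
  show "0 \<in> cochains K n" by (cases n) (simp_all add: K_cochains_0 K_cochains P_0)
  show "f + g \<in> cochains K n" if "f \<in> cochains K n" "g \<in> cochains K n"
    using that by (cases n) (simp_all add: K_cochains_0 K_cochains P_add)
  show "cscale K a f \<in> cochains K n" if "f \<in> cochains K n"
    using that by (cases n) (simp_all add: K_cochains_0 K_cochains P_scale K_scale)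
  show "diff K n (f + g) = diff K n f + diff K n g" if "f \<in> cochains K n" "g \<in> cochains K n"
    using that
    by (cases n) (simp_all add: K_cochains_0 K_cochains K_diff_0 K_diff_Suc P_add d_add sg_add)
  show "diff K n (cscale K a f) = cscale K a (diff K n f)" if "f \<in> cochains K n"
    using that
    by (cases n) (simp_all add: K_cochains_0 K_cochains K_diff_0 K_diff_Suc K_scale d_scale P_scale sg_def)
qed

lemma cocycles_Suc: "cocycles K (Suc a) = {x \<in> P (Suc a). d a x = 0}"
  by (auto simp: cocycles_def K_cochains K_diff_Suc sg_def split: if_splits)

lemma d_in_coboundaries: "x \<in> P (Suc a) \<Longrightarrow> d a x \<in> coboundaries K (Suc (Suc a))"
proof -
  assume x: "x \<in> P (Suc a)"
  have "diff K (Suc a) (sg a x) = d a x"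
    using x by (simp add: K_diff_Suc P_sg d_sg)
  then show ?thesis
    using x unfolding coboundaries_def by (auto simp: K_cochains P_sg intro!: image_eqI[of _ _ "sg a x"])
qed

text \<open>
  In arity \<open>1\<close> the only coboundary is \<open>0\<close>, since the complex starts there.
\<close>

lemma coboundaries_Suc_cases:
  assumes "b \<in> coboundaries K (Suc n)"
  obtains "b = 0" | a x where "n = Suc a" "x \<in> P (Suc a)" "b = d a x"
proof (cases n)
  case 0
  then show ?thesis using assms that(1) by (auto simp: coboundaries_def K_cochains_0 K_diff_0)
next
  case (Suc a)
  then obtain x where x: "x \<in> P (Suc a)" "b = sg a (d a x)"
    using assms by (auto simp: coboundaries_def K_cochains K_diff_Suc)
  then have "b = d a (sg a x)" by (simp add: d_sg)
  then show ?thesis using that(2)[OF Suc, of "sg a x"] x by (simp add: P_sg)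
qed

lemma coboundaries_subset_cocycles: "coboundaries K (Suc n) \<subseteq> cocycles K (Suc n)"
proof
  fix b assume "b \<in> coboundaries K (Suc n)"
  then show "b \<in> cocycles K (Suc n)"
    using d_closed d_d cocycles_0[of "Suc n"]
    by (cases rule: coboundaries_Suc_cases) (auto simp: cocycles_Suc)
qed

lemma cup_cocycle:
  "x \<in> cocycles K (Suc a) \<Longrightarrow> y \<in> cocycles K (Suc b) \<Longrightarrow> cup a b x y \<in> cocycles K (Suc (Suc (a + b)))"
  using cup_closed[of x a y b] d_cup[of x a y b] by (simp add: cocycles_Suc cup_zero)

lemma bracket_cocycle:
  "x \<in> cocycles K (Suc a) \<Longrightarrow> y \<in> cocycles K (Suc b) \<Longrightarrow> bracket a b x y \<in> cocycles K (Suc (a + b))"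
  using bracket_closed[of x a y b] d_bracket[of x a y b]
  by (simp add: cocycles_Suc bracket_zero)

text \<open>
  Cup product and bracket with a cocycle preserve coboundaries, because \<open>d\<close> is a derivation of
  both.  Hence both operations descend to cohomology.
\<close>

lemma cup_coboundary_left:
  assumes b: "b \<in> coboundaries K (Suc m)" and y: "y \<in> cocycles K (Suc n)"
  shows "cup m n b y \<in> coboundaries K (Suc (Suc (m + n)))"
  using b
proof (cases rule: coboundaries_Suc_cases)
  case 1
  then show ?thesis using y by (simp add: cup_zero cocycles_Suc coboundaries_0)
next
  case (2 a x)
  have "d (1 + a + n) (cup a n x y) = - cup m n b y"
    using d_cup[of x a y n] 2 y by (simp add: cocycles_Suc cup_zero)
  moreover have "d (1 + a + n) (cup a n x y) \<in> coboundaries K (Suc (Suc (m + n)))"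
    using d_in_coboundaries[of "cup a n x y" "1 + a + n"] cup_closed[of x a y n] 2 y by (simp add: cocycles_Suc)
  ultimately show ?thesis using coboundaries_minus by fastforce
qed

lemma cup_coboundary_right:
  assumes b: "b \<in> coboundaries K (Suc m)" and y: "y \<in> cocycles K (Suc n)"
  shows "cup n m y b \<in> coboundaries K (Suc (Suc (n + m)))"
  using b
proof (cases rule: coboundaries_Suc_cases)
  case 1
  then show ?thesis using y by (simp add: cup_zero cocycles_Suc coboundaries_0)
next
  case (2 a x)
  have "d (1 + n + a) (cup n a y x) = - sg n (cup n m y b)"
    using d_cup[of y n x a] 2 y by (simp add: cocycles_Suc cup_zero)
  moreover have "d (1 + n + a) (cup n a y x) \<in> coboundaries K (Suc (Suc (n + m)))"
    using d_in_coboundaries[of "cup n a y x" "1 + n + a"] cup_closed[of y n x a] 2 y by (simp add: cocycles_Suc)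
  ultimately have "- sg n (- sg n (cup n m y b)) \<in> coboundaries K (Suc (Suc (n + m)))"
    by (simp add: coboundaries_minus coboundaries_sg)
  then show ?thesis by (simp add: sg_minus)
qed

lemma bracket_coboundary_left:
  assumes b: "b \<in> coboundaries K (Suc m)" and y: "y \<in> cocycles K (Suc n)"
  shows "bracket m n b y \<in> coboundaries K (Suc (m + n))"
  using b
proof (cases rule: coboundaries_Suc_cases)
  case 1
  then show ?thesis using y by (simp add: bracket_zero cocycles_Suc coboundaries_0)
next
  case (2 a x)
  have "d (a + n) (bracket a n x y) = bracket m n b y"
    using d_bracket[of x a y n] 2 y by (simp add: cocycles_Suc bracket_zero)
  moreover have "d (a + n) (bracket a n x y) \<in> coboundaries K (Suc (m + n))"
    using d_in_coboundaries[of "bracket a n x y" "a + n"] bracket_closed[of x a y n] 2 y by (simp add: cocycles_Suc)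
  ultimately show ?thesis by simp
qed

lemma bracket_coboundary_right:
  assumes b: "b \<in> coboundaries K (Suc m)" and y: "y \<in> cocycles K (Suc n)"
  shows "bracket n m y b \<in> coboundaries K (Suc (n + m))"
  using bracket_coboundary_left[OF assms] bracket_antisym[of n m y b]
  by (simp add: coboundaries_minus coboundaries_sg add.commute)

abbreviation product :: "nat \<Rightarrow> nat \<Rightarrow> 'a \<Rightarrow> 'a \<Rightarrow> 'a"
  where "product a b x y \<equiv> - sg a (cup a b x y)"

lemma cocycle_in_P: "x \<in> cocycles K (Suc a) \<Longrightarrow> x \<in> P (Suc a)"
  by (simp add: cocycles_Suc)

lemma coboundary_in_P: "x \<in> coboundaries K (Suc a) \<Longrightarrow> x \<in> P (Suc a)"
  using coboundaries_subset_cocycles cocycle_in_P by blast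

text \<open>
  The defect \<open>(x + u)(y + v) - x y = x v + u (y + v)\<close> is a coboundary, as \<open>y + v\<close> is still a cocycle.
\<close>

lemma product_coclass:
  assumes x: "x \<in> cocycles K (Suc a)" and y: "y \<in> cocycles K (Suc b)"
  shows "induced_op K (Suc (Suc (a + b))) (operad_prod pc sc \<pi> (Suc a) (Suc b))
      (coclass K (Suc a) x) (coclass K (Suc b) y) = coclass K (Suc (Suc (a + b))) (product a b x y)"
proof -
  have "induced_op K (Suc (Suc (a + b))) (operad_prod pc sc \<pi> (Suc a) (Suc b))
      (coclass K (Suc a) x) (coclass K (Suc b) y) =
      coclass K (Suc (Suc (a + b))) (operad_prod pc sc \<pi> (Suc a) (Suc b) x y)"
  proof (rule induced_op_coclass)
    fix u v assume u: "u \<in> coboundaries K (Suc a)" and v: "v \<in> coboundaries K (Suc b)"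
    note in_P = cocycle_in_P[OF x] cocycle_in_P[OF y] coboundary_in_P[OF u] coboundary_in_P[OF v]
    have yv: "y + v \<in> cocycles K (Suc b)"
      using y v coboundaries_subset_cocycles by (auto intro: cocycles_add)
    have "operad_prod pc sc \<pi> (Suc a) (Suc b) (x + u) (y + v) - operad_prod pc sc \<pi> (Suc a) (Suc b) x y
       = - sg a (cup a b x v + cup a b u (y + v))"
      using in_P by (simp add: operad_prod_eq_cup P_add cup_add sg_add)
    also have "\<dots> \<in> coboundaries K (Suc (Suc (a + b)))"
      by (intro coboundaries_minus coboundaries_sg coboundaries_add cup_coboundary_left[OF u yv] cup_coboundary_right[OF v x])
    finally show "operad_prod pc sc \<pi> (Suc a) (Suc b) (x + u) (y + v) - operad_prod pc sc \<pi> (Suc a) (Suc b) x y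
       \<in> coboundaries K (Suc (Suc (a + b)))" .
  qed
  then show ?thesis using x y by (simp add: operad_prod_eq_cup cocycle_in_P)
qed

lemma bracket_coclass:
  assumes x: "x \<in> cocycles K (Suc a)" and y: "y \<in> cocycles K (Suc b)"
  shows "induced_op K (Suc (a + b)) (operad_bracket pc sc (Suc a) (Suc b))
      (coclass K (Suc a) x) (coclass K (Suc b) y) = coclass K (Suc (a + b)) (bracket a b x y)"
  unfolding operad_bracket_eq_bracket
proof (rule induced_op_coclass)
  fix u v assume u: "u \<in> coboundaries K (Suc a)" and v: "v \<in> coboundaries K (Suc b)"
  note in_P = cocycle_in_P[OF x] cocycle_in_P[OF y] coboundary_in_P[OF u] coboundary_in_P[OF v]
  have yv: "y + v \<in> cocycles K (Suc b)"
    using y v coboundaries_subset_cocycles by (auto intro: cocycles_add)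
  have "bracket a b (x + u) (y + v) - bracket a b x y = bracket a b x v + bracket a b u (y + v)"
    using in_P by (simp add: P_add bracket_add_left bracket_add_right)
  also have "\<dots> \<in> coboundaries K (Suc (a + b))"
    by (intro coboundaries_add bracket_coboundary_left[OF u yv] bracket_coboundary_right[OF v x])
  finally show "bracket a b (x + u) (y + v) - bracket a b x y \<in> coboundaries K (Suc (a + b))" .
qed

lemma product_cocycle:
  "x \<in> cocycles K (Suc a) \<Longrightarrow> y \<in> cocycles K (Suc b) \<Longrightarrow> product a b x y \<in> cocycles K (Suc (Suc (a + b)))"
  using cocycles_scale[OF cup_cocycle[of x a y b], of "(-1) ^ Suc a"]
  by (simp add: K_scale scale_sign_eq_sg[OF sc_vector_space] sg_Suc del: power_Suc)

lemma product_comm: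
  assumes x: "x \<in> cocycles K (Suc a)" and y: "y \<in> cocycles K (Suc b)"
  shows "coclass K (Suc (Suc (a + b))) (product a b x y) =
    coclass K (Suc (Suc (a + b))) (sg (Suc a * Suc b) (product b a y x))"
proof -
  have homotopy: "d (a + b) (pre a b x y) = - cup a b x y - sg (a * b) (cup b a y x)"
    using x y by (intro cup_comm_up_to_homotopy) (auto simp: cocycles_Suc)
  have "product a b x y - sg (Suc a * Suc b) (product b a y x) = sg a (d (a + b) (pre a b x y))"
    unfolding homotopy by (cases "even a"; cases "even b") (simp_all add: sg_def algebra_simps)
  moreover have "d (a + b) (pre a b x y) \<in> coboundaries K (Suc (Suc (a + b)))"
    using x y by (intro d_in_coboundaries pre_closed cocycle_in_P)
  ultimately show ?thesis unfolding coclass_eq_iff by (simp add: coboundaries_sg)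
qed

lemma product_assoc:
  assumes x: "x \<in> cocycles K (Suc a)" and y: "y \<in> cocycles K (Suc b)" and z: "z \<in> cocycles K (Suc c)"
  shows "product (Suc (a + b)) c (product a b x y) z = product a (Suc (b + c)) x (product b c y z)"
proof -
  have in_P: "x \<in> P (Suc a)" "y \<in> P (Suc b)" "z \<in> P (Suc c)" "cup a b x y \<in> P (Suc (Suc (a + b)))"
    "cup b c y z \<in> P (Suc (Suc (b + c)))"
    using x y z cup_closed[of x a y b] cup_closed[of y b z c] by (simp_all add: cocycle_in_P)
  have "product (Suc (a + b)) c (product a b x y) z = sg (Suc b) (cup (Suc (a + b)) c (cup a b x y) z)"
    using cup_sg(1)[of "cup a b x y" "Suc (a + b)" z c "Suc a"] in_P
    by (cases "even a"; cases "even b") (simp_all add: sg_def)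
  moreover have "product a (Suc (b + c)) x (product b c y z) = sg (a + b) (cup a (Suc (b + c)) x (cup b c y z))"
    using cup_sg(2)[of x a "cup b c y z" "Suc (b + c)" "Suc b"] in_P
    by (cases "even a"; cases "even b") (simp_all add: sg_def)
  ultimately show ?thesis using cup_assoc[of x a y b z c] in_P
    by (cases "even a"; cases "even b") (simp_all add: sg_def)
qed

lemma bracket_product_leibniz:
  assumes x: "x \<in> cocycles K (Suc a)" and y: "y \<in> cocycles K (Suc b)" and z: "z \<in> cocycles K (Suc c)"
  shows "coclass K (Suc (Suc (a + b + c))) (bracket a (Suc (b + c)) x (product b c y z)) =
    coclass K (Suc (Suc (a + b + c))) (product (a + b) c (bracket a b x y) z
      + sg (a * Suc b) (product b (a + c) y (bracket a c x z)))"
proof -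
  have in_P: "x \<in> P (Suc a)" "y \<in> P (Suc b)" "z \<in> P (Suc c)" "cup b c y z \<in> P (Suc (Suc (b + c)))"
    using x y z cup_closed[of y b z c] by (simp_all add: cocycle_in_P)
  have pull: "bracket a (Suc (b + c)) x (product b c y z) = sg (Suc b) (bracket a (Suc (b + c)) x (cup b c y z))"
    using bracket_sg(2)[of x a "cup b c y z" "Suc (b + c)" "Suc b"] in_P
    by (cases "even b") (simp_all add: sg_def)
  have homotopy: "bracket a (Suc (b + c)) x (cup b c y z) =
    sg a (d (a + b + c) (brace2 a b c x y z)
      + cup (a + b) c (bracket a b x y) z + sg (a * b) (cup b (a + c) y (bracket a c x z)))"
    using x y z leibniz_up_to_homotopy[of x a y b z c] by (simp add: cocycles_Suc)
  have "bracket a (Suc (b + c)) x (product b c y z) - (product (a + b) c (bracket a b x y) z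
      + sg (a * Suc b) (product b (a + c) y (bracket a c x z))) = sg (Suc (a + b)) (d (a + b + c) (brace2 a b c x y z))"
    unfolding pull homotopy by (cases "even a"; cases "even b") (simp_all add: sg_def algebra_simps)
  moreover have "d (a + b + c) (brace2 a b c x y z) \<in> coboundaries K (Suc (Suc (a + b + c)))"
    using in_P by (intro d_in_coboundaries brace2_closed)
  ultimately show ?thesis unfolding coclass_eq_iff by (simp add: coboundaries_sg)
qed

lemmas sc_class = scale_coclass[unfolded K_scale]

lemma sign_class:
  "cohomology_scale K n ((-1) ^ k) (coclass K n x) = coclass K n (sg k x)"
  by (simp add: sc_class K_scale scale_sign_eq_sg[OF sc_vector_space])

abbreviation G where "G \<equiv> cohomology_gerstenhaber K pc \<pi>"

lemma gcomp_G: "gcomp G n = cohomology K n" and gadd_G: "gadd G n = cohomology_add K n"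
  and gscale_G: "gscale G n = cohomology_scale K n"
  by (simp_all add: cohomology_gerstenhaber_def)

lemma gprod_G:
  assumes "x \<in> cocycles K (Suc a)" "y \<in> cocycles K (Suc b)"
  shows "gprod G (Suc a) (Suc b) (coclass K (Suc a) x) (coclass K (Suc b) y) =
    coclass K (Suc (Suc (a + b))) (product a b x y)"
  using product_coclass[OF assms] by (simp add: cohomology_gerstenhaber_def K_scale)

lemma gbracket_G:
  assumes "x \<in> cocycles K (Suc a)" "y \<in> cocycles K (Suc b)"
  shows "gbracket G (Suc a) (Suc b) (coclass K (Suc a) x) (coclass K (Suc b) y) =
    coclass K (Suc (a + b)) (bracket a b x y)"
  using bracket_coclass[OF assms] by (simp add: cohomology_gerstenhaber_def K_scale)

lemma cocycles_sg: "x \<in> cocycles K n \<Longrightarrow> sg k x \<in> cocycles K n"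
  using cocycles_scale[of x n "(-1) ^ k"] by (simp add: K_scale scale_sign_eq_sg[OF sc_vector_space])

lemmas G_simps = gcomp_G gadd_G gscale_G gprod_G gbracket_G add_coclass sc_class K_scale
  coclass_in cocycles_add cocycles_scale[unfolded K_scale] product_cocycle bracket_cocycle cocycles_sg

text \<open>
  Bilinearity on cohomology from bilinearity on cochains, stated once for product and bracket.
\<close>

lemma graded_bilinearI:
  assumes op: "\<And>a b x y. x \<in> cocycles K (Suc a) \<Longrightarrow> y \<in> cocycles K (Suc b) \<Longrightarrow>
      op (Suc a) (Suc b) (coclass K (Suc a) x) (coclass K (Suc b) y) = coclass K (deg (Suc a) (Suc b)) (\<beta> a b x y) \<and>
      \<beta> a b x y \<in> cocycles K (deg (Suc a) (Suc b))"
    and \<beta>: "\<And>a b x x' y c. x \<in> P (Suc a) \<Longrightarrow> x' \<in> P (Suc a) \<Longrightarrow> y \<in> P (Suc b) \<Longrightarrow>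
      \<beta> a b (x + x') y = \<beta> a b x y + \<beta> a b x' y \<and> \<beta> a b (sc c x) y = sc c (\<beta> a b x y)"
      "\<And>a b x y y' c. x \<in> P (Suc a) \<Longrightarrow> y \<in> P (Suc b) \<Longrightarrow> y' \<in> P (Suc b) \<Longrightarrow>
      \<beta> a b x (y + y') = \<beta> a b x y + \<beta> a b x y' \<and> \<beta> a b x (sc c y) = sc c (\<beta> a b x y)"
  shows "graded_bilinear G deg op"
  unfolding graded_bilinear_def
proof (intro allI impI conjI ballI)
  fix m n :: nat and X X' Y Y' and c :: 'k
  assume mn: "1 \<le> m" "1 \<le> n"
  obtain a b where [simp]: "m = Suc a" "n = Suc b" using mn by (metis Suc_le_D One_nat_def)
  note E = cohomology_elims[unfolded gcomp_G[symmetric]]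
  note simps = op G_simps \<beta> cocycle_in_P
  { assume "X \<in> gcomp G m" "Y \<in> gcomp G n"
    then obtain x y where [simp]: "x \<in> cocycles K (Suc a)" "X = coclass K (Suc a) x"
      "y \<in> cocycles K (Suc b)" "Y = coclass K (Suc b) y" by (auto elim!: E)
    show "op m n X Y \<in> gcomp G (deg m n)" by (simp add: simps)
    show "op m n (gscale G m c X) Y = gscale G (deg m n) c (op m n X Y)"
      using \<beta>(1)[of x a x y b c] by (simp add: simps)
    show "op m n X (gscale G n c Y) = gscale G (deg m n) c (op m n X Y)"
      using \<beta>(2)[of x a y b y c] by (simp add: simps) }
  { assume "X \<in> gcomp G m" "X' \<in> gcomp G m" "Y \<in> gcomp G n"
    then obtain x x' y where [simp]: "x \<in> cocycles K (Suc a)" "X = coclass K (Suc a) x"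
      "x' \<in> cocycles K (Suc a)" "X' = coclass K (Suc a) x'"
      "y \<in> cocycles K (Suc b)" "Y = coclass K (Suc b) y" by (auto elim!: E)
    show "op m n (gadd G m X X') Y = gadd G (deg m n) (op m n X Y) (op m n X' Y)" by (simp add: simps) }
  { assume "X \<in> gcomp G m" "Y \<in> gcomp G n" "Y' \<in> gcomp G n"
    then obtain x y y' where [simp]: "x \<in> cocycles K (Suc a)" "X = coclass K (Suc a) x"
      "y \<in> cocycles K (Suc b)" "Y = coclass K (Suc b) y"
      "y' \<in> cocycles K (Suc b)" "Y' = coclass K (Suc b) y'" by (auto elim!: E)
    show "op m n X (gadd G n Y Y') = gadd G (deg m n) (op m n X Y) (op m n X Y')" by (simp add: simps) }
qed

lemma sg_scale: "sg k (sc c x) = sc c (sg k x)"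
  by (simp add: sg_def)

lemma product_bilinear: "graded_bilinear G (\<lambda>m n. m + n) (gprod G)"
  by (rule graded_bilinearI[where \<beta> = "\<lambda>a b. product a b"])
    (simp_all add: gprod_G product_cocycle cup_add cup_scale sg_add sg_scale)

lemma bracket_bilinear: "graded_bilinear G (\<lambda>m n. m + n - 1) (gbracket G)"
  by (rule graded_bilinearI[where \<beta> = bracket])
    (simp_all add: gbracket_G bracket_cocycle bracket_add_left bracket_add_right bracket_scale)

text \<open>
  Every axiom is a statement about cocycles up to coboundaries: antisymmetry, the Jacobi identity
  and associativity hold on cochains, commutativity and the Leibniz rule up to the two homotopies.
\<close>

theorem cohomology_gerstenhaber_algebra: "gerstenhaber_algebra G"
proof -
  note E = cohomology_elims[unfolded gcomp_G[symmetric]]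
  have sym: "gprod G m n X Y = gscale G (m + n) ((-1) ^ (m * n)) (gprod G n m Y X) \<and>
      gbracket G m n X Y =
        gscale G (m + n - 1) (- ((-1) ^ ((m - 1) * (n - 1)))) (gbracket G n m Y X)"
    if mn: "1 \<le> m" "1 \<le> n" and XY: "X \<in> gcomp G m" "Y \<in> gcomp G n" for m n X Y
  proof -
    obtain a b where [simp]: "m = Suc a" "n = Suc b" using mn by (metis Suc_le_D One_nat_def)
    obtain x y where [simp]: "x \<in> cocycles K (Suc a)" "X = coclass K (Suc a) x"
      "y \<in> cocycles K (Suc b)" "Y = coclass K (Suc b) y" using XY by (auto elim!: E)
    have "gscale G (m + n) ((-1) ^ (m * n)) (gprod G n m Y X) =
        coclass K (Suc (Suc (a + b))) (sg (Suc a * Suc b) (product b a y x))"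
      using sign_class[of "m + n" "m * n"] by (simp add: gprod_G gscale_G add.commute del: power_Suc)
    moreover have "gscale G (m + n - 1) (- ((-1) ^ (a * b))) (gbracket G n m Y X) =
        coclass K (Suc (a + b)) (bracket a b x y)"
      using bracket_antisym[of a b x y]
      by (simp add: gbracket_G gscale_G sc_class K_scale scale_sign_eq_sg[OF sc_vector_space] add.commute)
    ultimately show ?thesis using product_comm[of x a y b] by (simp add: gprod_G gbracket_G)
  qed
  have assoc_jacobi_leibniz: "gprod G (m + n) p (gprod G m n X Y) Z = gprod G m (n + p) X (gprod G n p Y Z) \<and>
      gbracket G m (n + p - 1) X (gbracket G n p Y Z) =
        gadd G (m + n + p - 2)
          (gbracket G (m + n - 1) p (gbracket G m n X Y) Z)
          (gscale G (m + n + p - 2) ((-1) ^ ((m - 1) * (n - 1)))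
            (gbracket G n (m + p - 1) Y (gbracket G m p X Z))) \<and>
      gbracket G m (n + p) X (gprod G n p Y Z) =
        gadd G (m + n + p - 1)
          (gprod G (m + n - 1) p (gbracket G m n X Y) Z)
          (gscale G (m + n + p - 1) ((-1) ^ ((m - 1) * n))
            (gprod G n (m + p - 1) Y (gbracket G m p X Z)))"
    if mnp: "1 \<le> m" "1 \<le> n" "1 \<le> p" and XYZ: "X \<in> gcomp G m" "Y \<in> gcomp G n" "Z \<in> gcomp G p"
    for m n p X Y Z
  proof -
    obtain a b c where [simp]: "m = Suc a" "n = Suc b" "p = Suc c"
      using mnp by (metis Suc_le_D One_nat_def)
    obtain x y z where [simp]: "x \<in> cocycles K (Suc a)" "X = coclass K (Suc a) x"
      "y \<in> cocycles K (Suc b)" "Y = coclass K (Suc b) y"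
      "z \<in> cocycles K (Suc c)" "Z = coclass K (Suc c) z" using XYZ by (auto elim!: E)
    have deg: "a + (b + c) = a + b + c" "b + (a + c) = a + b + c" by simp_all
    have 1: "gprod G (m + n) p (gprod G m n X Y) Z = gprod G m (n + p) X (gprod G n p Y Z)"
      using product_assoc[of x a y b z c]
        gprod_G[of "product a b x y" "Suc (a + b)" z c] gprod_G[of x a "product b c y z" "Suc (b + c)"]
      by (simp add: gprod_G product_cocycle deg)
    have 2: "gbracket G m (n + p - 1) X (gbracket G n p Y Z) =
        gadd G (m + n + p - 2)
          (gbracket G (m + n - 1) p (gbracket G m n X Y) Z)
          (gscale G (m + n + p - 2) ((-1) ^ ((m - 1) * (n - 1)))
            (gbracket G n (m + p - 1) Y (gbracket G m p X Z)))"
      using bracket_jacobi[of x a y b z c]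
        gbracket_G[of "bracket a b x y" "a + b" z c] gbracket_G[of x a "bracket b c y z" "b + c"]
        gbracket_G[of y b "bracket a c x z" "a + c"]
      by (simp add: gbracket_G bracket_cocycle gadd_G gscale_G sign_class add_coclass cocycle_in_P deg)
    have 3: "gbracket G m (n + p) X (gprod G n p Y Z) =
        gadd G (m + n + p - 1)
          (gprod G (m + n - 1) p (gbracket G m n X Y) Z)
          (gscale G (m + n + p - 1) ((-1) ^ ((m - 1) * n))
            (gprod G n (m + p - 1) Y (gbracket G m p X Z)))"
      using bracket_product_leibniz[of x a y b z c]
        gprod_G[of "bracket a b x y" "a + b" z c] gbracket_G[of x a "product b c y z" "Suc (b + c)"]
        gprod_G[of y b "bracket a c x z" "a + c"] sign_class[of _ "a * Suc b"]
      by (simp add: gbracket_G gprod_G bracket_cocycle product_cocycle gadd_G gscale_G add_coclass deg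
          del: mult_Suc_right)
    from 1 2 3 show ?thesis by blast
  qed
  show ?thesis unfolding gerstenhaber_algebra_def
    using cohomology_vector_space product_bilinear bracket_bilinear sym assoc_jacobi_leibniz
    unfolding gcomp_G gadd_G gscale_G by blast
qed

end

section \<open>Morphisms of operads with multiplication\<close>

text \<open>
  A morphism of operads respecting the multiplications commutes with differential, product and
  bracket on cochains, as these are made from \<open>\<pi>\<close> and partial compositions.
\<close>

locale operad_morphism =
  A: operad_complex sc P pc \<pi> K + B: operad_complex sc' P' pc' \<pi>' L
  for sc :: "'k::field \<Rightarrow> 'a::ab_group_add \<Rightarrow> 'a" and P pc \<pi> K
    and sc' :: "'k \<Rightarrow> 'b::ab_group_add \<Rightarrow> 'b" and P' pc' \<pi>' L +
  fixes F :: "nat \<Rightarrow> 'a \<Rightarrow> 'b"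
  assumes F_add: "F n (f + g) = F n f + F n g"
    and F_sc: "F n (sc a f) = sc' a (F n f)"
    and F_in: "1 \<le> n \<Longrightarrow> f \<in> P n \<Longrightarrow> F n f \<in> P' n"
    and F_pc: "1 \<le> i \<Longrightarrow> i \<le> m \<Longrightarrow> 1 \<le> n \<Longrightarrow> f \<in> P m \<Longrightarrow> g \<in> P n \<Longrightarrow>
      F (m + n - 1) (pc m n i f g) = pc' m n i (F m f) (F n g)"
    and F_\<pi>: "F 2 \<pi> = \<pi>'"
begin

lemma F_zero: "F n 0 = 0"
  using F_add[of n 0 0] by simp

lemma F_sum: "F n (\<Sum>i\<in>I. f i) = (\<Sum>i\<in>I. F n (f i))"
  by (induction I rule: infinite_finite_induct) (simp_all add: F_zero F_add)

sublocale chain_map K L F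
proof (rule chain_map.intro[OF A.linear_complex_axioms B.linear_complex_axioms], unfold_locales)
  fix n f g and a :: 'k
  show "F n (f + g) = F n f + F n g" by (rule F_add)
  show "F n (cscale K a f) = cscale L a (F n f)" by (simp add: A.K_scale B.K_scale F_sc)
  show "F n f \<in> cochains L n" if "f \<in> cochains K n"
    using that by (cases n) (simp_all add: A.K_cochains A.K_cochains_0 B.K_cochains B.K_cochains_0 F_zero F_in)
  show "diff L n (F n f) = F (n + 1) (diff K n f)" if f: "f \<in> cochains K n"
  proof (cases "n = 0")
    case True
    then show ?thesis using f by (simp add: A.K_cochains_0 A.K_diff_0 B.K_diff_0 F_zero)
  next
    case False
    then have n: "1 \<le> n" and fP: "f \<in> P n" using f by (simp_all add: A.K_cochains)
    have "F (n + 1) (pc 2 n i \<pi> f) = pc' 2 n i \<pi>' (F n f)" if "1 \<le> i" "i \<le> 2" for i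
      using F_pc[OF that n A.\<pi>_in_P fP] by (simp add: F_\<pi>)
    moreover have "F (n + 1) (pc n 2 i f \<pi>) = pc' n 2 i (F n f) \<pi>'" if "i \<in> {1..n}" for i
      using F_pc[of i n 2 f \<pi>] that A.\<pi>_in_P fP by (simp add: F_\<pi>)
    ultimately show ?thesis
      unfolding A.K_diff[OF n fP] B.K_diff[OF n F_in[OF n fP]] F_add F_sc F_sum by simp
  qed
qed

lemma F_bullet:
  assumes "1 \<le> m" "1 \<le> n" "f \<in> P m" "g \<in> P n"
  shows "F (m + n - 1) (operad_bullet pc sc m n f g) = operad_bullet pc' sc' m n (F m f) (F n g)"
  unfolding operad_bullet_def F_sum F_sc using assms by (intro sum.cong refl) (auto simp: F_pc[simplified])

lemma F_bracket:
  assumes "1 \<le> m" "1 \<le> n" "f \<in> P m" "g \<in> P n"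
  shows "F (m + n - 1) (operad_bracket pc sc m n f g) = operad_bracket pc' sc' m n (F m f) (F n g)"
proof -
  have "F n (x - y) = F n x - F n y" for n x y
    using F_add[of n "x - y" y] by (simp add: algebra_simps)
  then show ?thesis
    using F_bullet[of m n f g] F_bullet[of n m g f] assms
    by (simp add: operad_bracket_def F_sc add.commute)
qed

lemma F_prod:
  assumes "1 \<le> m" "1 \<le> n" "f \<in> P m" "g \<in> P n"
  shows "F (m + n) (operad_prod pc sc \<pi> m n f g) = operad_prod pc' sc' \<pi>' m n (F m f) (F n g)"
  using F_pc[of 1 "n + 1" m "pc 2 n 2 \<pi> g" f] F_pc[of 2 2 n \<pi> g]
    A.pc_closed[of 2 2 n \<pi> g] A.\<pi>_in_P assms
  by (simp add: operad_prod_def F_sc F_\<pi> add.commute)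

theorem induced_gerstenhaber_morphism: "gerstenhaber_morphism A.G B.G (\<lambda>n. induced_map L n (F n))"
  unfolding gerstenhaber_morphism_def
proof (intro conjI allI impI ballI)
  show "gerstenhaber_algebra A.G" by (rule A.cohomology_gerstenhaber_algebra)
  show "gerstenhaber_algebra B.G" by (rule B.cohomology_gerstenhaber_algebra)
  note E = A.cohomology_elims[unfolded A.gcomp_G[symmetric]]
  fix n :: nat and X Y and a :: 'k
  note lin = F_cohomology_linear[of n, unfolded cohomology_linear_def]
  { assume "X \<in> gcomp A.G n"
    then show "induced_map L n (F n) X \<in> gcomp B.G n"
      "induced_map L n (F n) (gscale A.G n a X) = gscale B.G n a (induced_map L n (F n) X)"
      using lin by (auto simp: A.gcomp_G A.gscale_G B.gcomp_G B.gscale_G) }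
  { assume "X \<in> gcomp A.G n" "Y \<in> gcomp A.G n"
    then show "induced_map L n (F n) (gadd A.G n X Y) = gadd B.G n (induced_map L n (F n) X) (induced_map L n (F n) Y)"
      using lin by (auto simp: A.gcomp_G A.gadd_G B.gadd_G) }
  fix m :: nat
  assume mn: "1 \<le> m" "1 \<le> n" and XY: "X \<in> gcomp A.G m" "Y \<in> gcomp A.G n"
  obtain p q where [simp]: "m = Suc p" "n = Suc q" using mn by (metis Suc_le_D One_nat_def)
  obtain x y where [simp]: "X = coclass K (Suc p) x" "Y = coclass K (Suc q) y"
    and xy: "x \<in> cocycles K (Suc p)" "y \<in> cocycles K (Suc q)" using XY by (auto elim!: E)
  note xy' = xy[THEN A.cocycle_in_P]
  note Fxy = xy[THEN F_cocycle] 
  have "F (m + n) (A.product p q x y) = B.product p q (F m x) (F n y)"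
    using F_prod[OF mn, of x y] xy' Fxy[THEN B.cocycle_in_P]
    by (simp add: A.operad_prod_eq_cup B.operad_prod_eq_cup)
  then show "induced_map L (m + n) (F (m + n)) (gprod A.G m n X Y) =
      gprod B.G m n (induced_map L m (F m) X) (induced_map L n (F n) Y)"
    using xy Fxy by (simp add: A.gprod_G B.gprod_G F_coclass)
  have "F (m + n - 1) (A.bracket p q x y) = B.bracket p q (F m x) (F n y)"
    using F_bracket[OF mn, of x y] xy'
    by (simp add: A.operad_bracket_eq_bracket B.operad_bracket_eq_bracket)
  then show "induced_map L (m + n - 1) (F (m + n - 1)) (gbracket A.G m n X Y) =
      gbracket B.G m n (induced_map L m (F m) X) (induced_map L n (F n) Y)"
    using xy Fxy by (simp add: A.gbracket_G B.gbracket_G F_coclass)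
qed

end

section \<open>Partial compositions of tensor-valued maps\<close>

interpretation tens: vector_space "tscale :: 'k::field \<Rightarrow> ('w, 'k) tens \<Rightarrow> _"
  by (rule vector_space_tscale)

lemma sum_fun_apply: "(\<Sum>i\<in>I. f i) x = (\<Sum>i\<in>I. f i x :: 'b::comm_monoid_add)"
  by (induction I rule: infinite_finite_induct) simp_all

lemma tscale_apply: "tscale a t \<phi> = a * t \<phi>"
  by (simp add: tscale_def)

lemma tensors_add: "t \<in> tensors \<Phi> W \<Longrightarrow> t' \<in> tensors \<Phi> W \<Longrightarrow> t + t' \<in> tensors \<Phi> W"
  unfolding tensors_def by (rule tens.span_add)

lemma tensors_scale: "t \<in> tensors \<Phi> W \<Longrightarrow> tscale a t \<in> tensors \<Phi> W"
  unfolding tensors_def by (rule tens.span_scale)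

lemma tensors_zero: "0 \<in> tensors \<Phi> W"
  unfolding tensors_def by (rule tens.span_zero)

lemma tensors_pure: "w \<in> W \<Longrightarrow> pure_tensor \<Phi> w \<in> tensors \<Phi> W"
  unfolding tensors_def by (rule tens.span_base) simp

text \<open>
  A tensor is a finite sum of multiples of pure tensors.  Two linear maps on tensors thus agree if
  they agree on pure tensors, and a tensor sees of a form only its values on tuples.
\<close>

lemma tensors_induct [consumes 1, case_names zero step]:
  assumes "t \<in> tensors \<Phi> W" "Q 0"
    and "\<And>a w t. w \<in> W \<Longrightarrow> t \<in> tensors \<Phi> W \<Longrightarrow> Q t \<Longrightarrow> Q (tscale a (pure_tensor \<Phi> w) + t)"
  shows "Q t"
proof -
  have "t \<in> tensors \<Phi> W \<and> Q t"
    using assms(1) unfolding tensors_def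
  proof (induction rule: tens.span_induct_alt)
    case base
    have "0 \<in> tens.span (pure_tensor \<Phi> ` W) \<and> Q 0" using assms(2) tens.span_zero by blast
    then show ?case .
  next
    case (step c x y)
    then obtain w where w: "w \<in> W" "x = pure_tensor \<Phi> w"
      and y: "y \<in> tens.span (pure_tensor \<Phi> ` W)" "Q y" by blast
    have "x \<in> tens.span (pure_tensor \<Phi> ` W)" using w by (auto intro: tens.span_base)
    then have "tscale c x + y \<in> tens.span (pure_tensor \<Phi> ` W)"
      using y by (intro tens.span_add tens.span_scale)
    moreover have "Q (tscale c x + y)" using assms(3)[OF w(1)] y w(2) by (simp only: tensors_def)
    ultimately have "tscale c x + y \<in> tens.span (pure_tensor \<Phi> ` W) \<and> Q (tscale c x + y)" ..
    then show ?case .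
  qed
  then show ?thesis by simp
qed

lemma tensors_linear_eqI:
  assumes "t \<in> tensors \<Phi> W"
    and "\<And>t t'. F (t + t') = F t + F t'" "\<And>a t. F (tscale a t) = tscale a (F t)"
    and "\<And>t t'. G (t + t') = G t + G t'" "\<And>a t. G (tscale a t) = tscale a (G t)"
    and "\<And>w. w \<in> W \<Longrightarrow> F (pure_tensor \<Phi> w) = G (pure_tensor \<Phi> w)"
  shows "F t = G t"
  using assms(1)
proof (induction rule: tensors_induct)
  case zero
  have "F 0 = 0" "G 0 = 0" using assms(3,5)[of 0 0] by simp_all
  then show ?case by (simp add: zero_fun_def)
next
  case (step a w t)
  then show ?case by (simp only: assms(2-6))
qed

lemma tensors_linear_closed:
  assumes "t \<in> tensors \<Phi> W"
    and "\<And>t t'. F (t + t') = F t + F t'" "\<And>a t. F (tscale a t) = tscale a (F t)"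
    and "\<And>w. w \<in> W \<Longrightarrow> F (pure_tensor \<Phi> w) \<in> tensors \<Psi> W'"
  shows "F t \<in> tensors \<Psi> W'"
  using assms(1)
proof (induction rule: tensors_induct)
  case zero
  have "F 0 = 0" using assms(3)[of 0 0] by simp
  then show ?case using tensors_zero by (simp add: zero_fun_def)
next
  case (step a w t)
  have "F (tscale a (pure_tensor \<Phi> w) + t) = tscale a (F (pure_tensor \<Phi> w)) + F t"
    by (simp only: assms(2,3))
  also have "\<dots> \<in> tensors \<Psi> W'"
    using step by (intro tensors_add tensors_scale assms(4))
  finally show ?case .
qed

lemma tensors_eq_on:
  assumes "t \<in> tensors \<Phi> W" "\<phi> \<in> \<Phi>" "\<phi>' \<in> \<Phi>" "\<And>w. w \<in> W \<Longrightarrow> \<phi> w = \<phi>' w"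
  shows "t \<phi> = t \<phi>'"
  using tensors_apply_linear[OF assms(1) assms(3) assms(3) assms(2), of 1 0] assms(4) by simp

lemma linear_functional_iff:
  fixes s :: "'k::field \<Rightarrow> 'c::ab_group_add \<Rightarrow> 'c"
  assumes "vector_space s"
  shows "Vector_Spaces.linear s (*) l \<longleftrightarrow>
    (\<forall>x y. l (x + y) = l x + l y) \<and> (\<forall>c x. l (s c x) = c * l x)"
  using assms by (simp add: Vector_Spaces.linear_iff vector_space_mult)

lemma Hom_iff:
  fixes s :: "'k::field \<Rightarrow> 'c::ab_group_add \<Rightarrow> 'c"
  assumes "vector_space s"
  shows "f \<in> Hom s T \<longleftrightarrow> (\<forall>x y. f (x + y) = f x + f y) \<and> (\<forall>c x. f (s c x) = tscale c (f x)) \<and> (\<forall>x. f x \<in> T)"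
  using assms vector_space_tscale by (auto simp: Hom_def Vector_Spaces.linear_iff)

lemma multilinear_formsD:
  "\<psi> \<in> multilinear_forms s n \<Longrightarrow> length w = n \<Longrightarrow> i < n \<Longrightarrow> Vector_Spaces.linear s (*) (\<lambda>x. \<psi> (w[i := x]))"
  by (simp add: multilinear_forms_def)

lemma slot_form_inner:
  fixes s :: "'k::field \<Rightarrow> 'c::ab_group_add \<Rightarrow> 'c"
  assumes \<psi>: "\<psi> \<in> multilinear_forms s (m + n - 1)" and w: "length w = m" and i: "1 \<le> i" "i \<le> m"
  shows "(\<lambda>u. \<psi> (take (i - 1) w @ u @ drop i w)) \<in> multilinear_forms s n"
  unfolding multilinear_forms_def mem_Collect_eq
proof (intro allI impI)
  fix u :: "'c list" and k assume u: "length u = n" "k < n"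
  have "(take (i - 1) w @ u @ drop i w)[i - 1 + k := x] = take (i - 1) w @ u[k := x] @ drop i w" for x
    using u w i by (auto simp: list_update_append)
  moreover have "Vector_Spaces.linear s (*) (\<lambda>x. \<psi> ((take (i - 1) w @ u @ drop i w)[i - 1 + k := x]))"
    by (rule multilinear_formsD[OF \<psi>]) (use u w i in auto)
  ultimately show "Vector_Spaces.linear s (*) (\<lambda>x. \<psi> (take (i - 1) w @ u[k := x] @ drop i w))" by simp
qed

lemma slot_map_linear:
  "slot_map s m n i g (t + t') = slot_map s m n i g t + slot_map s m n i g t'"
  "slot_map s m n i g (tscale a t) = tscale a (slot_map s m n i g t)"
  by (simp_all add: slot_map_def tscale_def fun_eq_iff)

lemma slot_map_pure_apply:
  fixes s :: "'k::field \<Rightarrow> 'c::ab_group_add \<Rightarrow> 'c"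
  assumes "vector_space s" "g \<in> Hom s (tensor_power s n)" "1 \<le> i" "i \<le> m"
    and "\<psi> \<in> multilinear_forms s (m + n - 1)"
  shows "slot_map s m n i g (pure_tensor (multilinear_forms s m) w) \<psi> =
    g (w ! (i - 1)) (\<lambda>u. \<psi> (take (i - 1) w @ u @ drop i w))"
  using slot_map_form[OF assms] assms(5) by (simp add: slot_map_def pure_tensor_def)

lemma slot_map_outside:
  "\<psi> \<notin> multilinear_forms s (m + n - 1) \<Longrightarrow> slot_map s m n i g t \<psi> = 0"
  by (simp add: slot_map_def)

lemma slot_map_closed:
  fixes s :: "'k::field \<Rightarrow> 'c::ab_group_add \<Rightarrow> 'c"
  assumes s: "vector_space s" and g: "g \<in> Hom s (tensor_power s n)" and i: "1 \<le> i" "i \<le> m"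
    and t: "t \<in> tensor_power s m"
  shows "slot_map s m n i g t \<in> tensor_power s (m + n - 1)"
  using t unfolding tensor_power_def
proof (rule tensors_linear_closed)
  fix w :: "'c list" assume "w \<in> {w. length w = m}"
  then have w: "length w = m" by simp
  define insert_at where "insert_at \<tau> = (\<lambda>\<psi>. if \<psi> \<in> multilinear_forms s (m + n - 1)
      then \<tau> (\<lambda>u. \<psi> (take (i - 1) w @ u @ drop i w)) else 0)" for \<tau> :: "('c list, 'k) tens"
  have "g (w ! (i - 1)) \<in> tensors (multilinear_forms s n) {w. length w = n}"
    using g by (auto simp: Hom_def tensor_power_def)
  then have "insert_at (g (w ! (i - 1))) \<in> tensors (multilinear_forms s (m + n - 1)) {w. length w = m + n - 1}"
  proof (rule tensors_linear_closed)
    fix u :: "'c list" assume "u \<in> {u. length u = n}"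
    then have "insert_at (pure_tensor (multilinear_forms s n) u) =
        pure_tensor (multilinear_forms s (m + n - 1)) (take (i - 1) w @ u @ drop i w)"
      using slot_form_inner[OF _ w i] by (auto simp: insert_at_def pure_tensor_def fun_eq_iff)
    moreover have "length (take (i - 1) w @ u @ drop i w) = m + n - 1" using \<open>u \<in> _\<close> w i by simp
    ultimately show "insert_at (pure_tensor (multilinear_forms s n) u) \<in>
        tensors (multilinear_forms s (m + n - 1)) {w. length w = m + n - 1}"
      by (simp add: tensors_pure del: length_append)
  qed (auto simp: insert_at_def tscale_def fun_eq_iff)
  moreover have "slot_map s m n i g (pure_tensor (multilinear_forms s m) w) = insert_at (g (w ! (i - 1)))"
    using slot_map_pure_apply[OF s g i] by (auto simp: insert_at_def fun_eq_iff slot_map_outside)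
  ultimately show "slot_map s m n i g (pure_tensor (multilinear_forms s m) w) \<in>
      tensors (multilinear_forms s (m + n - 1)) {w. length w = m + n - 1}" by simp
qed (rule slot_map_linear)+

lemma slot_map_eqI:
  fixes s :: "'k::field \<Rightarrow> 'c::ab_group_add \<Rightarrow> 'c"
  assumes "t \<in> tensor_power s m"
    and "\<And>t t'. F (t + t') = F t + F t'" "\<And>a t. F (tscale a t) = tscale a (F t)"
    and "\<And>t t'. G (t + t') = G t + G t'" "\<And>a t. G (tscale a t) = tscale a (G t)"
    and "\<And>w \<psi>. length w = m \<Longrightarrow> F (pure_tensor (multilinear_forms s m) w) \<psi> = G (pure_tensor (multilinear_forms s m) w) \<psi>"
  shows "F t = G t"
  using assms(1)[unfolded tensor_power_def] assms(2-5)
  by (rule tensors_linear_eqI) (use assms(6) in \<open>auto simp: fun_eq_iff\<close>)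

lemma slot_map_add_map:
  fixes s :: "'k::field \<Rightarrow> 'c::ab_group_add \<Rightarrow> 'c"
  assumes s: "vector_space s" and g: "g \<in> Hom s (tensor_power s n)" "g' \<in> Hom s (tensor_power s n)"
    and gg: "g + g' \<in> Hom s (tensor_power s n)"
    and i: "1 \<le> i" "i \<le> m" and t: "t \<in> tensor_power s m"
  shows "slot_map s m n i (g + g') t = slot_map s m n i g t + slot_map s m n i g' t"
proof (rule slot_map_eqI[OF t, where G = "\<lambda>t. slot_map s m n i g t + slot_map s m n i g' t"])
  fix w :: "'c list" and \<psi> assume "length w = m"
  show "slot_map s m n i (g + g') (pure_tensor (multilinear_forms s m) w) \<psi> =
    (slot_map s m n i g (pure_tensor (multilinear_forms s m) w)
      + slot_map s m n i g' (pure_tensor (multilinear_forms s m) w)) \<psi>"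
    by (cases "\<psi> \<in> multilinear_forms s (m + n - 1)")
      (simp_all add: slot_map_pure_apply[OF s _ i] g gg slot_map_outside)
qed (simp_all only: slot_map_linear tens.scale_right_distrib ac_simps)

lemma slot_map_scale_map:
  fixes s :: "'k::field \<Rightarrow> 'c::ab_group_add \<Rightarrow> 'c"
  assumes s: "vector_space s" and g: "g \<in> Hom s (tensor_power s n)" 
    and ag: "(\<lambda>x. tscale a (g x)) \<in> Hom s (tensor_power s n)"
    and i: "1 \<le> i" "i \<le> m" and t: "t \<in> tensor_power s m"
  shows "slot_map s m n i (\<lambda>x. tscale a (g x)) t = tscale a (slot_map s m n i g t)"
proof (rule slot_map_eqI[OF t, where G = "\<lambda>t. tscale a (slot_map s m n i g t)"])
  fix w :: "'c list" and \<psi> assume "length w = m"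
  show "slot_map s m n i (\<lambda>x. tscale a (g x)) (pure_tensor (multilinear_forms s m) w) \<psi> =
    tscale a (slot_map s m n i g (pure_tensor (multilinear_forms s m) w)) \<psi>"
    by (cases "\<psi> \<in> multilinear_forms s (m + n - 1)")
      (simp_all add: slot_map_pure_apply[OF s _ i] g ag slot_map_outside tscale_apply)
qed (simp_all only: slot_map_linear tens.scale_right_distrib tens.scale_left_commute)

lemma slot_map_Hom:
  fixes s :: "'k::field \<Rightarrow> 'c::ab_group_add \<Rightarrow> 'c"
  assumes s: "vector_space s" and f: "f \<in> Hom s (tensor_power s m)" and g: "g \<in> Hom s (tensor_power s n)"
    and i: "1 \<le> i" "i \<le> m"
  shows "slot_map s m n i g \<circ> f \<in> Hom s (tensor_power s (m + n - 1))"
  using f slot_map_closed[OF s g i] by (simp add: Hom_iff[OF s] slot_map_linear)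

text \<open>
  On a pure tensor both sides pair \<open>g (w\<^sub>i)\<close> with a form in which \<open>h\<close> is applied to the \<open>j\<close>-th
  argument; the two forms agree on lists of length \<open>n\<close>.
\<close>

lemma slot_map_sequential:
  fixes s :: "'k::field \<Rightarrow> 'c::ab_group_add \<Rightarrow> 'c"
  assumes s: "vector_space s" and g: "g \<in> Hom s (tensor_power s n)" and h: "h \<in> Hom s (tensor_power s p)"
    and ij: "1 \<le> i" "i \<le> m" "1 \<le> j" "j \<le> n" and p: "1 \<le> p" and t: "t \<in> tensor_power s m"
  shows "slot_map s (m + n - 1) p (i - 1 + j) h (slot_map s m n i g t) =
    slot_map s m (n + p - 1) i (slot_map s n p j h \<circ> g) t"
proof (rule slot_map_eqI[OF t, where F = "\<lambda>t. slot_map s (m + n - 1) p (i - 1 + j) h (slot_map s m n i g t)"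
      and G = "slot_map s m (n + p - 1) i (slot_map s n p j h \<circ> g)"])
  fix w :: "'c list" and \<psi> assume w: "length w = m"
  let ?p = "pure_tensor (multilinear_forms s m) w"
  have deg: "m + (n + p - 1) - 1 = m + n - 1 + p - 1" using ij p by simp
  show "slot_map s (m + n - 1) p (i - 1 + j) h (slot_map s m n i g ?p) \<psi> =
    slot_map s m (n + p - 1) i (slot_map s n p j h \<circ> g) ?p \<psi>"
  proof (cases "\<psi> \<in> multilinear_forms s (m + n - 1 + p - 1)")
    case True
    have ij': "1 \<le> i - 1 + j" "i - 1 + j \<le> m + n - 1" using ij by auto
    define \<Theta> where "\<Theta> v = h (v ! (i - 1 + j - 1)) (\<lambda>u. \<psi> (take (i - 1 + j - 1) v @ u @ drop (i - 1 + j) v))" for v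
    have \<Theta>: "\<Theta> \<in> multilinear_forms s (m + n - 1)"
      unfolding \<Theta>_def by (rule slot_map_form[OF s h ij' True])
    let ?\<psi>' = "\<lambda>u. \<psi> (take (i - 1) w @ u @ drop i w)"
    have \<psi>': "?\<psi>' \<in> multilinear_forms s (n + p - 1)"
      by (rule slot_form_inner[OF _ w ij(1,2)]) (use True deg in simp)
    have gw: "g (w ! (i - 1)) \<in> tensors (multilinear_forms s n) {v. length v = n}"
      using g by (auto simp: Hom_def tensor_power_def)
    have "slot_map s (m + n - 1) p (i - 1 + j) h (slot_map s m n i g ?p) \<psi> = slot_map s m n i g ?p \<Theta>"
      unfolding slot_map_def[of s "m + n - 1"] by (simp only: True if_True \<Theta>_def[abs_def])
    also have "\<dots> = g (w ! (i - 1)) (\<lambda>u. \<Theta> (take (i - 1) w @ u @ drop i w))"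
      by (rule slot_map_pure_apply[OF s g ij(1,2) \<Theta>])
    also have "\<dots> = g (w ! (i - 1)) (\<lambda>v. h (v ! (j - 1)) (\<lambda>u. ?\<psi>' (take (j - 1) v @ u @ drop j v)))"
    proof (rule tensors_eq_on[OF gw])
      show "(\<lambda>u. \<Theta> (take (i - 1) w @ u @ drop i w)) \<in> multilinear_forms s n"
        by (rule slot_form_inner[OF \<Theta> w ij(1,2)])
      show "(\<lambda>v. h (v ! (j - 1)) (\<lambda>u. ?\<psi>' (take (j - 1) v @ u @ drop j v))) \<in> multilinear_forms s n"
        by (rule slot_map_form[OF s h ij(3,4) \<psi>'])
      fix v :: "'c list" assume "v \<in> {v. length v = n}"
      then have v: "length v = n" by simp
      let ?v = "take (i - 1) w @ v @ drop i w"
      have "?v ! (i - 1 + j - 1) = v ! (j - 1)" "take (i - 1 + j - 1) ?v = take (i - 1) w @ take (j - 1) v"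
        "drop (i - 1 + j) ?v = drop j v @ drop i w"
        using ij v w by (auto simp: nth_append)
      then show "\<Theta> ?v = h (v ! (j - 1)) (\<lambda>u. ?\<psi>' (take (j - 1) v @ u @ drop j v))"
        by (simp add: \<Theta>_def)
    qed
    also have "\<dots> = slot_map s n p j h (g (w ! (i - 1))) ?\<psi>'"
      using \<psi>' by (simp add: slot_map_def)
    also have "\<dots> = slot_map s m (n + p - 1) i (slot_map s n p j h \<circ> g) ?p \<psi>"
      using slot_map_pure_apply[OF s slot_map_Hom[OF s g h ij(3,4)] ij(1,2)] True deg by simp
    finally show ?thesis .
  next
    case False
    then show ?thesis using slot_map_outside[of \<psi> s m "n + p - 1"] deg by (simp add: slot_map_outside)
  qed
qed (simp_all only: slot_map_linear)

lemma double_form: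
  fixes s :: "'k::field \<Rightarrow> 'c::ab_group_add \<Rightarrow> 'c"
  assumes s: "vector_space s" and \<sigma>: "\<sigma> \<in> tensor_power s p"
    and 1: "\<And>x. length x = p \<Longrightarrow> (\<lambda>u. \<Psi> u x) \<in> multilinear_forms s n"
    and 2: "\<And>u. length u = n \<Longrightarrow> (\<lambda>x. \<Psi> u x) \<in> multilinear_forms s p"
  shows "(\<lambda>u. \<sigma> (\<lambda>x. \<Psi> u x)) \<in> multilinear_forms s n"
  unfolding multilinear_forms_def mem_Collect_eq linear_functional_iff[OF s]
proof (intro allI impI conjI)
  fix u :: "'c list" and l assume u: "length u = n" "l < n"
  have lin: "\<Psi> (u[l := y + y']) x = \<Psi> (u[l := y]) x + \<Psi> (u[l := y']) x"
    "\<Psi> (u[l := s c y]) x = c * \<Psi> (u[l := y]) x" if "length x = p" for x y y' c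
    using multilinear_formsD[OF 1[OF that] u] by (simp_all add: linear_functional_iff[OF s])
  note apply_lin = tensors_apply_linear[OF \<sigma>[unfolded tensor_power_def]]
  show "\<sigma> (\<lambda>x. \<Psi> (u[l := y + y']) x) = \<sigma> (\<lambda>x. \<Psi> (u[l := y]) x) + \<sigma> (\<lambda>x. \<Psi> (u[l := y']) x)" for y y'
    using apply_lin[OF 2[of "u[l := y]"] 2[of "u[l := y']"] 2[of "u[l := y + y']"], of 1 1] u lin by simp
  show "\<sigma> (\<lambda>x. \<Psi> (u[l := s c y]) x) = c * \<sigma> (\<lambda>x. \<Psi> (u[l := y]) x)" for c y
    using apply_lin[OF 2[of "u[l := y]"] 2[of "u[l := y]"] 2[of "u[l := s c y]"], of c 0] u lin by simp
qed

text \<open>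
  Both sides are the pairing of \<open>\<tau> \<otimes> \<sigma>\<close> with \<open>\<Psi>\<close>; the claim is linear in \<open>\<tau>\<close> and clear for
  pure \<open>\<tau>\<close>.
\<close>

lemma tensor_fubini:
  fixes s :: "'k::field \<Rightarrow> 'c::ab_group_add \<Rightarrow> 'c"
  assumes s: "vector_space s" and \<tau>: "\<tau> \<in> tensor_power s n" and \<sigma>: "\<sigma> \<in> tensor_power s p"
    and 1: "\<And>x. length x = p \<Longrightarrow> (\<lambda>u. \<Psi> u x) \<in> multilinear_forms s n"
    and 2: "\<And>u. length u = n \<Longrightarrow> (\<lambda>x. \<Psi> u x) \<in> multilinear_forms s p"
  shows "\<tau> (\<lambda>u. \<sigma> (\<lambda>x. \<Psi> u x)) = \<sigma> (\<lambda>x. \<tau> (\<lambda>u. \<Psi> u x))"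
  using \<tau> unfolding tensor_power_def
proof (induction rule: tensors_induct)
  have zero: "\<sigma> (\<lambda>_. 0) = 0"
  proof -
    have z: "(\<lambda>_. 0) \<in> multilinear_forms s p"
      by (simp add: multilinear_forms_def linear_functional_iff[OF s])
    show ?thesis
      using tensors_apply_linear[OF \<sigma>[unfolded tensor_power_def] z z z, of 0 0] by simp
  qed
  case zero
  then show ?case using \<open>\<sigma> (\<lambda>_. 0) = 0\<close> by simp
next
  case (step a w t)
  then have w: "length w = n" by simp
  have t: "t \<in> tensor_power s n" using step by (simp add: tensor_power_def)
  let ?p = "pure_tensor (multilinear_forms s n) w"
  have p: "?p \<in> tensor_power s n" unfolding tensor_power_def using w by (intro tensors_pure) simp
  have form: "(\<lambda>x. t' (\<lambda>u. \<Psi> u x)) \<in> multilinear_forms s p" if "t' \<in> tensor_power s n" for t'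
    using that by (rule double_form[OF s]) (use 1 2 in auto)
  have sum: "tscale a ?p + t \<in> tensor_power s n"
    using p t unfolding tensor_power_def by (intro tensors_add tensors_scale)
  have "\<sigma> (\<lambda>x. (tscale a ?p + t) (\<lambda>u. \<Psi> u x)) = a * \<sigma> (\<lambda>x. ?p (\<lambda>u. \<Psi> u x)) + 1 * \<sigma> (\<lambda>x. t (\<lambda>u. \<Psi> u x))"
    by (rule tensors_apply_linear[OF \<sigma>[unfolded tensor_power_def] form[OF p] form[OF t] form[OF sum]])
      (simp add: tscale_apply)
  moreover have "\<sigma> (\<lambda>x. ?p (\<lambda>u. \<Psi> u x)) = \<sigma> (\<lambda>x. \<Psi> w x)"
    by (rule tensors_eq_on[OF \<sigma>[unfolded tensor_power_def] form[OF p] 2[OF w]])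
      (use 1 in \<open>simp add: pure_tensor_def\<close>)
  moreover have "?p (\<lambda>u. \<sigma> (\<lambda>x. \<Psi> u x)) = \<sigma> (\<lambda>x. \<Psi> w x)"
    using double_form[OF s \<sigma> 1 2] by (simp add: pure_tensor_def)
  ultimately show ?case using step by (simp add: tscale_apply)
qed

text \<open>
  On a pure tensor the two sides evaluate \<open>g (w\<^sub>i)\<close> and \<open>h (w\<^sub>k)\<close>, in either order, on the form
  obtained from \<open>\<psi>\<close> by fixing the other entries of \<open>w\<close>.
\<close>

lemma slot_map_parallel:
  fixes s :: "'k::field \<Rightarrow> 'c::ab_group_add \<Rightarrow> 'c"
  assumes s: "vector_space s" and g: "g \<in> Hom s (tensor_power s n)" and h: "h \<in> Hom s (tensor_power s p)"
    and ik: "1 \<le> i" "i < k" "k \<le> m" and np: "1 \<le> n" "1 \<le> p" and t: "t \<in> tensor_power s m"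
  shows "slot_map s (m + n - 1) p (k - 1 + n) h (slot_map s m n i g t) =
    slot_map s (m + p - 1) n i g (slot_map s m p k h t)"
proof (rule slot_map_eqI[OF t, where F = "\<lambda>t. slot_map s (m + n - 1) p (k - 1 + n) h (slot_map s m n i g t)"
      and G = "\<lambda>t. slot_map s (m + p - 1) n i g (slot_map s m p k h t)"])
  fix w :: "'c list" and \<psi> assume w: "length w = m"
  let ?p = "pure_tensor (multilinear_forms s m) w"
  have deg: "m + p - 1 + n - 1 = m + n - 1 + p - 1" using ik np by simp
  show "slot_map s (m + n - 1) p (k - 1 + n) h (slot_map s m n i g ?p) \<psi> =
    slot_map s (m + p - 1) n i g (slot_map s m p k h ?p) \<psi>"
  proof (cases "\<psi> \<in> multilinear_forms s (m + n - 1 + p - 1)")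
    case True
    have True': "\<psi> \<in> multilinear_forms s (m + p - 1 + n - 1)" using True deg by simp
    have im: "i \<le> m" and k1: "1 \<le> k" using ik by auto
    have kn: "1 \<le> k - 1 + n" "k - 1 + n \<le> m + n - 1" and ip: "1 \<le> i" "i \<le> m + p - 1" using ik np by auto
    let ?gw = "g (w ! (i - 1))" and ?hw = "h (w ! (k - 1))"
    have gw: "?gw \<in> tensor_power s n" and hw: "?hw \<in> tensor_power s p"
      using g h by (auto simp: Hom_def)
    define \<Psi> where "\<Psi> u x = \<psi> (take (i - 1) w @ u @ drop i (take (k - 1) w) @ x @ drop k w)" for u x
    define \<Theta> where "\<Theta> v = h (v ! (k - 1 + n - 1)) (\<lambda>u. \<psi> (take (k - 1 + n - 1) v @ u @ drop (k - 1 + n) v))" for v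
    define \<Xi> where "\<Xi> v = g (v ! (i - 1)) (\<lambda>u. \<psi> (take (i - 1) v @ u @ drop i v))" for v
    have \<Theta>: "\<Theta> \<in> multilinear_forms s (m + n - 1)"
      unfolding \<Theta>_def by (rule slot_map_form[OF s h kn True])
    have \<Xi>: "\<Xi> \<in> multilinear_forms s (m + p - 1)"
      unfolding \<Xi>_def by (rule slot_map_form[OF s g ip True'])
    have lists_u: "take (k - 1 + n - 1) (take (i - 1) w @ u @ drop i w) = take (i - 1) w @ u @ drop i (take (k - 1) w)"
      "drop (k - 1 + n) (take (i - 1) w @ u @ drop i w) = drop k w"
      "(take (i - 1) w @ u @ drop i w) ! (k - 1 + n - 1) = w ! (k - 1)" if "length u = n" for u
      using that ik np w by (auto simp: nth_append drop_take)
    have lists_x: "take (i - 1) (take (k - 1) w @ x @ drop k w) = take (i - 1) w"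
      "drop i (take (k - 1) w @ x @ drop k w) = drop i (take (k - 1) w) @ x @ drop k w"
      "(take (k - 1) w @ x @ drop k w) ! (i - 1) = w ! (i - 1)" for x
      using ik np w by (auto simp: nth_append min_def)
    have form_x: "(\<lambda>u. \<Psi> u x) \<in> multilinear_forms s n" if "length x = p" for x
      using slot_form_inner[of \<psi> s "m + p - 1" n "take (k - 1) w @ x @ drop k w" i] True' that w ik np
      by (simp add: \<Psi>_def lists_x[simplified])
    have form_u: "(\<lambda>x. \<Psi> u x) \<in> multilinear_forms s p" if "length u = n" for u
      using slot_form_inner[of \<psi> s "m + n - 1" p "take (i - 1) w @ u @ drop i w" "k - 1 + n"] True that w ik np
        lists_u[OF that]
      by (simp add: \<Psi>_def)
    have "slot_map s (m + n - 1) p (k - 1 + n) h (slot_map s m n i g ?p) \<psi> = slot_map s m n i g ?p \<Theta>"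
      unfolding slot_map_def[of s "m + n - 1"] by (simp only: True if_True \<Theta>_def[abs_def])
    also have "\<dots> = ?gw (\<lambda>u. \<Theta> (take (i - 1) w @ u @ drop i w))"
      by (rule slot_map_pure_apply[OF s g ik(1) im \<Theta>])
    also have "\<dots> = ?gw (\<lambda>u. ?hw (\<lambda>x. \<Psi> u x))"
    proof (rule tensors_eq_on[OF gw[unfolded tensor_power_def]])
      show "(\<lambda>u. \<Theta> (take (i - 1) w @ u @ drop i w)) \<in> multilinear_forms s n"
        by (rule slot_form_inner[OF \<Theta> w ik(1) im])
      show "(\<lambda>u. ?hw (\<lambda>x. \<Psi> u x)) \<in> multilinear_forms s n"
        by (rule double_form[OF s hw form_x form_u])
      fix u :: "'c list" assume "u \<in> {w. length w = n}"
      then show "\<Theta> (take (i - 1) w @ u @ drop i w) = ?hw (\<lambda>x. \<Psi> u x)"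
        using lists_u[of u] by (simp add: \<Theta>_def \<Psi>_def)
    qed
    also have "\<dots> = ?hw (\<lambda>x. ?gw (\<lambda>u. \<Psi> u x))"
      by (rule tensor_fubini[OF s gw hw form_x form_u])
    also have "(\<lambda>x. ?gw (\<lambda>u. \<Psi> u x)) = (\<lambda>x. \<Xi> (take (k - 1) w @ x @ drop k w))"
      unfolding \<Xi>_def \<Psi>_def lists_x by simp
    also have "?hw (\<lambda>x. \<Xi> (take (k - 1) w @ x @ drop k w)) = slot_map s m p k h ?p \<Xi>"
      by (rule slot_map_pure_apply[OF s h k1 ik(3) \<Xi>, symmetric])
    also have "\<dots> = slot_map s (m + p - 1) n i g (slot_map s m p k h ?p) \<psi>"
      unfolding slot_map_def[of s "m + p - 1"] by (simp only: True' if_True \<Xi>_def[abs_def])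
    finally show ?thesis .
  next
    case False
    then show ?thesis using deg by (simp add: slot_map_outside)
  qed
qed (simp_all only: slot_map_linear)

lemma sum_additive_on:
  fixes F :: "'a::ab_group_add \<Rightarrow> 'b::ab_group_add"
  assumes "0 \<in> A" "\<And>x y. x \<in> A \<Longrightarrow> y \<in> A \<Longrightarrow> x + y \<in> A"
    and "\<And>x y. x \<in> A \<Longrightarrow> y \<in> A \<Longrightarrow> F (x + y) = F x + F y" "\<And>j. j \<in> J \<Longrightarrow> g j \<in> A"
  shows "F (\<Sum>j\<in>J. g j) = (\<Sum>j\<in>J. F (g j))"
proof -
  have "F 0 = 0" using assms(1) assms(3)[of 0 0] by simp
  then have "(\<Sum>j\<in>J. g j) \<in> A \<and> F (\<Sum>j\<in>J. g j) = (\<Sum>j\<in>J. F (g j))"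
    using assms(4) by (induction J rule: infinite_finite_induct) (simp_all add: assms(1-3))
  then show ?thesis ..
qed

lemma tensor_power_add: "t \<in> tensor_power s n \<Longrightarrow> t' \<in> tensor_power s n \<Longrightarrow> t + t' \<in> tensor_power s n"
  unfolding tensor_power_def by (rule tensors_add)

lemma tensor_power_scale: "t \<in> tensor_power s n \<Longrightarrow> tscale a t \<in> tensor_power s n"
  unfolding tensor_power_def by (rule tensors_scale)

lemma tensor_power_zero: "0 \<in> tensor_power s n"
  unfolding tensor_power_def by (rule tensors_zero)

lemma Hom_apply: "f \<in> Hom s T \<Longrightarrow> f x \<in> T"
  by (auto simp: Hom_def)

lemma Hom_power_zero:
  fixes s :: "'k::field \<Rightarrow> 'c::ab_group_add \<Rightarrow> 'c" and sM :: "'k \<Rightarrow> 'm::ab_group_add \<Rightarrow> 'm"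
  shows "vector_space sM \<Longrightarrow> 0 \<in> Hom sM (tensor_power s n)"
  using tensor_power_zero by (simp add: Hom_iff tscale_def zero_fun_def)

lemma Hom_power_add:
  fixes s :: "'k::field \<Rightarrow> 'c::ab_group_add \<Rightarrow> 'c" and sM :: "'k \<Rightarrow> 'm::ab_group_add \<Rightarrow> 'm"
  assumes "vector_space sM" "f \<in> Hom sM (tensor_power s n)" "g \<in> Hom sM (tensor_power s n)"
  shows "f + g \<in> Hom sM (tensor_power s n)"
proof -
  have "(f + g) x \<in> tensor_power s n" for x
    using tensor_power_add[OF Hom_apply[OF assms(2), of x] Hom_apply[OF assms(3), of x]] by (simp add: plus_fun_def)
  moreover have "(f + g) (x + y) = (f + g) x + (f + g) y" "(f + g) (sM c x) = tscale c ((f + g) x)" for x y c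
    using assms(2,3) unfolding Hom_iff[OF assms(1)] by (simp_all add: tscale_def fun_eq_iff algebra_simps)
  ultimately show ?thesis unfolding Hom_iff[OF assms(1)] by blast
qed

lemma Hom_power_scale:
  fixes s :: "'k::field \<Rightarrow> 'c::ab_group_add \<Rightarrow> 'c" and sM :: "'k \<Rightarrow> 'm::ab_group_add \<Rightarrow> 'm"
  assumes "vector_space sM" "f \<in> Hom sM (tensor_power s n)"
  shows "(\<lambda>x. tscale a (f x)) \<in> Hom sM (tensor_power s n)"
  using assms(2) unfolding Hom_iff[OF assms(1)]
  by (auto simp: tens.scale_right_distrib tens.scale_left_commute intro: tensor_power_scale)

lemma Hom_power_sum:
  fixes s :: "'k::field \<Rightarrow> 'c::ab_group_add \<Rightarrow> 'c" and sM :: "'k \<Rightarrow> 'm::ab_group_add \<Rightarrow> 'm"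
  assumes "vector_space sM" "\<And>i. i \<in> I \<Longrightarrow> f i \<in> Hom sM (tensor_power s n)"
  shows "(\<Sum>i\<in>I. f i) \<in> Hom sM (tensor_power s n)"
  using assms(2) by (induction I rule: infinite_finite_induct)
    (auto intro: Hom_power_add[OF assms(1)] Hom_power_zero[OF assms(1)])

lemma slot_map_sum_map:
  fixes s :: "'k::field \<Rightarrow> 'c::ab_group_add \<Rightarrow> 'c"
  assumes s: "vector_space s" and g: "\<And>j. j \<in> J \<Longrightarrow> g j \<in> Hom s (tensor_power s n)"
    and i: "1 \<le> i" "i \<le> m" and t: "t \<in> tensor_power s m"
  shows "slot_map s m n i (\<Sum>j\<in>J. g j) t = (\<Sum>j\<in>J. slot_map s m n i (g j) t)"
  using Hom_power_zero[OF s] Hom_power_add[OF s] slot_map_add_map[OF s _ _ Hom_power_add[OF s] i t] g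
  by (intro sum_additive_on[where A = "Hom s (tensor_power s n)" and F = "\<lambda>g. slot_map s m n i g t"]) auto

lemma tensor2_add: "t \<in> tensor2 sA sB \<Longrightarrow> t' \<in> tensor2 sA sB \<Longrightarrow> t + t' \<in> tensor2 sA sB"
  unfolding tensor2_def by (rule tensors_add)

lemma Hom_tensor2_add:
  assumes sM: "vector_space sM" and f: "f \<in> Hom sM (tensor2 sA sB)" and g: "g \<in> Hom sM (tensor2 sA sB)"
  shows "f + g \<in> Hom sM (tensor2 sA sB)"
proof -
  have "(f + g) x \<in> tensor2 sA sB" for x
    using tensor2_add[OF Hom_apply[OF f, of x] Hom_apply[OF g, of x]] by (simp add: plus_fun_def)
  moreover have "(f + g) (x + y) = (f + g) x + (f + g) y" "(f + g) (sM c x) = tscale c ((f + g) x)" for x y c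
    using f g unfolding Hom_iff[OF sM] by (simp_all add: tscale_def fun_eq_iff algebra_simps)
  ultimately show ?thesis unfolding Hom_iff[OF sM] by blast
qed

section \<open>Coproducts as elements of the operads\<close>

lemma to_power2_linear:
  "to_power2 s (t + t') = to_power2 s t + to_power2 s t'"
  "to_power2 s (tscale a t) = tscale a (to_power2 s t)"
  by (simp_all add: to_power2_def tscale_def fun_eq_iff)

lemma multilinear_two_bilinear:
  fixes s :: "'k::field \<Rightarrow> 'c::ab_group_add \<Rightarrow> 'c"
  assumes "\<psi> \<in> multilinear_forms s 2"
  shows "(\<lambda>(x, y). \<psi> [x, y]) \<in> bilinear_forms s s"
  using multilinear_formsD[OF assms, of "[_, _]" 0] multilinear_formsD[OF assms, of "[_, _]" 1]
  by (simp add: bilinear_forms_def)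

lemma multilinear_three_trilinear:
  fixes s :: "'k::field \<Rightarrow> 'c::ab_group_add \<Rightarrow> 'c"
  assumes "\<psi> \<in> multilinear_forms s 3"
  shows "(\<lambda>(x, y, z). \<psi> [x, y, z]) \<in> trilinear_forms s s s"
  using multilinear_formsD[OF assms, of "[_, _, _]" 0] multilinear_formsD[OF assms, of "[_, _, _]" 1]
    multilinear_formsD[OF assms, of "[_, _, _]" 2]
  by (simp add: trilinear_forms_def)

lemma to_power2_closed:
  fixes s :: "'k::field \<Rightarrow> 'c::ab_group_add \<Rightarrow> 'c"
  assumes "t \<in> tensor2 s s"
  shows "to_power2 s t \<in> tensor_power s 2"
  using assms unfolding tensor2_def tensor_power_def
proof (rule tensors_linear_closed)
  fix w :: "'c \<times> 'c"
  obtain x y where w: "w = (x, y)" by force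
  have "to_power2 s (pure_tensor (bilinear_forms s s) w) = pure_tensor (multilinear_forms s 2) [x, y]"
    using multilinear_two_bilinear by (auto simp: w to_power2_def pure_tensor_def fun_eq_iff)
  then show "to_power2 s (pure_tensor (bilinear_forms s s) w) \<in> tensors (multilinear_forms s 2) {w. length w = 2}"
    by (simp add: tensors_pure)
qed (rule to_power2_linear)+

lemma to_power2_Hom:
  fixes s :: "'k::field \<Rightarrow> 'c::ab_group_add \<Rightarrow> 'c"
  assumes "vector_space s" "D \<in> Hom s (tensor2 s s)"
  shows "to_power2 s \<circ> D \<in> Hom s (tensor_power s 2)"
  using assms(2) unfolding Hom_iff[OF assms(1)] by (auto simp: to_power2_linear intro: to_power2_closed)

text \<open>
  On a tensor in \<open>C \<otimes> C\<close> the outer maps \<open>f \<otimes> id\<close> and \<open>id \<otimes> f\<close> of the differentials are compositions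
  in the first and in the second slot.
\<close>

lemma slot_map_to_power2_left:
  fixes s :: "'k::field \<Rightarrow> 'c::ab_group_add \<Rightarrow> 'c"
  assumes s: "vector_space s" and f: "f \<in> Hom s (tensor_power s n)"
  shows "slot_map s 2 n 1 f (to_power2 s t) = pow_map_id s n f t"
proof
  fix \<psi>
  show "slot_map s 2 n 1 f (to_power2 s t) \<psi> = pow_map_id s n f t \<psi>"
  proof (cases "\<psi> \<in> multilinear_forms s (n + 1)")
    case True
    then have "(\<lambda>w. f (w ! (1 - 1)) (\<lambda>u. \<psi> (take (1 - 1) w @ u @ drop 1 w))) \<in> multilinear_forms s 2"
      using slot_map_form[OF s f, of 1 2 \<psi>] by simp
    then show ?thesis using True by (simp add: slot_map_def to_power2_def pow_map_id_def)
  qed (simp add: slot_map_def pow_map_id_def)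
qed

lemma slot_map_to_power2_right:
  fixes s :: "'k::field \<Rightarrow> 'c::ab_group_add \<Rightarrow> 'c"
  assumes s: "vector_space s" and f: "f \<in> Hom s (tensor_power s n)"
  shows "slot_map s 2 n 2 f (to_power2 s t) = id_pow_map s n f t"
proof
  fix \<psi>
  show "slot_map s 2 n 2 f (to_power2 s t) \<psi> = id_pow_map s n f t \<psi>"
  proof (cases "\<psi> \<in> multilinear_forms s (n + 1)")
    case True
    then have "(\<lambda>w. f (w ! (2 - 1)) (\<lambda>u. \<psi> (take (2 - 1) w @ u @ drop 2 w))) \<in> multilinear_forms s 2"
      using slot_map_form[OF s f, of 2 2 \<psi>] by simp
    then show ?thesis using True by (simp add: slot_map_def to_power2_def id_pow_map_def)
  qed (simp add: slot_map_def id_pow_map_def)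
qed

text \<open>
  Relations between coproducts are stated with forms on triples; the form
  \<open>(x, y, z) \<mapsto> \<psi> [x, y, z]\<close> carries them to the third tensor power.
\<close>

lemma coproduct_slots:
  fixes s :: "'k::field \<Rightarrow> 'c::ab_group_add \<Rightarrow> 'c"
  assumes s: "vector_space s" and E: "E \<in> Hom s (tensor2 s s)" "E' \<in> Hom s (tensor2 s s)"
    and eq: "map_id s s s E \<circ> D = id_map s s s E' \<circ> D'"
  shows "coEnd_comp s 2 2 1 (to_power2 s \<circ> D) (to_power2 s \<circ> E) =
    coEnd_comp s 2 2 2 (to_power2 s \<circ> D') (to_power2 s \<circ> E')"
proof (intro ext)
  fix x \<psi>
  note E2 = to_power2_Hom[OF s E(1)] to_power2_Hom[OF s E(2)]
  have lhs: "coEnd_comp s 2 2 1 (to_power2 s \<circ> D) (to_power2 s \<circ> E) x = pow_map_id s 2 (to_power2 s \<circ> E) (D x)"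
    by (simp only: coEnd_comp_def o_apply slot_map_to_power2_left[OF s E2(1)])
  have rhs: "coEnd_comp s 2 2 2 (to_power2 s \<circ> D') (to_power2 s \<circ> E') x = id_pow_map s 2 (to_power2 s \<circ> E') (D' x)"
    by (simp only: coEnd_comp_def o_apply slot_map_to_power2_right[OF s E2(2)])
  show "coEnd_comp s 2 2 1 (to_power2 s \<circ> D) (to_power2 s \<circ> E) x \<psi> =
    coEnd_comp s 2 2 2 (to_power2 s \<circ> D') (to_power2 s \<circ> E') x \<psi>"
  proof (cases "\<psi> \<in> multilinear_forms s 3")
    case True
    have form1: "(\<lambda>w. \<psi> (w @ [c])) \<in> multilinear_forms s 2" for c
      using slot_form_inner[of \<psi> s 2 2 "[c, c]" 1] True by simp
    have form2: "(\<lambda>w. \<psi> (c # w)) \<in> multilinear_forms s 2" for c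
      using slot_form_inner[of \<psi> s 2 2 "[c, c]" 2] True by simp
    have "pow_map_id s 2 (to_power2 s \<circ> E) (D x) \<psi> = map_id s s s E (D x) (\<lambda>(x, y, z). \<psi> [x, y, z])"
      using True multilinear_three_trilinear[OF True] form1
      by (simp add: pow_map_id_def to_power2_def map_id_def)
    also have "map_id s s s E (D x) = id_map s s s E' (D' x)" using fun_cong[OF eq, of x] by simp
    also have "id_map s s s E' (D' x) (\<lambda>(x, y, z). \<psi> [x, y, z]) = id_pow_map s 2 (to_power2 s \<circ> E') (D' x) \<psi>"
      using True multilinear_three_trilinear[OF True] form2
      by (simp add: id_pow_map_def to_power2_def id_map_def)
    finally show ?thesis unfolding lhs rhs .
  next
    case False
    then show ?thesis unfolding lhs rhs by (simp add: pow_map_id_def id_pow_map_def)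
  qed
qed

section \<open>The coendomorphism operad\<close>

context
  fixes s :: "'k::field \<Rightarrow> 'c::ab_group_add \<Rightarrow> 'c"
  assumes s: "vector_space s"
begin

lemma coEnd_closed:
  "1 \<le> i \<Longrightarrow> i \<le> m \<Longrightarrow> f \<in> Hom s (tensor_power s m) \<Longrightarrow> g \<in> Hom s (tensor_power s n) \<Longrightarrow>
    coEnd_comp s m n i f g \<in> Hom s (tensor_power s (m + n - 1))"
  unfolding coEnd_comp_def by (rule slot_map_Hom[OF s])

lemma coEnd_add_left:
  "coEnd_comp s m n i (f + f') g = coEnd_comp s m n i f g + coEnd_comp s m n i f' g"
proof
  show "coEnd_comp s m n i (f + f') g x = (coEnd_comp s m n i f g + coEnd_comp s m n i f' g) x" for x
    using slot_map_linear(1)[of s m n i g "f x" "f' x"]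
    by (simp only: coEnd_comp_def o_apply plus_fun_apply)
qed

lemma coEnd_scale_left:
  "coEnd_comp s m n i (\<lambda>x. tscale a (f x)) g = (\<lambda>x. tscale a (coEnd_comp s m n i f g x))"
  by (simp add: coEnd_comp_def slot_map_linear fun_eq_iff)

lemma coEnd_add_right:
  assumes "1 \<le> i" "i \<le> m" "f \<in> Hom s (tensor_power s m)" "g \<in> Hom s (tensor_power s n)" "g' \<in> Hom s (tensor_power s n)"
  shows "coEnd_comp s m n i f (g + g') = coEnd_comp s m n i f g + coEnd_comp s m n i f g'"
proof
  show "coEnd_comp s m n i f (g + g') x = (coEnd_comp s m n i f g + coEnd_comp s m n i f g') x" for x
    using slot_map_add_map[OF s assms(4,5) Hom_power_add[OF s assms(4,5)] assms(1,2) Hom_apply[OF assms(3), of x]]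
    by (simp only: coEnd_comp_def o_apply plus_fun_apply)
qed

lemma coEnd_scale_right:
  assumes "1 \<le> i" "i \<le> m" "f \<in> Hom s (tensor_power s m)" "g \<in> Hom s (tensor_power s n)"
  shows "coEnd_comp s m n i f (\<lambda>x. tscale a (g x)) = (\<lambda>x. tscale a (coEnd_comp s m n i f g x))"
  using slot_map_scale_map[OF s assms(4) Hom_power_scale[OF s assms(4)] assms(1,2) Hom_apply[OF assms(3)]]
  by (simp add: coEnd_comp_def fun_eq_iff)

lemma coEnd_sequential:
  assumes "1 \<le> i" "i \<le> m" "1 \<le> j" "j \<le> n" "1 \<le> p"
    and "f \<in> Hom s (tensor_power s m)" "g \<in> Hom s (tensor_power s n)" "h \<in> Hom s (tensor_power s p)"
  shows "coEnd_comp s (m + n - 1) p (i - 1 + j) (coEnd_comp s m n i f g) h =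
    coEnd_comp s m (n + p - 1) i f (coEnd_comp s n p j g h)"
  unfolding coEnd_comp_def fun_eq_iff o_apply
  using slot_map_sequential[OF s assms(7,8,1-5) Hom_apply[OF assms(6)]] by (simp add: o_def)

lemma coEnd_parallel:
  assumes "1 \<le> i" "i < k" "k \<le> m" "1 \<le> n" "1 \<le> p"
    and "f \<in> Hom s (tensor_power s m)" "g \<in> Hom s (tensor_power s n)" "h \<in> Hom s (tensor_power s p)"
  shows "coEnd_comp s (m + n - 1) p (k - 1 + n) (coEnd_comp s m n i f g) h =
    coEnd_comp s (m + p - 1) n i (coEnd_comp s m p k f h) g"
  unfolding coEnd_comp_def fun_eq_iff o_apply
  using slot_map_parallel[OF s assms(7,8,1-5) Hom_apply[OF assms(6)]] by simp

lemma coEnd_sum_left: "coEnd_comp s m n i (\<Sum>j\<in>J. f j) g = (\<Sum>j\<in>J. coEnd_comp s m n i (f j) g)"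
  by (rule sum_additive_on[where A = UNIV and F = "\<lambda>f. coEnd_comp s m n i f g"]) (auto simp: coEnd_add_left)

lemma coEnd_sum_right:
  assumes "1 \<le> i" "i \<le> m" "f \<in> Hom s (tensor_power s m)" "\<And>j. j \<in> J \<Longrightarrow> g j \<in> Hom s (tensor_power s n)"
  shows "coEnd_comp s m n i f (\<Sum>j\<in>J. g j) = (\<Sum>j\<in>J. coEnd_comp s m n i f (g j))"
proof
  show "coEnd_comp s m n i f (\<Sum>j\<in>J. g j) x = (\<Sum>j\<in>J. coEnd_comp s m n i f (g j)) x" for x
    using slot_map_sum_map[OF s assms(4,1,2) Hom_apply[OF assms(3), of x], where J = J]
    by (simp add: coEnd_comp_def sum_fun_apply)
qed

lemma coEnd_operad_complex:
  assumes D: "D \<in> Hom s (tensor2 s s)" and coassoc: "map_id s s s D \<circ> D = id_map s s s D \<circ> D"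
  shows "operad_complex (\<lambda>a f x. tscale a (f x)) (\<lambda>n. Hom s (tensor_power s n)) (coEnd_comp s)
    (to_power2 s \<circ> D) (coHoch_complex s D s D D)"
proof (intro operad_complex.intro operad_with_multiplication.intro operad_complex_axioms.intro)
  fix m n p i j k :: nat and f f' g g' h and a b :: 'k
  note pi = to_power2_Hom[OF s D]
  let ?H = "\<lambda>n. Hom s (tensor_power s n)" and ?pi = "to_power2 s \<circ> D"
  show "vector_space (\<lambda>(a::'k) (f :: 'c \<Rightarrow> ('c list, 'k) tens) x. tscale a (f x))" 
    by unfold_locales (auto simp: tscale_def fun_eq_iff algebra_simps)
  show "0 \<in> ?H n" using Hom_power_zero[OF s] .
  show "f + g \<in> ?H n" if "f \<in> ?H n" "g \<in> ?H n" using Hom_power_add[OF s that] .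
  show "(\<lambda>x. tscale a (f x)) \<in> ?H n" if "f \<in> ?H n" using Hom_power_scale[OF s that] .
  show "coEnd_comp s m n i f g \<in> ?H (m + n - 1)" if "1 \<le> i" "i \<le> m" "f \<in> ?H m" "g \<in> ?H n"
    using coEnd_closed[OF that] .
  show "coEnd_comp s m n i (f + f') g = coEnd_comp s m n i f g + coEnd_comp s m n i f' g"
    by (rule coEnd_add_left)
  show "coEnd_comp s m n i f (g + g') = coEnd_comp s m n i f g + coEnd_comp s m n i f g'"
    if "1 \<le> i" "i \<le> m" "f \<in> ?H m" "g \<in> ?H n" "g' \<in> ?H n" using coEnd_add_right[OF that] .
  show "coEnd_comp s m n i (\<lambda>x. tscale a (f x)) g = (\<lambda>x. tscale a (coEnd_comp s m n i f g x))"
    by (rule coEnd_scale_left)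
  show "coEnd_comp s m n i f (\<lambda>x. tscale a (g x)) = (\<lambda>x. tscale a (coEnd_comp s m n i f g x))"
    if "1 \<le> i" "i \<le> m" "f \<in> ?H m" "g \<in> ?H n" using coEnd_scale_right[OF that] .
  show "coEnd_comp s (m + n - 1) p (i - 1 + j) (coEnd_comp s m n i f g) h =
      coEnd_comp s m (n + p - 1) i f (coEnd_comp s n p j g h)"
    if "1 \<le> i" "i \<le> m" "1 \<le> j" "j \<le> n" "1 \<le> p" "f \<in> ?H m" "g \<in> ?H n" "h \<in> ?H p"
    using coEnd_sequential[OF that] .
  show "coEnd_comp s (m + n - 1) p (k - 1 + n) (coEnd_comp s m n i f g) h =
      coEnd_comp s (m + p - 1) n i (coEnd_comp s m p k f h) g"
    if "1 \<le> i" "i < k" "k \<le> m" "1 \<le> n" "1 \<le> p" "f \<in> ?H m" "g \<in> ?H n" "h \<in> ?H p"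
    using coEnd_parallel[OF that] .
  show "?pi \<in> ?H 2" by (rule pi)
  show "coEnd_comp s 2 2 1 ?pi ?pi = coEnd_comp s 2 2 2 ?pi ?pi"
    by (rule coproduct_slots[OF s D D coassoc])
  show "cscale (coHoch_complex s D s D D) = (\<lambda>a f x. tscale a (f x))"
    and "cochains (coHoch_complex s D s D D) 0 = {0}"
    and "diff (coHoch_complex s D s D D) 0 0 = 0"
    by (simp_all add: coHoch_complex_def coHoch_cochains_def coHoch_diff_def)
  show "cochains (coHoch_complex s D s D D) n = ?H n" if "1 \<le> n"
    using that by (simp add: coHoch_complex_def coHoch_cochains_def)
  show "diff (coHoch_complex s D s D D) n f = coEnd_comp s 2 n 2 ?pi f
      + (\<Sum>i=1..n. (\<lambda>x. tscale ((-1) ^ i) (coEnd_comp s n 2 i f ?pi x)))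
      + (\<lambda>x. tscale ((-1) ^ (n + 1)) (coEnd_comp s 2 n 1 ?pi f x))"
    if n: "1 \<le> n" and f: "f \<in> ?H n"
  proof
    fix x
    show "diff (coHoch_complex s D s D D) n f x = (coEnd_comp s 2 n 2 ?pi f
      + (\<Sum>i=1..n. (\<lambda>x. tscale ((-1) ^ i) (coEnd_comp s n 2 i f ?pi x)))
      + (\<lambda>x. tscale ((-1) ^ (n + 1)) (coEnd_comp s 2 n 1 ?pi f x))) x"
      using n slot_map_to_power2_left[OF s f, of "D x"] slot_map_to_power2_right[OF s f, of "D x"]
      by (simp add: coHoch_complex_def coHoch_diff_def coEnd_comp_def sum_fun_apply)
  qed
qed

end

section \<open>The dendriform operad\<close>

text \<open>
  The value \<open>g\<^bsub>R\<^sub>1[r]\<^esub>\<close>: one component of \<open>g\<close> inside the block, the sum of all components outside.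
\<close>

definition label :: "nat \<Rightarrow> nat \<Rightarrow> (nat \<Rightarrow> 'm \<Rightarrow> ('c list, 'k::field) tens) \<Rightarrow> nat \<Rightarrow> 'm \<Rightarrow> ('c list, 'k) tens"
  where "label i n g r = (if i \<le> r \<and> r \<le> i + n - 1 then g (r - i + 1) else S_map n g)"

lemma at_vector_R1:
  fixes g :: "nat \<Rightarrow> 'm \<Rightarrow> ('c list, 'k::field) tens"
  assumes "1 \<le> n" "1 \<le> i"
  shows "at_vector n g (R1 m i n r) = label i n g r"
proof (cases "i \<le> r \<and> r \<le> i + n - 1")
  case True
  then have q: "r - i + 1 \<in> {1..n}" using assms by auto
  have "at_vector n g (R1 m i n r) x = (\<Sum>j=1..n. if j = r - i + 1 then g j x else 0)" for x
    unfolding at_vector_def R1_def if_P[OF True] basis_vector_def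
    by (intro sum.cong refl) (simp add: tscale_def zero_fun_def)
  then have "at_vector n g (R1 m i n r) x = g (r - i + 1) x" for x
    using q by (simp add: sum.delta)
  then show ?thesis unfolding label_def if_P[OF True] by (intro ext) simp
next
  case False
  have coeff: "(\<Sum>j'=1..n. basis_vector j') j = (1 :: 'k)" if "j \<in> {1..n}" for j
    using that by (simp add: sum_fun_apply basis_vector_def)
  have "at_vector n g (R1 m i n r) x = (\<Sum>j=1..n. g j x)" for x
    unfolding at_vector_def R1_def if_not_P[OF False]
    by (intro sum.cong refl) (simp only: coeff tens.scale_one)
  then show ?thesis unfolding label_def if_not_P[OF False] S_map_def by (intro ext) (simp add: sum_fun_apply)
qed

lemma R0_cases:
  assumes "1 \<le> i" "1 \<le> n"
  shows "r < i \<Longrightarrow> R0 m i n r = r" and "i \<le> r \<Longrightarrow> r < i + n \<Longrightarrow> R0 m i n r = i"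
    and "i + n \<le> r \<Longrightarrow> R0 m i n r = r + 1 - n"
  using assms by (auto simp: R0_def)

lemma label_cases:
  assumes "1 \<le> n"
  shows "r < i \<Longrightarrow> label i n g r = S_map n g" and "i \<le> r \<Longrightarrow> r < i + n \<Longrightarrow> label i n g r = g (r + 1 - i)"
    and "i + n \<le> r \<Longrightarrow> label i n g r = S_map n g"
  using assms by (auto simp: label_def Suc_diff_le)

text \<open>
  How \<open>R\<^sub>0\<close> and \<open>R\<^sub>1\<close> behave under nested compositions, a check in each of five regions for
  \<open>r\<close>: before the block of \<open>g\<close>, inside it before, in and after the block of \<open>h\<close>, and after
  the block of \<open>g\<close>.
\<close>

lemma sequential_labels:
  fixes r m i n j p :: nat
  assumes ij: "1 \<le> i" "1 \<le> j" "j \<le> n" "1 \<le> p"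
  defines "r' \<equiv> R0 (m + n - 1) (i - 1 + j) p r"
  shows "R0 m i n r' = R0 m i (n + p - 1) r"
    and "i \<le> r \<Longrightarrow> r < i + (n + p - 1) \<Longrightarrow> label i n g r' = g (R0 n j p (r + 1 - i))"
    and "i \<le> r \<Longrightarrow> r < i + (n + p - 1) \<Longrightarrow> label (i - 1 + j) p h r = label j p h (r + 1 - i)"
    and "\<not> (i \<le> r \<and> r < i + (n + p - 1)) \<Longrightarrow> label i n g r' = S_map n g"
    and "\<not> (i \<le> r \<and> r < i + (n + p - 1)) \<Longrightarrow> label (i - 1 + j) p h r = S_map p h"
proof -
  obtain i' j' n' p' where [simp]: "i = Suc i'" "j = Suc j'" "n = Suc n'" "p = Suc p'"
    using ij by (metis Suc_le_D One_nat_def le_trans)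
  have "j' \<le> n'" using ij by simp
  then consider "r < i" | e where "r = i + e" "e < j'" | e where "r = i + j' + e" "e < p"
    | e where "r = i + j' + p + e" "j' + e < n'" | e where "r = i + n' + p + e"
  proof -
    have "r < i \<or> (\<exists>e. r = i + e \<and> e < j') \<or> (\<exists>e. r = i + j' + e \<and> e < p)
      \<or> (\<exists>e. r = i + j' + p + e \<and> j' + e < n') \<or> (\<exists>e. r = i + n' + p + e)"
      using \<open>j' \<le> n'\<close> by presburger
    then show thesis using that by blast
  qed
  note regions = this
  note simps = R0_cases label_cases r'_def
  show "R0 m i n r' = R0 m i (n + p - 1) r"
    using \<open>j' \<le> n'\<close> by (cases rule: regions) (simp_all add: simps)
  show "label i n g r' = g (R0 n j p (r + 1 - i))" if "i \<le> r" "r < i + (n + p - 1)"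
    using \<open>j' \<le> n'\<close> that by (cases rule: regions) (simp_all add: simps)
  show "label (i - 1 + j) p h r = label j p h (r + 1 - i)" if "i \<le> r" "r < i + (n + p - 1)"
    using \<open>j' \<le> n'\<close> that by (cases rule: regions) (simp_all add: simps)
  show "label i n g r' = S_map n g" if "\<not> (i \<le> r \<and> r < i + (n + p - 1))"
    using \<open>j' \<le> n'\<close> that by (cases rule: regions) (simp_all add: simps)
  show "label (i - 1 + j) p h r = S_map p h" if "\<not> (i \<le> r \<and> r < i + (n + p - 1))"
    using \<open>j' \<le> n'\<close> that by (cases rule: regions) (simp_all add: simps)
qed

text \<open>
  Here the five regions are cut out by the two disjoint blocks.
\<close>

lemma parallel_labels:
  fixes r m i n k p :: nat
  assumes ik: "1 \<le> i" "i < k" "1 \<le> n" "1 \<le> p"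
  defines "r' \<equiv> R0 (m + n - 1) (k - 1 + n) p r" and "r'' \<equiv> R0 (m + p - 1) i n r"
  shows "R0 m i n r' = R0 m k p r''"
    and "label i n g r' = label i n g r"
    and "label (k - 1 + n) p h r = label k p h r''"
proof -
  obtain i' e n' p' where [simp]: "i = Suc i'" "k = Suc (Suc (i' + e))" "n = Suc n'" "p = Suc p'"
  proof -
    obtain i' n' p' where "i = Suc i'" "n = Suc n'" "p = Suc p'" using ik by (metis Suc_le_D One_nat_def)
    moreover obtain e where "k = i + e + 1" using ik(2) by (metis less_imp_add_positive Suc_eq_plus1 add_Suc_right gr0_implies_Suc)
    ultimately show thesis using that by simp
  qed
  consider "r < i" | c where "r = i + c" "c < n" | c where "r = i + n + c" "c < e"
    | c where "r = i + n + e + c" "c < p" | c where "r = i + n + e + p + c"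
  proof -
    have "r < i \<or> (\<exists>c. r = i + c \<and> c < n) \<or> (\<exists>c. r = i + n + c \<and> c < e)
      \<or> (\<exists>c. r = i + n + e + c \<and> c < p) \<or> (\<exists>c. r = i + n + e + p + c)"
      by presburger
    then show thesis using that by blast
  qed
  note regions = this
  note simps = R0_cases label_cases r'_def r''_def
  show "R0 m i n r' = R0 m k p r''" by (cases rule: regions) (simp_all add: simps)
  show "label i n g r' = label i n g r" by (cases rule: regions) (simp_all add: simps)
  show "label (k - 1 + n) p h r = label k p h r''" by (cases rule: regions) (simp_all add: simps)
qed

lemma R0_range:
  assumes "1 \<le> i" "i \<le> m" "1 \<le> n" "r \<in> {1..m + n - 1}"
  shows "R0 m i n r \<in> {1..m}"
  using assms by (auto simp: R0_def)

text \<open>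
  Outside the block every \<open>q \<noteq> i\<close> occurs once, with the total \<open>g\<close>; inside it \<open>i\<close> occurs with each
  component \<open>G j\<close>, and by hypothesis these sum up to the missing term \<open>B i g\<close>.
\<close>

lemma sum_labels:
  fixes B :: "nat \<Rightarrow> 'b \<Rightarrow> 'c::comm_monoid_add"
  assumes i: "1 \<le> i" "i \<le> m" and n: "1 \<le> n"
    and block: "(\<Sum>j=1..n. B i (G j)) = B i g"
  shows "(\<Sum>r=1..m+n-1. B (R0 m i n r) (if i \<le> r \<and> r \<le> i + n - 1 then G (r - i + 1) else g)) =
    (\<Sum>q=1..m. B q g)"
proof -
  let ?b = "\<lambda>r. B (R0 m i n r) (if i \<le> r \<and> r \<le> i + n - 1 then G (r - i + 1) else g)"
  have "{1..m+n-1} = {1..<i} \<union> ({i..i+n-1} \<union> {i+n..m+n-1})" using i n by auto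
  then have "sum ?b {1..m+n-1} = sum ?b {1..<i} + (sum ?b {i..i+n-1} + sum ?b {i+n..m+n-1})"
    using n by (simp only:) (subst sum.union_disjoint; auto)+
  also have "sum ?b {1..<i} = (\<Sum>q\<in>{1..<i}. B q g)"
    by (intro sum.cong refl) (auto simp: R0_def)
  also have "sum ?b {i..i+n-1} = (\<Sum>j=1..n. B i (G j))"
    by (rule sum.reindex_bij_witness[where i = "\<lambda>j. j + i - 1" and j = "\<lambda>r. r - i + 1"])
      (use i n in \<open>auto simp: R0_def\<close>)
  also have "sum ?b {i+n..m+n-1} = (\<Sum>q\<in>{i<..m}. B q g)"
    by (rule sum.reindex_bij_witness[where i = "\<lambda>q. q + n - 1" and j = "\<lambda>r. r - n + 1"])
      (use i n in \<open>auto simp: R0_def\<close>)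
  also have "(\<Sum>q\<in>{1..<i}. B q g) + ((\<Sum>j=1..n. B i (G j)) + (\<Sum>q\<in>{i<..m}. B q g)) = (\<Sum>q=1..m. B q g)"
  proof -
    have "{1..m} = {1..<i} \<union> insert i {i<..m}" using i by auto
    then have "(\<Sum>q=1..m. B q g) = (\<Sum>q\<in>{1..<i}. B q g) + (\<Sum>q\<in>insert i {i<..m}. B q g)"
      by (simp only:) (subst sum.union_disjoint; auto)
    then show ?thesis using block by simp
  qed
  finally show ?thesis .
qed

lemma S_map_add: "S_map n (f + g) = S_map n f + S_map n g"
  by (simp add: S_map_def sum.distrib)

lemma S_map_scale: "S_map n (\<lambda>r x. tscale a (f r x)) = (\<lambda>x. tscale a (S_map n f x))"
  by (simp add: S_map_def fun_eq_iff sum_fun_apply tens.scale_sum_right)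

lemma label_add: "label i n (f + g) r = label i n f r + label i n g r"
  by (simp add: label_def S_map_add)

lemma label_scale: "label i n (\<lambda>r x. tscale a (f r x)) r = (\<lambda>x. tscale a (label i n f r x))"
  by (simp add: label_def S_map_scale)

lemma coDend_cochain_Hom:
  fixes s :: "'k::field \<Rightarrow> 'c::ab_group_add \<Rightarrow> 'c" and sM :: "'k \<Rightarrow> 'm::ab_group_add \<Rightarrow> 'm"
  assumes "vector_space sM" "f \<in> coDend_cochains s sM n"
  shows "f r \<in> Hom sM (tensor_power s n)"
proof (cases "r \<in> {1..n}")
  case True
  then show ?thesis using assms(2) by (auto simp: coDend_cochains_def split: if_splits)
next
  case False
  then have "f r = 0" using assms(2) by (auto simp: coDend_cochains_def split: if_splits)
  then show ?thesis using Hom_power_zero[OF assms(1), of s n] by simp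
qed

lemma coDend_cochain_outside: "f \<in> coDend_cochains s sM n \<Longrightarrow> r \<notin> {1..n} \<Longrightarrow> f r = 0"
  by (auto simp: coDend_cochains_def split: if_splits)

lemma coDend_cochainI:
  "1 \<le> n \<Longrightarrow> (\<And>r. r \<in> {1..n} \<Longrightarrow> f r \<in> Hom sM (tensor_power s n)) \<Longrightarrow> (\<And>r. r \<notin> {1..n} \<Longrightarrow> f r = 0) \<Longrightarrow>
    f \<in> coDend_cochains s sM n"
  by (simp add: coDend_cochains_def)

lemma S_map_Hom:
  fixes s :: "'k::field \<Rightarrow> 'c::ab_group_add \<Rightarrow> 'c" and sM :: "'k \<Rightarrow> 'm::ab_group_add \<Rightarrow> 'm"
  assumes "vector_space sM" "f \<in> coDend_cochains s sM n"
  shows "S_map n f \<in> Hom sM (tensor_power s n)"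
  unfolding S_map_def by (intro Hom_power_sum assms(1) coDend_cochain_Hom[OF assms])

lemma label_Hom:
  fixes s :: "'k::field \<Rightarrow> 'c::ab_group_add \<Rightarrow> 'c" and sM :: "'k \<Rightarrow> 'm::ab_group_add \<Rightarrow> 'm"
  assumes "vector_space sM" "f \<in> coDend_cochains s sM n"
  shows "label i n f r \<in> Hom sM (tensor_power s n)"
  unfolding label_def using S_map_Hom[OF assms] coDend_cochain_Hom[OF assms] by simp

lemma S_map_two_family: "S_map 2 (two_family a b) = a + b"
proof -
  have "{1..2::nat} = {1, 2}" by auto
  then show ?thesis by (simp add: S_map_def two_family_def)
qed

context
  fixes s :: "'k::field \<Rightarrow> 'c::ab_group_add \<Rightarrow> 'c"
  assumes s: "vector_space s"
begin

lemma coDend_comp_label: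
  "1 \<le> n \<Longrightarrow> 1 \<le> i \<Longrightarrow> r \<in> {1..m+n-1} \<Longrightarrow>
    coDend_comp s m n i f g r = coEnd_comp s m n i (f (R0 m i n r)) (label i n g r)"
  by (simp add: coDend_comp_def coEnd_comp_def at_vector_R1)

lemma coDend_comp_outside: "r \<notin> {1..m+n-1} \<Longrightarrow> coDend_comp s m n i f g r = 0"
  by (simp add: coDend_comp_def)

lemma coDend_comp_cases:
  "1 \<le> n \<Longrightarrow> 1 \<le> i \<Longrightarrow> coDend_comp s m n i f g r =
    (if r \<in> {1..m+n-1} then coEnd_comp s m n i (f (R0 m i n r)) (label i n g r) else 0)"
  using coDend_comp_label coDend_comp_outside by simp

text \<open>
  \<open>sum_labels\<close> for the biadditive map \<open>B q = coEnd_comp s m n i (f q)\<close>.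
\<close>

lemma S_map_coDend_comp:
  assumes i: "1 \<le> i" "i \<le> m" and n: "1 \<le> n"
    and f: "f \<in> coDend_cochains s s m" and g: "g \<in> coDend_cochains s s n"
  shows "S_map (m + n - 1) (coDend_comp s m n i f g) = coEnd_comp s m n i (S_map m f) (S_map n g)"
proof -
  have "S_map (m + n - 1) (coDend_comp s m n i f g) =
      (\<Sum>r=1..m+n-1. coEnd_comp s m n i (f (R0 m i n r)) (label i n g r))"
    unfolding S_map_def using n i by (intro sum.cong refl coDend_comp_label) auto
  also have "\<dots> = (\<Sum>q=1..m. coEnd_comp s m n i (f q) (S_map n g))"
    unfolding label_def
  proof (rule sum_labels[OF i n, where B = "\<lambda>q. coEnd_comp s m n i (f q)"])
    show "(\<Sum>j=1..n. coEnd_comp s m n i (f i) (g j)) = coEnd_comp s m n i (f i) (S_map n g)"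
      unfolding S_map_def
      by (rule coEnd_sum_right[OF s i, symmetric]) (rule coDend_cochain_Hom[OF s f] coDend_cochain_Hom[OF s g])+
  qed
  also have "\<dots> = coEnd_comp s m n i (S_map m f) (S_map n g)"
    unfolding S_map_def[of m] by (rule coEnd_sum_left[OF s, symmetric])
  finally show ?thesis .
qed

lemma coDend_comp_closed:
  assumes i: "1 \<le> i" "i \<le> m" and n: "1 \<le> n"
    and f: "f \<in> coDend_cochains s s m" and g: "g \<in> coDend_cochains s s n"
  shows "coDend_comp s m n i f g \<in> coDend_cochains s s (m + n - 1)"
proof (rule coDend_cochainI)
  show "coDend_comp s m n i f g r \<in> Hom s (tensor_power s (m + n - 1))" if "r \<in> {1..m+n-1}" for r
    unfolding coDend_comp_label[OF n i(1) that]
    by (rule coEnd_closed[OF s i coDend_cochain_Hom[OF s f] label_Hom[OF s g]])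
qed (use i n in \<open>auto simp: coDend_comp_outside\<close>)

text \<open>
  Label by label this is the sequential axiom of the coendomorphism operad.  When \<open>r\<close> lies outside
  the block of slot \<open>i\<close>, the inner composite enters through its total \<open>S(g \<bullet>\<^sub>j h)\<close>, which splits as
  \<open>S g \<bullet>\<^sub>j S h\<close> by \<open>S_map_coDend_comp\<close>.
\<close>

lemma coDend_sequential:
  assumes ij: "1 \<le> i" "i \<le> m" "1 \<le> j" "j \<le> n" "1 \<le> p"
    and f: "f \<in> coDend_cochains s s m" and g: "g \<in> coDend_cochains s s n" and h: "h \<in> coDend_cochains s s p"
  shows "coDend_comp s (m + n - 1) p (i - 1 + j) (coDend_comp s m n i f g) h =
    coDend_comp s m (n + p - 1) i f (coDend_comp s n p j g h)"
proof
  fix r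
  have n: "1 \<le> n" and ij1: "1 \<le> i - 1 + j" and np1: "1 \<le> n + p - 1" using ij by auto
  have deg: "m + n - 1 + p - 1 = m + (n + p - 1) - 1" using ij by simp
  show "coDend_comp s (m + n - 1) p (i - 1 + j) (coDend_comp s m n i f g) h r =
    coDend_comp s m (n + p - 1) i f (coDend_comp s n p j g h) r"
  proof (cases "r \<in> {1..m + n - 1 + p - 1}")
    case True
    define r' where "r' = R0 (m + n - 1) (i - 1 + j) p r"
    have r': "r' \<in> {1..m + n - 1}" unfolding r'_def using True ij by (intro R0_range) auto
    have lhs: "coDend_comp s (m + n - 1) p (i - 1 + j) (coDend_comp s m n i f g) h r =
      coEnd_comp s (m + n - 1) p (i - 1 + j)
        (coEnd_comp s m n i (f (R0 m i n r')) (label i n g r')) (label (i - 1 + j) p h r)"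
      using coDend_comp_label[OF ij(5) ij1 True] coDend_comp_label[OF n ij(1) r'] by (simp add: r'_def)
    have rhs: "coDend_comp s m (n + p - 1) i f (coDend_comp s n p j g h) r =
      coEnd_comp s m (n + p - 1) i (f (R0 m i (n + p - 1) r)) (label i (n + p - 1) (coDend_comp s n p j g h) r)"
      using coDend_comp_label[OF np1 ij(1)] True deg by simp
    have index: "R0 m i n r' = R0 m i (n + p - 1) r"
      unfolding r'_def by (rule sequential_labels(1)[OF ij(1,3-5)])
    note labels = sequential_labels(2)[OF ij(1,3-5), where m = m and r = r, folded r'_def]
      sequential_labels(3)[OF ij(1,3-5), where r = r]
      sequential_labels(4)[OF ij(1,3-5), where m = m and r = r, folded r'_def]
      sequential_labels(5)[OF ij(1,3-5), where r = r]
    have inner: "label i (n + p - 1) (coDend_comp s n p j g h) r =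
      coEnd_comp s n p j (label i n g r') (label (i - 1 + j) p h r)"
    proof (cases "i \<le> r \<and> r < i + (n + p - 1)")
      case inside: True
      then have q: "r + 1 - i \<in> {1..n + p - 1}" by auto
      have "label i (n + p - 1) (coDend_comp s n p j g h) r =
          coEnd_comp s n p j (g (R0 n j p (r + 1 - i))) (label j p h (r + 1 - i))"
        unfolding label_cases(2)[OF np1 conjunct1[OF inside] conjunct2[OF inside]]
        by (rule coDend_comp_label[OF ij(5,3) q])
      then show ?thesis unfolding labels(1,2)[OF conjunct1[OF inside] conjunct2[OF inside]] .
    next
      case outside: False
      then have "label i (n + p - 1) (coDend_comp s n p j g h) r = coEnd_comp s n p j (S_map n g) (S_map p h)"
        using S_map_coDend_comp[OF ij(3,4,5) g h] label_cases(1,3)[OF np1] by (metis not_le)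
      then show ?thesis unfolding labels(3,4)[OF outside] .
    qed
    show ?thesis unfolding lhs rhs index inner
      by (rule coEnd_sequential[OF s ij coDend_cochain_Hom[OF s f] label_Hom[OF s g] label_Hom[OF s h]])
  next
    case False
    then show ?thesis using deg by (simp add: coDend_comp_outside)
  qed
qed

lemma coDend_parallel:
  assumes ik: "1 \<le> i" "i < k" "k \<le> m" "1 \<le> n" "1 \<le> p"
    and f: "f \<in> coDend_cochains s s m" and g: "g \<in> coDend_cochains s s n" and h: "h \<in> coDend_cochains s s p"
  shows "coDend_comp s (m + n - 1) p (k - 1 + n) (coDend_comp s m n i f g) h =
    coDend_comp s (m + p - 1) n i (coDend_comp s m p k f h) g"
proof
  fix r
  have kn: "1 \<le> k - 1 + n" and k: "1 \<le> k" using ik by auto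
  have deg: "m + n - 1 + p - 1 = m + p - 1 + n - 1" using ik by simp
  show "coDend_comp s (m + n - 1) p (k - 1 + n) (coDend_comp s m n i f g) h r =
    coDend_comp s (m + p - 1) n i (coDend_comp s m p k f h) g r"
  proof (cases "r \<in> {1..m + n - 1 + p - 1}")
    case True
    then have True': "r \<in> {1..m + p - 1 + n - 1}" using deg by simp
    define r' where "r' = R0 (m + n - 1) (k - 1 + n) p r"
    define r'' where "r'' = R0 (m + p - 1) i n r"
    have r': "r' \<in> {1..m + n - 1}" unfolding r'_def using True ik by (intro R0_range) auto
    have r'': "r'' \<in> {1..m + p - 1}" unfolding r''_def using True' ik by (intro R0_range) auto
    have lhs: "coDend_comp s (m + n - 1) p (k - 1 + n) (coDend_comp s m n i f g) h r =
      coEnd_comp s (m + n - 1) p (k - 1 + n)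
        (coEnd_comp s m n i (f (R0 m i n r')) (label i n g r')) (label (k - 1 + n) p h r)"
      using coDend_comp_label[OF ik(5) kn True] coDend_comp_label[OF ik(4,1) r'] by (simp add: r'_def)
    have rhs: "coDend_comp s (m + p - 1) n i (coDend_comp s m p k f h) g r =
      coEnd_comp s (m + p - 1) n i
        (coEnd_comp s m p k (f (R0 m k p r'')) (label k p h r'')) (label i n g r)"
      using coDend_comp_label[OF ik(4,1) True'] coDend_comp_label[OF ik(5) k r''] by (simp add: r''_def)
    note index = parallel_labels(1)[OF ik(1,2,4,5), of m r, folded r'_def r''_def]
      and g_label = parallel_labels(2)[OF ik(1,2,4,5), of g m r, folded r'_def]
      and h_label = parallel_labels(3)[OF ik(1,2,4,5), of h r m, folded r''_def]
    show ?thesis unfolding lhs rhs index g_label h_label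
      by (rule coEnd_parallel[OF s ik coDend_cochain_Hom[OF s f] label_Hom[OF s g] label_Hom[OF s h]])
  next
    case False
    then show ?thesis using deg by (simp add: coDend_comp_outside)
  qed
qed

end

lemma dendriform_self_bicomodule:
  "dendriform_coalgebra s Dp Ds \<Longrightarrow> dendriform_bicomodule s Dp Ds s Dp Ds Dp Ds"
  by (simp add: dendriform_coalgebra_def dendriform_bicomodule_def)

lemma two_family_simps: "two_family a b (Suc 0) = a" "two_family a b 1 = a" "two_family a b 2 = b"
  by (simp_all add: two_family_def)

lemma two_family_coDend:
  assumes "a \<in> Hom sM (tensor_power s 2)" "b \<in> Hom sM (tensor_power s 2)"
  shows "two_family a b \<in> coDend_cochains s sM 2"
  using assms by (intro coDend_cochainI) (auto simp: two_family_def)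

context
  fixes s :: "'k::field \<Rightarrow> 'c::ab_group_add \<Rightarrow> 'c" and Dp Ds :: "'c \<Rightarrow> ('c \<times> 'c, 'k) tens"
  assumes dend: "dendriform_coalgebra s Dp Ds"
begin

lemma base_vs: "vector_space s" and prec_Hom: "Dp \<in> Hom s (tensor2 s s)" and succ_Hom: "Ds \<in> Hom s (tensor2 s s)"
  using dend by (simp_all add: dendriform_coalgebra_def)

abbreviation dend_mult where "dend_mult \<equiv> two_family (to_power2 s \<circ> Dp) (to_power2 s \<circ> Ds)"

lemma dend_mult_cochain: "dend_mult \<in> coDend_cochains s s 2"
  by (intro two_family_coDend to_power2_Hom base_vs prec_Hom succ_Hom)

lemma S_map_dend_mult: "S_map 2 dend_mult = to_power2 s \<circ> (Dp + Ds)"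
  by (simp add: S_map_two_family fun_eq_iff to_power2_def)

text \<open>
  The three labels of arity \<open>3\<close> give the three dendriform identities.
\<close>

lemma dend_mult_assoc: "coDend_comp s 2 2 1 dend_mult dend_mult = coDend_comp s 2 2 2 dend_mult dend_mult"
proof
  fix r :: nat
  let ?p = "to_power2 s \<circ> Dp" and ?q = "to_power2 s \<circ> Ds"
  have sum: "to_power2 s \<circ> (Dp + Ds) = S_map 2 dend_mult" by (simp add: S_map_dend_mult)
  have eq: "map_id s s s Dp \<circ> Dp = id_map s s s (Dp + Ds) \<circ> Dp"
    "map_id s s s Ds \<circ> Dp = id_map s s s Dp \<circ> Ds"
    "map_id s s s (Dp + Ds) \<circ> Ds = id_map s s s Ds \<circ> Ds"
    using dend by (simp_all add: dendriform_coalgebra_def)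
  note assoc = coproduct_slots[OF base_vs prec_Hom Hom_tensor2_add[OF base_vs prec_Hom succ_Hom] eq(1)] coproduct_slots[OF base_vs succ_Hom prec_Hom eq(2)]
    coproduct_slots[OF base_vs Hom_tensor2_add[OF base_vs prec_Hom succ_Hom] succ_Hom eq(3)]
  have expand: "coDend_comp s 2 2 i dend_mult dend_mult r =
      coEnd_comp s 2 2 i (dend_mult (R0 2 i 2 r)) (label i 2 dend_mult r)" if "1 \<le> i" "r \<in> {1..2 + 2 - 1}" for i
    using that by (intro coDend_comp_label[OF base_vs]) auto
  consider "r = 1" | "r = 2" | "r = 3" | "r \<notin> {1..2 + 2 - 1}" by fastforce
  then show "coDend_comp s 2 2 1 dend_mult dend_mult r = coDend_comp s 2 2 2 dend_mult dend_mult r"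
  proof cases
    case 1
    then have r: "r \<in> {1..2 + 2 - 1}" by simp
    have "R0 2 1 2 r = 1" "R0 2 2 2 r = 1" "label 1 2 dend_mult r = ?p" "label 2 2 dend_mult r = S_map 2 dend_mult"
      using 1 by (simp_all add: R0_def label_def two_family_def)
    then show ?thesis
      using assoc(1) unfolding sum by (simp only: expand[OF _ r] order.refl one_le_numeral two_family_simps)
  next
    case 2
    then have r: "r \<in> {1..2 + 2 - 1}" by simp
    have "R0 2 1 2 r = 1" "R0 2 2 2 r = 2" "label 1 2 dend_mult r = ?q" "label 2 2 dend_mult r = ?p"
      using 2 by (simp_all add: R0_def label_def two_family_def)
    then show ?thesis
      using assoc(2) unfolding sum by (simp only: expand[OF _ r] order.refl one_le_numeral two_family_simps)
  next
    case 3
    then have r: "r \<in> {1..2 + 2 - 1}" by simp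
    have "R0 2 1 2 r = 2" "R0 2 2 2 r = 2" "label 1 2 dend_mult r = S_map 2 dend_mult" "label 2 2 dend_mult r = ?q"
      using 3 by (simp_all add: R0_def label_def two_family_def)
    then show ?thesis
      using assoc(3) unfolding sum by (simp only: expand[OF _ r] order.refl one_le_numeral two_family_simps)
  next
    case 4
    show ?thesis unfolding coDend_comp_outside[OF base_vs 4] ..
  qed
qed

lemma coDend_cochains_0: "0 \<in> coDend_cochains s s n"
  using Hom_power_zero[OF base_vs, of s n] by (simp add: coDend_cochains_def)

lemma coDend_operad_complex:
  "operad_complex (\<lambda>a f r x. tscale a (f r x)) (coDend_cochains s s) (coDend_comp s) dend_mult
    (coDend_complex s Dp Ds s Dp Ds Dp Ds)"
proof (intro operad_complex.intro operad_with_multiplication.intro operad_complex_axioms.intro)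
  fix m n p i j k :: nat and f f' g g' h and a b :: 'k
  let ?P = "coDend_cochains s s" and ?K = "coDend_complex s Dp Ds s Dp Ds Dp Ds"
  note H = coDend_cochain_Hom[OF base_vs] and L = label_Hom[OF base_vs]
  show "vector_space (\<lambda>(a::'k) (f :: nat \<Rightarrow> 'c \<Rightarrow> ('c list, 'k) tens) r x. tscale a (f r x))"
    by unfold_locales (auto simp: tscale_def fun_eq_iff algebra_simps)
  show "0 \<in> ?P n" by (rule coDend_cochains_0)
  show "f + g \<in> ?P n" if "1 \<le> n" "f \<in> ?P n" "g \<in> ?P n"
  proof (rule coDend_cochainI[OF that(1)])
    show "(f + g) r \<in> Hom s (tensor_power s n)" for r
      using Hom_power_add[OF base_vs H[OF that(2)] H[OF that(3)]] by (simp only: plus_fun_apply)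
    show "(f + g) r = 0" if "r \<notin> {1..n}" for r
      using coDend_cochain_outside[OF \<open>f \<in> ?P n\<close> that] coDend_cochain_outside[OF \<open>g \<in> ?P n\<close> that]
      by (simp only: plus_fun_apply) simp
  qed
  show "(\<lambda>r x. tscale a (f r x)) \<in> ?P n" if "1 \<le> n" "f \<in> ?P n"
  proof (rule coDend_cochainI[OF that(1)])
    show "(\<lambda>x. tscale a (f r x)) \<in> Hom s (tensor_power s n)" for r
      by (rule Hom_power_scale[OF base_vs H[OF that(2)]])
    show "(\<lambda>x. tscale a (f r x)) = 0" if "r \<notin> {1..n}" for r
      using coDend_cochain_outside[OF \<open>f \<in> ?P n\<close> that] by (simp add: fun_eq_iff tscale_def)
  qed
  show "coDend_comp s m n i f g \<in> ?P (m + n - 1)" if "1 \<le> i" "i \<le> m" "1 \<le> n" "f \<in> ?P m" "g \<in> ?P n"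
    by (rule coDend_comp_closed[OF base_vs that])
  note cases = coDend_comp_cases[OF base_vs]
  show "coDend_comp s m n i (f + f') g = coDend_comp s m n i f g + coDend_comp s m n i f' g"
    if i: "1 \<le> i" and n: "1 \<le> n"
  proof
    show "coDend_comp s m n i (f + f') g r = (coDend_comp s m n i f g + coDend_comp s m n i f' g) r" for r
      unfolding plus_fun_apply[of "coDend_comp s m n i f g"] cases[OF n i] plus_fun_apply[of f f'] coEnd_add_left[OF base_vs]
      by (simp add: fun_eq_iff)
  qed
  show "coDend_comp s m n i f (g + g') = coDend_comp s m n i f g + coDend_comp s m n i f g'"
    if i: "1 \<le> i" "i \<le> m" and n: "1 \<le> n" and fg: "f \<in> ?P m" "g \<in> ?P n" "g' \<in> ?P n"
  proof
    show "coDend_comp s m n i f (g + g') r = (coDend_comp s m n i f g + coDend_comp s m n i f g') r" for r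
      unfolding plus_fun_apply[of "coDend_comp s m n i f g"] cases[OF n i(1)] label_add
        coEnd_add_right[OF base_vs i H[OF fg(1)] L[OF fg(2)] L[OF fg(3)]] by (simp add: fun_eq_iff)
  qed
  show "coDend_comp s m n i (\<lambda>r x. tscale a (f r x)) g = (\<lambda>r x. tscale a (coDend_comp s m n i f g r x))"
    if i: "1 \<le> i" and n: "1 \<le> n"
    unfolding cases[OF n i, abs_def] coEnd_scale_left[OF base_vs] by (auto simp: fun_eq_iff tscale_def)
  show "coDend_comp s m n i f (\<lambda>r x. tscale a (g r x)) = (\<lambda>r x. tscale a (coDend_comp s m n i f g r x))"
    if i: "1 \<le> i" "i \<le> m" and n: "1 \<le> n" and fg: "f \<in> ?P m" "g \<in> ?P n"
    unfolding cases[OF n i(1), abs_def] label_scale coEnd_scale_right[OF base_vs i H[OF fg(1)] L[OF fg(2)]]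
    by (auto simp: fun_eq_iff tscale_def)
  show "coDend_comp s (m + n - 1) p (i - 1 + j) (coDend_comp s m n i f g) h =
      coDend_comp s m (n + p - 1) i f (coDend_comp s n p j g h)"
    if "1 \<le> i" "i \<le> m" "1 \<le> j" "j \<le> n" "1 \<le> p" "f \<in> ?P m" "g \<in> ?P n" "h \<in> ?P p"
    by (rule coDend_sequential[OF base_vs that])
  show "coDend_comp s (m + n - 1) p (k - 1 + n) (coDend_comp s m n i f g) h =
      coDend_comp s (m + p - 1) n i (coDend_comp s m p k f h) g"
    if "1 \<le> i" "i < k" "k \<le> m" "1 \<le> n" "1 \<le> p" "f \<in> ?P m" "g \<in> ?P n" "h \<in> ?P p"
    by (rule coDend_parallel[OF base_vs that])
  show "dend_mult \<in> ?P 2" by (rule dend_mult_cochain)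
  show "coDend_comp s 2 2 1 dend_mult dend_mult = coDend_comp s 2 2 2 dend_mult dend_mult"
    by (rule dend_mult_assoc)
  show "cscale ?K = (\<lambda>a f r x. tscale a (f r x))" and "cochains ?K 0 = {0}" and "diff ?K 0 0 = 0"
    by (simp_all add: coDend_complex_def coDend_cochains_def coDend_diff_def)
  show "cochains ?K n = ?P n" if "1 \<le> n"
    by (simp add: coDend_complex_def)
  show "diff ?K n f = coDend_comp s 2 n 2 dend_mult f
      + (\<Sum>i=1..n. (\<lambda>r x. tscale ((-1) ^ i) (coDend_comp s n 2 i f dend_mult r x)))
      + (\<lambda>r x. tscale ((-1) ^ (n + 1)) (coDend_comp s 2 n 1 dend_mult f r x))"
    if n: "1 \<le> n" and f: "f \<in> ?P n"
  proof (rule ext, rule ext)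
    fix r x
    let ?rhs = "coDend_comp s 2 n 2 dend_mult f r x
      + (\<Sum>i=1..n. tscale ((-1) ^ i) (coDend_comp s n 2 i f dend_mult r x))
      + tscale ((-1) ^ (n + 1)) (coDend_comp s 2 n 1 dend_mult f r x)"
    have "diff ?K n f r x = ?rhs"
    proof (cases "r \<in> {1..n + 1}")
      case True
      have r: "r \<in> {1..2 + n - 1}" "r \<in> {1..n + 2 - 1}" using True by auto
      have two: "dend_mult q = to_power2 s \<circ> two_family Dp Ds q" if "q \<in> {1..2}" for q
        using that by (auto simp: two_family_def)
      have out: "coDend_comp s 2 n 2 dend_mult f r x = id_pow_map s n (label 2 n f r) (two_family Dp Ds (R0 2 2 n r) x)"
        "coDend_comp s 2 n 1 dend_mult f r x = pow_map_id s n (label 1 n f r) (two_family Dp Ds (R0 2 1 n r) x)"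
        using two[OF R0_range[OF _ _ n r(1), of 2]] two[OF R0_range[OF _ _ n r(1), of 1]]
          slot_map_to_power2_right[OF base_vs L[OF f]] slot_map_to_power2_left[OF base_vs L[OF f]]
        by (simp_all add: coDend_comp_label[OF base_vs n _ r(1)] coEnd_comp_def)
      have mid: "coDend_comp s n 2 i f dend_mult r x = slot_map s n 2 i (label i 2 dend_mult r) (f (R0 n i 2 r) x)"
        if "i \<in> {1..n}" for i
        using that coDend_comp_label[OF base_vs _ _ r(2), of i f dend_mult] by (simp add: coEnd_comp_def)
      have "diff ?K n f r x = id_pow_map s n (label 2 n f r) (two_family Dp Ds (R0 2 2 n r) x)
        + (\<Sum>i=1..n. tscale ((-1) ^ i) (slot_map s n 2 i (label i 2 dend_mult r) (f (R0 n i 2 r) x)))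
        + tscale ((-1) ^ (n + 1)) (pow_map_id s n (label 1 n f r) (two_family Dp Ds (R0 2 1 n r) x))"
        using n True by (simp add: coDend_complex_def coDend_diff_def at_vector_R1)
      then show ?thesis unfolding out using mid by simp
    next
      case False
      then have r: "r \<notin> {1..2 + n - 1}" "r \<notin> {1..n + 2 - 1}" by auto
      show ?thesis unfolding coDend_comp_outside[OF base_vs r(1)] coDend_comp_outside[OF base_vs r(2)]
        using n False by (simp add: coDend_complex_def coDend_diff_def tscale_def fun_eq_iff sum_fun_apply)
    qed
    then show "diff ?K n f r x = (coDend_comp s 2 n 2 dend_mult f
      + (\<Sum>i=1..n. (\<lambda>r x. tscale ((-1) ^ i) (coDend_comp s n 2 i f dend_mult r x)))
      + (\<lambda>r x. tscale ((-1) ^ (n + 1)) (coDend_comp s 2 n 1 dend_mult f r x))) r x"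
      by (simp only: plus_fun_apply sum_fun_apply)
  qed
qed

end

section \<open>Coefficients in a bicomodule\<close>

lemma tensor2_eq: "tensor2 sA sB = tensors (bilinear_forms sA sB) UNIV"
  by (simp add: tensor2_def)

text \<open>
  All maps of the form \<open>f \<otimes> id\<close> and \<open>id \<otimes> f\<close> pair a tensor with a form \<open>E f \<psi>\<close> built from \<open>f\<close>; they depend
  linearly on \<open>f\<close> because \<open>E f \<psi>\<close> does.
\<close>

lemma tensor_pairing_combination:
  fixes t :: "('w, 'k::field) tens"
  assumes t: "t \<in> tensors \<Phi> UNIV"
    and forms: "\<And>\<psi>. \<psi> \<in> \<Psi> \<Longrightarrow> E f \<psi> \<in> \<Phi>" "\<And>\<psi>. \<psi> \<in> \<Psi> \<Longrightarrow> E g \<psi> \<in> \<Phi>" "\<And>\<psi>. \<psi> \<in> \<Psi> \<Longrightarrow> E h \<psi> \<in> \<Phi>"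
    and h: "\<And>\<psi> w. E h \<psi> w = a * E f \<psi> w + b * E g \<psi> w"
  shows "(\<lambda>\<psi>. if \<psi> \<in> \<Psi> then t (E h \<psi>) else 0) =
    tscale a (\<lambda>\<psi>. if \<psi> \<in> \<Psi> then t (E f \<psi>) else 0) + tscale b (\<lambda>\<psi>. if \<psi> \<in> \<Psi> then t (E g \<psi>) else 0)"
  using tensors_apply_linear[OF t forms h] by (auto simp: tscale_def fun_eq_iff)

lemma bilinear_forms_iff:
  assumes "vector_space sA" "vector_space sB"
  shows "\<phi> \<in> bilinear_forms sA sB \<longleftrightarrow>
    (\<forall>x y b. \<phi> (x + y, b) = \<phi> (x, b) + \<phi> (y, b)) \<and> (\<forall>c x b. \<phi> (sA c x, b) = c * \<phi> (x, b)) \<and>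
    (\<forall>a x y. \<phi> (a, x + y) = \<phi> (a, x) + \<phi> (a, y)) \<and> (\<forall>a c x. \<phi> (a, sB c x) = c * \<phi> (a, x))"
  by (auto simp: bilinear_forms_def linear_functional_iff[OF assms(1)] linear_functional_iff[OF assms(2)])

text \<open>
  The forms that define \<open>f \<otimes> id\<close> and \<open>id \<otimes> f\<close> pair \<open>f a\<close> with a form \<open>\<chi> d\<close> depending linearly on the
  remaining argument \<open>d\<close>.
\<close>

lemma pairing_bilinear:
  fixes sA :: "'k::field \<Rightarrow> 'a::ab_group_add \<Rightarrow> 'a" and sD :: "'k \<Rightarrow> 'd::ab_group_add \<Rightarrow> 'd"
  assumes vs: "vector_space sA" "vector_space sD" and f: "f \<in> Hom sA (tensors \<Phi> W)"
    and form: "\<And>d. \<chi> d \<in> \<Phi>"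
    and lin: "\<And>d d' w. w \<in> W \<Longrightarrow> \<chi> (d + d') w = \<chi> d w + \<chi> d' w" "\<And>c d w. w \<in> W \<Longrightarrow> \<chi> (sD c d) w = c * \<chi> d w"
  shows "(\<lambda>(a, d). f a (\<chi> d)) \<in> bilinear_forms sA sD" "(\<lambda>(d, a). f a (\<chi> d)) \<in> bilinear_forms sD sA"
proof -
  have "f a (\<chi> (d + d')) = f a (\<chi> d) + f a (\<chi> d')" for a d d'
    using tensors_apply_linear[OF Hom_apply[OF f] form[of d] form[of d'] form[of "d + d'"], of 1 1 a] lin by simp
  moreover have "f a (\<chi> (sD c d)) = c * f a (\<chi> d)" for a c d
    using tensors_apply_linear[OF Hom_apply[OF f] form[of d] form[of d] form[of "sD c d"], of c 0 a] lin by simp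
  ultimately show "(\<lambda>(a, d). f a (\<chi> d)) \<in> bilinear_forms sA sD" "(\<lambda>(d, a). f a (\<chi> d)) \<in> bilinear_forms sD sA"
    using f by (simp_all add: bilinear_forms_iff vs Hom_iff tscale_apply)
qed

lemma id_pow_form:
  fixes s :: "'k::field \<Rightarrow> 'c::ab_group_add \<Rightarrow> 'c" and sM :: "'k \<Rightarrow> 'm::ab_group_add \<Rightarrow> 'm"
  assumes s: "vector_space s" and sM: "vector_space sM"
    and f: "f \<in> Hom sM (tensor_power s n)" and \<psi>: "\<psi> \<in> multilinear_forms s (n + 1)"
  shows "(\<lambda>(c, x). f x (\<lambda>w. \<psi> (c # w))) \<in> bilinear_forms s sM"
proof (rule pairing_bilinear(2)[OF sM s f[unfolded tensor_power_def]])
  show "(\<lambda>w. \<psi> (c # w)) \<in> multilinear_forms s n" for c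
    unfolding multilinear_forms_def
  proof (intro CollectI allI impI)
    fix w :: "'c list" and i assume "length w = n" "i < n"
    then show "Vector_Spaces.linear s (*) (\<lambda>x. \<psi> (c # w[i := x]))"
      using multilinear_formsD[OF \<psi>, of "c # w" "Suc i"] by (simp add: list_update_append)
  qed
  fix c c' a and w :: "'c list" assume "w \<in> {w. length w = n}"
  then have "Vector_Spaces.linear s (*) (\<lambda>c. \<psi> (c # w))"
    using multilinear_formsD[OF \<psi>, of "0 # w" 0] by (simp add: list_update_append)
  then show "\<psi> ((c + c') # w) = \<psi> (c # w) + \<psi> (c' # w)" "\<psi> (s a c # w) = a * \<psi> (c # w)"
    by (simp_all add: linear_functional_iff[OF s])
qed

lemma pow_id_form:
  fixes s :: "'k::field \<Rightarrow> 'c::ab_group_add \<Rightarrow> 'c" and sM :: "'k \<Rightarrow> 'm::ab_group_add \<Rightarrow> 'm"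
  assumes s: "vector_space s" and sM: "vector_space sM"
    and f: "f \<in> Hom sM (tensor_power s n)" and \<psi>: "\<psi> \<in> multilinear_forms s (n + 1)"
  shows "(\<lambda>(x, c). f x (\<lambda>w. \<psi> (w @ [c]))) \<in> bilinear_forms sM s"
proof (rule pairing_bilinear(1)[OF sM s f[unfolded tensor_power_def]])
  show "(\<lambda>w. \<psi> (w @ [c])) \<in> multilinear_forms s n" for c
    unfolding multilinear_forms_def
  proof (intro CollectI allI impI)
    fix w :: "'c list" and i assume "length w = n" "i < n"
    then show "Vector_Spaces.linear s (*) (\<lambda>x. \<psi> (w[i := x] @ [c]))"
      using multilinear_formsD[OF \<psi>, of "w @ [c]" i] by (simp add: list_update_append)
  qed
  fix c c' a and w :: "'c list" assume "w \<in> {w. length w = n}"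
  then have "Vector_Spaces.linear s (*) (\<lambda>c. \<psi> (w @ [c]))"
    using multilinear_formsD[OF \<psi>, of "w @ [0]" n] by (simp add: list_update_append)
  then show "\<psi> (w @ [c + c']) = \<psi> (w @ [c]) + \<psi> (w @ [c'])" "\<psi> (w @ [s a c]) = a * \<psi> (w @ [c])"
    by (simp_all add: linear_functional_iff[OF s])
qed

lemma id_pow_map_linear:
  "id_pow_map s n f (t + t') = id_pow_map s n f t + id_pow_map s n f t'"
  "pow_map_id s n f' (u + u') = pow_map_id s n f' u + pow_map_id s n f' u'"
  by (simp_all add: id_pow_map_def pow_map_id_def fun_eq_iff)

context
  fixes s :: "'k::field \<Rightarrow> 'c::ab_group_add \<Rightarrow> 'c" and sM :: "'k \<Rightarrow> 'm::ab_group_add \<Rightarrow> 'm"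
  assumes s: "vector_space s" and sM: "vector_space sM"
begin

lemma id_pow_map_combination:
  assumes t: "t \<in> tensor2 s sM" and f: "f \<in> Hom sM (tensor_power s n)" and g: "g \<in> Hom sM (tensor_power s n)"
  shows "id_pow_map s n ((\<lambda>x. tscale a (f x)) + (\<lambda>x. tscale b (g x))) t = tscale a (id_pow_map s n f t) + tscale b (id_pow_map s n g t)"
  unfolding id_pow_map_def
  by (rule tensor_pairing_combination[OF t[unfolded tensor2_eq],
        where E = "\<lambda>f \<psi>. \<lambda>(c, x). f x (\<lambda>w. \<psi> (c # w))"])
    (rule id_pow_form[OF s sM f] id_pow_form[OF s sM g]
        id_pow_form[OF s sM Hom_power_add[OF sM Hom_power_scale[OF sM f] Hom_power_scale[OF sM g]]],
      assumption | auto simp: tscale_apply)+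

lemma id_pow_map_add_map:
  assumes "t \<in> tensor2 s sM" "f \<in> Hom sM (tensor_power s n)" "g \<in> Hom sM (tensor_power s n)"
  shows "id_pow_map s n (f + g) t = id_pow_map s n f t + id_pow_map s n g t"
  using id_pow_map_combination[OF assms, of 1 1] by simp

lemma id_pow_map_scale_map:
  assumes "t \<in> tensor2 s sM" "f \<in> Hom sM (tensor_power s n)"
  shows "id_pow_map s n (\<lambda>x. tscale a (f x)) t = tscale a (id_pow_map s n f t)"
  using id_pow_map_combination[OF assms assms(2), of a 0] by (simp add: plus_fun_def)

lemma pow_map_id_combination:
  assumes t: "t \<in> tensor2 sM s" and f: "f \<in> Hom sM (tensor_power s n)" and g: "g \<in> Hom sM (tensor_power s n)"
  shows "pow_map_id s n ((\<lambda>x. tscale a (f x)) + (\<lambda>x. tscale b (g x))) t = tscale a (pow_map_id s n f t) + tscale b (pow_map_id s n g t)"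
  unfolding pow_map_id_def
  by (rule tensor_pairing_combination[OF t[unfolded tensor2_eq],
        where E = "\<lambda>f \<psi>. \<lambda>(x, c). f x (\<lambda>w. \<psi> (w @ [c]))"])
    (rule pow_id_form[OF s sM f] pow_id_form[OF s sM g]
        pow_id_form[OF s sM Hom_power_add[OF sM Hom_power_scale[OF sM f] Hom_power_scale[OF sM g]]],
      assumption | auto simp: tscale_apply)+

lemma pow_map_id_add_map:
  assumes "t \<in> tensor2 sM s" "f \<in> Hom sM (tensor_power s n)" "g \<in> Hom sM (tensor_power s n)"
  shows "pow_map_id s n (f + g) t = pow_map_id s n f t + pow_map_id s n g t"
  using pow_map_id_combination[OF assms, of 1 1] by simp

lemma pow_map_id_scale_map:
  assumes "t \<in> tensor2 sM s" "f \<in> Hom sM (tensor_power s n)"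
  shows "pow_map_id s n (\<lambda>x. tscale a (f x)) t = tscale a (pow_map_id s n f t)"
  using pow_map_id_combination[OF assms assms(2), of a 0] by (simp add: plus_fun_def)

lemma id_pow_map_sum_map:
  assumes "t \<in> tensor2 s sM" "\<And>j. j \<in> J \<Longrightarrow> f j \<in> Hom sM (tensor_power s n)"
  shows "id_pow_map s n (\<Sum>j\<in>J. f j) t = (\<Sum>j\<in>J. id_pow_map s n (f j) t)"
  by (rule sum_additive_on[where A = "Hom sM (tensor_power s n)" and F = "\<lambda>f. id_pow_map s n f t"])
    (auto intro: Hom_power_zero[OF sM] Hom_power_add[OF sM] id_pow_map_add_map assms)

lemma pow_map_id_sum_map:
  assumes "t \<in> tensor2 sM s" "\<And>j. j \<in> J \<Longrightarrow> f j \<in> Hom sM (tensor_power s n)"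
  shows "pow_map_id s n (\<Sum>j\<in>J. f j) t = (\<Sum>j\<in>J. pow_map_id s n (f j) t)"
  by (rule sum_additive_on[where A = "Hom sM (tensor_power s n)" and F = "\<lambda>f. pow_map_id s n f t"])
    (auto intro: Hom_power_zero[OF sM] Hom_power_add[OF sM] pow_map_id_add_map assms)

lemma coHoch_linear_complex:
  assumes l: "\<And>x. l x \<in> tensor2 s sM" and r: "\<And>x. r x \<in> tensor2 sM s"
  shows "linear_complex (coHoch_complex s D sM l r)"
proof (rule linear_complex.intro)
  fix n f g and a :: 'k
  let ?K = "coHoch_complex s D sM l r"
  show "vector_space (cscale ?K)"
    by unfold_locales (auto simp: coHoch_complex_def tscale_def fun_eq_iff algebra_simps)
  show "0 \<in> cochains ?K n"
    by (simp add: coHoch_complex_def coHoch_cochains_def Hom_power_zero[OF sM])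
  show "f + g \<in> cochains ?K n" if "f \<in> cochains ?K n" "g \<in> cochains ?K n"
    using that Hom_power_add[OF sM, of f s n g]
    by (cases "n = 0") (auto simp: coHoch_complex_def coHoch_cochains_def)
  show "cscale ?K a f \<in> cochains ?K n" if "f \<in> cochains ?K n"
    using that Hom_power_scale[OF sM, of f s n a]
    by (cases "n = 0") (auto simp: coHoch_complex_def coHoch_cochains_def tscale_def fun_eq_iff)
  show "diff ?K n (f + g) = diff ?K n f + diff ?K n g" if "f \<in> cochains ?K n" "g \<in> cochains ?K n"
  proof (cases "n = 0")
    case False
    then have fg: "f \<in> Hom sM (tensor_power s n)" "g \<in> Hom sM (tensor_power s n)"
      using that by (simp_all add: coHoch_complex_def coHoch_cochains_def)
    show ?thesis
    proof
      fix x
      have "diff ?K n (f + g) x = id_pow_map s n (f + g) (l x)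
        + (\<Sum>i=1..n. tscale ((-1) ^ i) (slot_map s n 2 i (to_power2 s \<circ> D) (f x + g x)))
        + tscale ((-1) ^ (n + 1)) (pow_map_id s n (f + g) (r x))"
        unfolding coHoch_complex_def coHoch_diff_def using False by simp
      also have "\<dots> = diff ?K n f x + diff ?K n g x"
        unfolding id_pow_map_add_map[OF l fg] pow_map_id_add_map[OF r fg] slot_map_linear
          tens.scale_right_distrib sum.distrib coHoch_complex_def coHoch_diff_def
        using False by (simp only: cochain_complex.simps if_False ac_simps)
      finally show "diff ?K n (f + g) x = (diff ?K n f + diff ?K n g) x"
        by (simp only: plus_fun_apply)
    qed
  qed (simp add: coHoch_complex_def coHoch_diff_def)
  show "diff ?K n (cscale ?K a f) = cscale ?K a (diff ?K n f)" if "f \<in> cochains ?K n"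
  proof (cases "n = 0")
    case False
    then have f: "f \<in> Hom sM (tensor_power s n)"
      using that by (simp add: coHoch_complex_def coHoch_cochains_def)
    show ?thesis
    proof
      fix x
      have "diff ?K n (cscale ?K a f) x = id_pow_map s n (\<lambda>x. tscale a (f x)) (l x)
        + (\<Sum>i=1..n. tscale ((-1) ^ i) (slot_map s n 2 i (to_power2 s \<circ> D) (tscale a (f x))))
        + tscale ((-1) ^ (n + 1)) (pow_map_id s n (\<lambda>x. tscale a (f x)) (r x))"
        unfolding coHoch_complex_def coHoch_diff_def using False by simp
      also have "\<dots> = tscale a (diff ?K n f x)"
        unfolding id_pow_map_scale_map[OF l f] pow_map_id_scale_map[OF r f] slot_map_linear
          tens.scale_left_commute[of _ a] tens.scale_sum_right[symmetric] tens.scale_right_distrib[symmetric]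
          coHoch_complex_def coHoch_diff_def
        using False by (simp only: cochain_complex.simps if_False)
      finally show "diff ?K n (cscale ?K a f) x = cscale ?K a (diff ?K n f) x"
        by (simp add: coHoch_complex_def)
    qed
  qed (simp add: coHoch_complex_def coHoch_diff_def tscale_def fun_eq_iff)
qed

lemma coDend_diff_label:
  assumes "1 \<le> n" "r \<in> {1..n + 1}"
  shows "coDend_diff s Dp Ds lp ls rp rs n f r x =
    id_pow_map s n (label 2 n f r) (two_family lp ls (R0 2 2 n r) x)
    + (\<Sum>i=1..n. tscale ((-1) ^ i) (slot_map s n 2 i
        (label i 2 (two_family (to_power2 s \<circ> Dp) (to_power2 s \<circ> Ds)) r) (f (R0 n i 2 r) x)))
    + tscale ((-1) ^ (n + 1)) (pow_map_id s n (label 1 n f r) (two_family rp rs (R0 2 1 n r) x))"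
  using assms by (simp add: coDend_diff_def at_vector_R1)

lemma coDend_diff_outside: "r \<notin> {1..n + 1} \<Longrightarrow> coDend_diff s Dp Ds lp ls rp rs n f r = 0"
  by (simp add: coDend_diff_def)

lemma two_family_tensor2:
  assumes "\<And>x. a x \<in> tensor2 sA sB" "\<And>x. b x \<in> tensor2 sA sB"
  shows "two_family a b q x \<in> tensor2 sA sB"
  using assms tensors_zero[of "bilinear_forms sA sB" UNIV] by (simp add: two_family_def tensor2_eq)

lemma coDend_linear_complex:
  assumes l: "\<And>x. lp x \<in> tensor2 s sM" "\<And>x. ls x \<in> tensor2 s sM"
    and r: "\<And>x. rp x \<in> tensor2 sM s" "\<And>x. rs x \<in> tensor2 sM s"
  shows "linear_complex (coDend_complex s Dp Ds sM lp ls rp rs)"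
proof (rule linear_complex.intro)
  fix n f g and a :: 'k
  let ?K = "coDend_complex s Dp Ds sM lp ls rp rs"
  let ?d = "coDend_diff s Dp Ds lp ls rp rs"
  note tl = two_family_tensor2[OF l] and tr = two_family_tensor2[OF r]
  note L = label_Hom[OF sM]
  have sel: "cochains ?K = coDend_cochains s sM" "diff ?K = ?d" "cscale ?K = (\<lambda>a f r x. tscale a (f r x))"
    by (simp_all add: coDend_complex_def)
  show "vector_space (cscale ?K)"
    unfolding sel by unfold_locales (auto simp: tscale_def fun_eq_iff algebra_simps)
  show "0 \<in> cochains ?K n"
    by (simp add: sel coDend_cochains_def Hom_power_zero[OF sM])
  show "f + g \<in> cochains ?K n" if "f \<in> cochains ?K n" "g \<in> cochains ?K n"
  proof (cases "n = 0")
    case False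
    then show ?thesis using that unfolding sel
      by (intro coDend_cochainI)
        (auto simp: coDend_cochain_outside fun_eq_iff
          intro: Hom_power_add[OF sM coDend_cochain_Hom[OF sM] coDend_cochain_Hom[OF sM]])
  qed (use that in \<open>simp add: sel coDend_cochains_def\<close>)
  show "cscale ?K a f \<in> cochains ?K n" if "f \<in> cochains ?K n"
  proof (cases "n = 0")
    case False
    then show ?thesis using that unfolding sel
      by (intro coDend_cochainI)
        (auto simp: coDend_cochain_outside fun_eq_iff tscale_def
          intro: Hom_power_scale[OF sM coDend_cochain_Hom[OF sM], unfolded tscale_def])
  qed (use that in \<open>simp add: sel coDend_cochains_def fun_eq_iff tscale_def\<close>)
  show "diff ?K n (f + g) = diff ?K n f + diff ?K n g" if "f \<in> cochains ?K n" "g \<in> cochains ?K n"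
    unfolding sel
  proof (cases "n = 0")
    case False
    then have n: "1 \<le> n" by simp
    note f = that(1)[unfolded sel] and g = that(2)[unfolded sel]
    show "?d n (f + g) = ?d n f + ?d n g"
    proof (rule ext, rule ext)
      fix r x
      have "?d n (f + g) r x = ?d n f r x + ?d n g r x"
      proof (cases "r \<in> {1..n + 1}")
        case True
        show ?thesis
          unfolding coDend_diff_label[OF n True] label_add id_pow_map_add_map[OF tl L[OF f] L[OF g]]
            pow_map_id_add_map[OF tr L[OF f] L[OF g]] plus_fun_apply[of f g] plus_fun_apply[of "f _" "g _"]
            slot_map_linear tens.scale_right_distrib sum.distrib
          by (simp only: ac_simps)
      next
        case False
        show ?thesis unfolding coDend_diff_outside[OF False] by (simp add: fun_eq_iff)
      qed
      then show "?d n (f + g) r x = (?d n f + ?d n g) r x" by (simp only: plus_fun_apply)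
    qed
  qed (simp add: coDend_diff_def)
  show "diff ?K n (cscale ?K a f) = cscale ?K a (diff ?K n f)" if "f \<in> cochains ?K n"
    unfolding sel
  proof (cases "n = 0")
    case False
    then have n: "1 \<le> n" by simp
    note f = that(1)[unfolded sel]
    show "?d n (\<lambda>r x. tscale a (f r x)) = (\<lambda>r x. tscale a (?d n f r x))"
    proof (rule ext, rule ext)
      fix r x
      show "?d n (\<lambda>r x. tscale a (f r x)) r x = tscale a (?d n f r x)"
      proof (cases "r \<in> {1..n + 1}")
        case True
        show ?thesis
          unfolding coDend_diff_label[OF n True] label_scale id_pow_map_scale_map[OF tl L[OF f]]
            pow_map_id_scale_map[OF tr L[OF f]]
            slot_map_linear tens.scale_right_distrib tens.scale_sum_right
          by (simp only: tens.scale_left_commute)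
      next
        case False
        show ?thesis unfolding coDend_diff_outside[OF False] by (simp add: fun_eq_iff tscale_def)
      qed
    qed
  qed (simp add: coDend_diff_def fun_eq_iff tscale_def)
qed

text \<open>
  \<open>sum_labels\<close> is applied to the left coaction (\<open>m = i = 2\<close>), to the right coaction (\<open>m = 2\<close>,
  \<open>i = 1\<close>), and to the coproduct in each slot \<open>i\<close> of a cochain.
\<close>

lemma coDend_coHoch_chain_map:
  assumes D: "Dp \<in> Hom s (tensor2 s s)" "Ds \<in> Hom s (tensor2 s s)"
    and l: "\<And>x. lp x \<in> tensor2 s sM" "\<And>x. ls x \<in> tensor2 s sM"
    and r: "\<And>x. rp x \<in> tensor2 sM s" "\<And>x. rs x \<in> tensor2 sM s"
  shows "chain_map (coDend_complex s Dp Ds sM lp ls rp rs) (coHoch_complex s (Dp + Ds) sM (lp + ls) (rp + rs)) S_map"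
proof (rule chain_map.intro)
  let ?K = "coDend_complex s Dp Ds sM lp ls rp rs" and ?L = "coHoch_complex s (Dp + Ds) sM (lp + ls) (rp + rs)"
  let ?\<pi> = "two_family (to_power2 s \<circ> Dp) (to_power2 s \<circ> Ds)"
  show "linear_complex ?K" by (rule coDend_linear_complex[OF l r])
  have "(lp + ls) x \<in> tensor2 s sM" "(rp + rs) x \<in> tensor2 sM s" for x
    using tensor2_add[OF l(1)[of x] l(2)[of x]] tensor2_add[OF r(1)[of x] r(2)[of x]]
    by (simp_all add: plus_fun_def)
  then show "linear_complex ?L" by (rule coHoch_linear_complex)
  show "chain_map_axioms ?K ?L S_map"
  proof (rule chain_map_axioms.intro)
    fix n and f g :: "nat \<Rightarrow> 'm \<Rightarrow> ('c list, 'k) tens" and a :: 'k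
    show "S_map n (f + g) = S_map n f + S_map n g" by (rule S_map_add)
    show "S_map n (cscale ?K a f) = cscale ?L a (S_map n f)"
      by (simp add: coDend_complex_def coHoch_complex_def S_map_scale)
    show "S_map n f \<in> cochains ?L n" if "f \<in> cochains ?K n"
      using that S_map_Hom[OF sM, of f s n]
      by (simp add: coDend_complex_def coHoch_complex_def coHoch_cochains_def coDend_cochains_def S_map_def)
    show "diff ?L n (S_map n f) = S_map (n + 1) (diff ?K n f)" if "f \<in> cochains ?K n"
    proof (cases "n = 0")
      case True
      then show ?thesis
        by (simp add: coDend_complex_def coHoch_complex_def coHoch_diff_def coDend_diff_def S_map_def)
    next
      case False
      then have n: "1 \<le> n" by simp
      have f: "f \<in> coDend_cochains s sM n" using that by (simp add: coDend_complex_def)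
      note H = coDend_cochain_Hom[OF sM f] and SH = S_map_Hom[OF sM f]
      have \<pi>: "?\<pi> \<in> coDend_cochains s s 2" by (intro two_family_coDend to_power2_Hom s D)
      have S\<pi>: "S_map 2 ?\<pi> = to_power2 s \<circ> (Dp + Ds)"
        by (simp add: S_map_two_family fun_eq_iff to_power2_def)
      have pair: "{1..2::nat} = {1, 2}" by auto
      show ?thesis
      proof
        fix x
        have left: "(\<Sum>r=1..n+1. id_pow_map s n (label 2 n f r) (two_family lp ls (R0 2 2 n r) x)) =
            id_pow_map s n (S_map n f) ((lp + ls) x)"
        proof -
          have "(\<Sum>r=1..2+n-1. id_pow_map s n (label 2 n f r) (two_family lp ls (R0 2 2 n r) x)) =
              (\<Sum>q=1..2. id_pow_map s n (S_map n f) (two_family lp ls q x))"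
            unfolding label_def
          proof (rule sum_labels[where B = "\<lambda>q g. id_pow_map s n g (two_family lp ls q x)"])
            show "(\<Sum>j=1..n. id_pow_map s n (f j) (two_family lp ls 2 x)) =
                id_pow_map s n (S_map n f) (two_family lp ls 2 x)"
              unfolding S_map_def by (rule id_pow_map_sum_map[OF two_family_tensor2[OF l] H, symmetric])
          qed (use n in auto)
          also have "\<dots> = id_pow_map s n (S_map n f) (lp x + ls x)"
            unfolding pair id_pow_map_linear by (simp add: two_family_simps)
          finally show ?thesis by simp
        qed
        have right: "(\<Sum>r=1..n+1. pow_map_id s n (label 1 n f r) (two_family rp rs (R0 2 1 n r) x)) =
            pow_map_id s n (S_map n f) ((rp + rs) x)"
        proof -
          have "(\<Sum>r=1..2+n-1. pow_map_id s n (label 1 n f r) (two_family rp rs (R0 2 1 n r) x)) =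
              (\<Sum>q=1..2. pow_map_id s n (S_map n f) (two_family rp rs q x))"
            unfolding label_def
          proof (rule sum_labels[where B = "\<lambda>q g. pow_map_id s n g (two_family rp rs q x)"])
            show "(\<Sum>j=1..n. pow_map_id s n (f j) (two_family rp rs 1 x)) =
                pow_map_id s n (S_map n f) (two_family rp rs 1 x)"
              unfolding S_map_def by (rule pow_map_id_sum_map[OF two_family_tensor2[OF r] H, symmetric])
          qed (use n in auto)
          also have "\<dots> = pow_map_id s n (S_map n f) (rp x + rs x)"
            unfolding pair id_pow_map_linear by (simp add: two_family_simps)
          finally show ?thesis by simp
        qed
        have mid: "(\<Sum>r=1..n+1. slot_map s n 2 i (label i 2 ?\<pi> r) (f (R0 n i 2 r) x)) =
            slot_map s n 2 i (to_power2 s \<circ> (Dp + Ds)) (S_map n f x)" if i: "i \<in> {1..n}" for i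
        proof -
          have i': "1 \<le> i" "i \<le> n" using i by auto
          have "(\<Sum>r=1..n+2-1. slot_map s n 2 i (label i 2 ?\<pi> r) (f (R0 n i 2 r) x)) =
              (\<Sum>q=1..n. slot_map s n 2 i (S_map 2 ?\<pi>) (f q x))"
            unfolding label_def
          proof (rule sum_labels[where B = "\<lambda>q g. slot_map s n 2 i g (f q x)"])
            show "(\<Sum>j=1..2. slot_map s n 2 i (?\<pi> j) (f i x)) = slot_map s n 2 i (S_map 2 ?\<pi>) (f i x)"
              unfolding S_map_def
              by (rule slot_map_sum_map[OF s coDend_cochain_Hom[OF s \<pi>] i' Hom_apply[OF H], symmetric])
          qed (use i' in auto)
          also have "\<dots> = slot_map s n 2 i (S_map 2 ?\<pi>) (\<Sum>q=1..n. f q x)"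
            by (rule sum_additive_on[where A = UNIV and F = "slot_map s n 2 i (S_map 2 ?\<pi>)", symmetric])
              (simp_all only: slot_map_linear UNIV_I)
          finally show ?thesis unfolding S\<pi> by (simp add: S_map_def sum_fun_apply)
        qed
        have "S_map (n + 1) (diff ?K n f) x = (\<Sum>r=1..n+1. coDend_diff s Dp Ds lp ls rp rs n f r x)"
          by (simp add: S_map_def coDend_complex_def sum_fun_apply)
        also have "\<dots> = (\<Sum>r=1..n+1. id_pow_map s n (label 2 n f r) (two_family lp ls (R0 2 2 n r) x)
            + (\<Sum>i=1..n. tscale ((-1) ^ i) (slot_map s n 2 i (label i 2 ?\<pi> r) (f (R0 n i 2 r) x)))
            + tscale ((-1) ^ (n + 1)) (pow_map_id s n (label 1 n f r) (two_family rp rs (R0 2 1 n r) x)))"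
          by (intro sum.cong refl coDend_diff_label n)
        also have "\<dots> = id_pow_map s n (S_map n f) ((lp + ls) x)
            + (\<Sum>i=1..n. tscale ((-1) ^ i) (slot_map s n 2 i (to_power2 s \<circ> (Dp + Ds)) (S_map n f x)))
            + tscale ((-1) ^ (n + 1)) (pow_map_id s n (S_map n f) ((rp + rs) x))"
          unfolding sum.distrib left right[symmetric] tens.scale_sum_right
          by (subst sum.swap) (simp only: mid tens.scale_sum_right[symmetric] cong: sum.cong)
        also have "\<dots> = diff ?L n (S_map n f) x"
          using False by (simp add: coHoch_complex_def coHoch_diff_def)
        finally show "diff ?L n (S_map n f) x = S_map (n + 1) (diff ?K n f) x" ..
      qed
    qed
  qed
qed

end

section \<open>The associative bicomodule\<close>

context
  fixes sX :: "'k::field \<Rightarrow> 'x::ab_group_add \<Rightarrow> 'x" and sY :: "'k \<Rightarrow> 'y::ab_group_add \<Rightarrow> 'y"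
    and sD :: "'k \<Rightarrow> 'd::ab_group_add \<Rightarrow> 'd" and sA :: "'k \<Rightarrow> 'a::ab_group_add \<Rightarrow> 'a"
  assumes vs: "vector_space sX" "vector_space sY" "vector_space sD" "vector_space sA"
begin

lemma map_id_form:
  assumes f: "f \<in> Hom sA (tensor2 sX sY)" and \<psi>: "\<psi> \<in> trilinear_forms sX sY sD"
  shows "(\<lambda>(a, d). f a (\<lambda>(x, y). \<psi> (x, y, d))) \<in> bilinear_forms sA sD"
  by (rule pairing_bilinear(1)[OF vs(4,3) f[unfolded tensor2_eq]])
    (use \<psi> in \<open>auto simp: trilinear_forms_def bilinear_forms_def linear_functional_iff vs\<close>)

lemma id_map_form:
  assumes f: "f \<in> Hom sA (tensor2 sX sY)" and \<psi>: "\<psi> \<in> trilinear_forms sD sX sY"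
  shows "(\<lambda>(d, a). f a (\<lambda>(x, y). \<psi> (d, x, y))) \<in> bilinear_forms sD sA"
  by (rule pairing_bilinear(2)[OF vs(4,3) f[unfolded tensor2_eq]])
    (use \<psi> in \<open>auto simp: trilinear_forms_def bilinear_forms_def linear_functional_iff vs\<close>)

lemma map_id_add_map:
  assumes t: "t \<in> tensor2 sA sD" and f: "f \<in> Hom sA (tensor2 sX sY)" and g: "g \<in> Hom sA (tensor2 sX sY)"
  shows "map_id sX sY sD (f + g) t = map_id sX sY sD f t + map_id sX sY sD g t"
proof -
  have "map_id sX sY sD (f + g) t = tscale 1 (map_id sX sY sD f t) + tscale 1 (map_id sX sY sD g t)"
    unfolding map_id_def
    by (rule tensor_pairing_combination[OF t[unfolded tensor2_eq],
          where E = "\<lambda>f \<psi>. \<lambda>(a, d). f a (\<lambda>(x, y). \<psi> (x, y, d))"])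
      (rule map_id_form[OF f] map_id_form[OF g] map_id_form[OF Hom_tensor2_add[OF vs(4) f g]], assumption | auto)+
  then show ?thesis by simp
qed

lemma id_map_add_map:
  assumes t: "t \<in> tensor2 sD sA" and f: "f \<in> Hom sA (tensor2 sX sY)" and g: "g \<in> Hom sA (tensor2 sX sY)"
  shows "id_map sD sX sY (f + g) t = id_map sD sX sY f t + id_map sD sX sY g t"
proof -
  have "id_map sD sX sY (f + g) t = tscale 1 (id_map sD sX sY f t) + tscale 1 (id_map sD sX sY g t)"
    unfolding id_map_def
    by (rule tensor_pairing_combination[OF t[unfolded tensor2_eq],
          where E = "\<lambda>f \<psi>. \<lambda>(d, a). f a (\<lambda>(x, y). \<psi> (d, x, y))"])
      (rule id_map_form[OF f] id_map_form[OF g] id_map_form[OF Hom_tensor2_add[OF vs(4) f g]], assumption | auto)+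
  then show ?thesis by simp
qed

end

lemma map_id_linear: "map_id sX sY sD f (t + t') = map_id sX sY sD f t + map_id sX sY sD f t'"
  by (simp add: map_id_def fun_eq_iff)

lemma id_map_linear: "id_map sD sX sY f (t + t') = id_map sD sX sY f t + id_map sD sX sY f t'"
  by (simp add: id_map_def fun_eq_iff)

text \<open>
  Adding up three identities of dendriform type.  The three triples of bicomodule identities, and
  those of the coalgebra, are all of this shape.
\<close>

lemma dendriform_relations_sum:
  assumes vs: "vector_space sX" "vector_space sY" "vector_space sD" "vector_space sA" "vector_space sB"
    and f: "f \<in> Hom sA (tensor2 sX sY)" "f' \<in> Hom sA (tensor2 sX sY)" and u: "\<And>x. u x \<in> tensor2 sA sD"
    and g: "g \<in> Hom sB (tensor2 sY sD)" "g' \<in> Hom sB (tensor2 sY sD)" and v': "\<And>x. v' x \<in> tensor2 sX sB"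
    and eq: "map_id sX sY sD f \<circ> u = id_map sX sY sD (g + g') \<circ> v"
      "map_id sX sY sD f' \<circ> u = id_map sX sY sD g \<circ> v'"
      "map_id sX sY sD (f + f') \<circ> u' = id_map sX sY sD g' \<circ> v'"
  shows "map_id sX sY sD (f + f') \<circ> (u + u') = id_map sX sY sD (g + g') \<circ> (v + v')"
proof
  fix x
  have "(map_id sX sY sD (f + f') \<circ> (u + u')) x =
      map_id sX sY sD f (u x) + map_id sX sY sD f' (u x) + map_id sX sY sD (f + f') (u' x)"
    unfolding o_apply plus_fun_apply[of u] map_id_linear map_id_add_map[OF vs(1-4) u f] ..
  also have "\<dots> = id_map sX sY sD (g + g') (v x) + id_map sX sY sD g (v' x) + id_map sX sY sD g' (v' x)"
    using eq[THEN fun_cong, of x] by (simp only: o_apply)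
  also have "\<dots> = (id_map sX sY sD (g + g') \<circ> (v + v')) x"
    unfolding o_apply plus_fun_apply[of v] id_map_linear
      id_map_add_map[OF vs(2,3,1,5) v' g] by (simp only: add.assoc)
  finally show "(map_id sX sY sD (f + f') \<circ> (u + u')) x = (id_map sX sY sD (g + g') \<circ> (v + v')) x" .
qed

lemma associative_bicomodule:
  assumes coalg: "dendriform_coalgebra s Dp Ds" and bi: "dendriform_bicomodule s Dp Ds sM lp ls rp rs"
  shows "bicomodule s (Dp + Ds) sM (lp + ls) (rp + rs)"
proof -
  have s: "vector_space s" and D: "Dp \<in> Hom s (tensor2 s s)" "Ds \<in> Hom s (tensor2 s s)"
    using coalg by (simp_all add: dendriform_coalgebra_def)
  have sM: "vector_space sM" and l: "lp \<in> Hom sM (tensor2 s sM)" "ls \<in> Hom sM (tensor2 s sM)"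
    and r: "rp \<in> Hom sM (tensor2 sM s)" "rs \<in> Hom sM (tensor2 sM s)"
    using bi by (simp_all add: dendriform_bicomodule_def)
  note l' = Hom_apply[OF l(1)] Hom_apply[OF l(2)] and r' = Hom_apply[OF r(1)] Hom_apply[OF r(2)]
  note rel = bi[unfolded dendriform_bicomodule_def]
  have "map_id s s sM (Dp + Ds) \<circ> (lp + ls) = id_map s s sM (lp + ls) \<circ> (lp + ls)"
    by (rule dendriform_relations_sum[OF s s sM s sM D l'(1) l l'(2)]) (use rel in blast)+
  moreover have "map_id s sM s (lp + ls) \<circ> (rp + rs) = id_map s sM s (rp + rs) \<circ> (lp + ls)"
    by (rule dendriform_relations_sum[OF s sM s sM sM l r'(1) r l'(2)]) (use rel in blast)+
  moreover have "map_id sM s s (rp + rs) \<circ> (rp + rs) = id_map sM s s (Dp + Ds) \<circ> (rp + rs)"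
    by (rule dendriform_relations_sum[OF sM s s sM s r r'(1) D r'(2)]) (use rel in blast)+
  ultimately show ?thesis
    using sM Hom_tensor2_add[OF sM l] Hom_tensor2_add[OF sM r] by (simp add: bicomodule_def)
qed

lemma associative_coalgebra:
  assumes "dendriform_coalgebra s Dp Ds"
  shows "coassociative_coalgebra s (Dp + Ds)"
  using associative_bicomodule[OF assms dendriform_self_bicomodule[OF assms]]
  by (simp add: bicomodule_def coassociative_coalgebra_def)

section \<open>The comparison map\<close>

lemma dendriform_gerstenhaber_morphism:
  fixes s :: "'k::field \<Rightarrow> 'c::ab_group_add \<Rightarrow> 'c"
  assumes dend: "dendriform_coalgebra s Dp Ds"
  shows "gerstenhaber_morphism
       (coDend_gerstenhaber s Dp Ds) (coHoch_gerstenhaber s (Dp + Ds))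
       (\<lambda>n. induced_map (coHoch_complex s (Dp + Ds) s (Dp + Ds) (Dp + Ds)) n (S_map n))"
proof -
  have s: "vector_space s" using dend by (simp add: dendriform_coalgebra_def)
  have coassoc: "Dp + Ds \<in> Hom s (tensor2 s s)"
    "map_id s s s (Dp + Ds) \<circ> (Dp + Ds) = id_map s s s (Dp + Ds) \<circ> (Dp + Ds)"
    using associative_coalgebra[OF dend] by (simp_all add: coassociative_coalgebra_def)
  interpret operad_morphism "\<lambda>a f r x. tscale a (f r x)" "coDend_cochains s s" "coDend_comp s"
    "two_family (to_power2 s \<circ> Dp) (to_power2 s \<circ> Ds)" "coDend_complex s Dp Ds s Dp Ds Dp Ds"
    "\<lambda>a f x. tscale a (f x)" "\<lambda>n. Hom s (tensor_power s n)" "coEnd_comp s" "to_power2 s \<circ> (Dp + Ds)"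
    "coHoch_complex s (Dp + Ds) s (Dp + Ds) (Dp + Ds)" S_map
  proof (intro operad_morphism.intro operad_morphism_axioms.intro)
    fix m n i :: nat and f g :: "nat \<Rightarrow> 'c \<Rightarrow> ('c list, 'k) tens" and a :: 'k
    show "S_map n (f + g) = S_map n f + S_map n g" by (rule S_map_add)
    show "S_map n (\<lambda>r x. tscale a (f r x)) = (\<lambda>x. tscale a (S_map n f x))" by (rule S_map_scale)
    show "S_map n f \<in> Hom s (tensor_power s n)" if "f \<in> coDend_cochains s s n"
      by (rule S_map_Hom[OF s that])
    show "S_map (m + n - 1) (coDend_comp s m n i f g) = coEnd_comp s m n i (S_map m f) (S_map n g)"
      if "1 \<le> i" "i \<le> m" "1 \<le> n" "f \<in> coDend_cochains s s m" "g \<in> coDend_cochains s s n"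
      by (rule S_map_coDend_comp[OF s that])
  qed (use S_map_dend_mult[OF dend] coDend_operad_complex[OF dend] coEnd_operad_complex[OF s coassoc] in auto)
  show ?thesis
    using induced_gerstenhaber_morphism unfolding coDend_gerstenhaber_def coHoch_gerstenhaber_def .
qed

theorem theorem3p8:
  fixes s :: "'k::field_char_0 \<Rightarrow> 'c::ab_group_add \<Rightarrow> 'c"
    and Dp Ds :: "'c \<Rightarrow> ('c \<times> 'c, 'k) tens"
    and sM :: "'k \<Rightarrow> 'm::ab_group_add \<Rightarrow> 'm"
    and lp ls :: "'m \<Rightarrow> ('c \<times> 'm, 'k) tens"
    and rp rs :: "'m \<Rightarrow> ('m \<times> 'c, 'k) tens"
  assumes "dendriform_coalgebra s Dp Ds"
    and "dendriform_bicomodule s Dp Ds sM lp ls rp rs"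
  shows
    "coassociative_coalgebra s (Dp + Ds) \<and>
     bicomodule s (Dp + Ds) sM (lp + ls) (rp + rs) \<and>
     (let coDend = coDend_complex s Dp Ds sM lp ls rp rs;
          coHoch = coHoch_complex s (Dp + Ds) sM (lp + ls) (rp + rs)
      in \<forall>n\<ge>1.
        (\<forall>f\<in>cochains coDend n.
           S_map n f \<in> cochains coHoch n \<and>
           diff coHoch n (S_map n f) = S_map (n + 1) (diff coDend n f)) \<and>
        (\<forall>f\<in>cocycles coDend n.
           S_map n f \<in> cocycles coHoch n \<and>
           induced_map coHoch n (S_map n) (coclass coDend n f) = coclass coHoch n (S_map n f)) \<and>
        cohomology_linear coDend coHoch n (induced_map coHoch n (S_map n))) \<and>
     gerstenhaber_morphism
       (coDend_gerstenhaber s Dp Ds) (coHoch_gerstenhaber s (Dp + Ds))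
       (\<lambda>n. induced_map (coHoch_complex s (Dp + Ds) s (Dp + Ds) (Dp + Ds)) n (S_map n))"
proof -
  have s: "vector_space s" and D: "Dp \<in> Hom s (tensor2 s s)" "Ds \<in> Hom s (tensor2 s s)"
    using assms(1) by (simp_all add: dendriform_coalgebra_def)
  have sM: "vector_space sM" and lr: "lp \<in> Hom sM (tensor2 s sM)" "ls \<in> Hom sM (tensor2 s sM)"
    "rp \<in> Hom sM (tensor2 sM s)" "rs \<in> Hom sM (tensor2 sM s)"
    using assms(2) by (simp_all add: dendriform_bicomodule_def)
  interpret chain_map "coDend_complex s Dp Ds sM lp ls rp rs"
    "coHoch_complex s (Dp + Ds) sM (lp + ls) (rp + rs)" S_map
    by (rule coDend_coHoch_chain_map[OF s sM D lr[THEN Hom_apply]])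
  show ?thesis
    unfolding Let_def
    using associative_coalgebra[OF assms(1)] associative_bicomodule[OF assms]
      dendriform_gerstenhaber_morphism[OF assms(1)]
      F_cochain F_diff F_cocycle F_coclass F_cohomology_linear by blast
qed

end
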